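(* Let $\tau$ be a renewal process with $\mathbf P(\tau_1=n)=L(n)/n^{1+\alpha}$ for all $n\ge 1$, with $L$ slowly varying, and consider the associated disordered pinning model with quenched free energy $\mathrm f^q(\beta,h)$, quenched critical point $h_c(\beta)$ and annealed critical point $h_c^a(\beta)$. Assume that either $\alpha\in(0,1/2)$, or $\alpha=1/2$ and $L$ is such that $$\sum_{n=1}^\infty \frac{1}{n\,L(n)^2}<\infty .$$ Then there exists $\beta_2>0$ such that for all $\beta\in[0,\beta_2]$ one has $h_c(\beta)=h_c^a(\beta)$ and $$\lim_{h\to h_c^a(\beta)^+}\frac{\log \mathrm f^q(\beta,h)}{\log\big(h-h_c^a(\beta)\big)}=\alpha^{-1}.$$
   Context: Renewal process. Under the law $\mathbf P$ (expectation $\mathbf E$), $\tau=(\tau_n)_{n\ge 0}$ is a renewal sequence: $\tau_0=0$ and the increments $\tau_{n+1}-\tau_n$ (conditioned on $\tau_n<\infty$) are i.i.d. with values in $\{1,2,\dots\}\cup\{\infty\}$; $\tau$ may contain only finitely many finite terms (i.e. $\sum_{n\ge1}\mathbf P(\tau_1=n)\le 1$, and $\tau$ is not assumed recurrent). $\tau$ is also viewed as the random subset $\{\tau_k:\tau_k<\infty\}$ of $\{0,1,2,\dots\}$. Throughout, $\mathbf P(\tau_1=n)=L(n)/n^{1+\alpha}$ for all integers $n\ge1$, where $\alpha>0$ and $L:(0,\infty)\to(0,\infty)$ is slowly varying, i.e. measurable with $\lim_{x\to\infty}L(xu)/L(x)=1$ for all $u>0$. Environment. $\omega=(\omega_n)_{n\ge1}$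 is a sequence of i.i.d. real random variables (law $\mathbb P$, expectation $\mathbb E$), independent of $\tau$, with mean $0$, variance $1$ and exponential moments: $\lambda(\beta):=\log\mathbb E[\exp(\beta\omega_1)]<\infty$ for all $\beta\ge 0$. Model. For $\beta\ge0$, $h\in\mathbb R$, $N\ge1$, the partition function is $$Z_N^{\beta,h,\omega}:=\mathbf E\Big[\exp\Big(\sum_{n=1}^N(h+\beta\omega_n)\mathbf 1_{\{n\in\tau\}}\Big)\Big].$$ The quenched free energy is $\mathrm f^q(\beta,h):=\lim_{N\to\infty}\frac1N\mathbb E\log Z_N^{\beta,h,\omega}=\lim_{N\to\infty}\frac1N\log Z_N^{\beta,h,\omega}$ (the limits exist, the second one $\mathbb P$-a.s.). It is non-negative, and convex and non-decreasing in $h$. The quenched critical point is $h_c(\beta):=\inf\{h:\mathrm f^q(\beta,h)>0\}$. The annealed free energy is $\mathrm f^a(\beta,h):=\lim_{N\to\infty}\frac1N\log\mathbb E Z_N^{\beta,h,\omega}=\mathrm f^q(0,h+\lambda(\beta))$ and the annealed critical point is $h_c^a(\beta):=\inf\{h:\mathrm f^a(\beta,h)>0\}=h_c(0)-\lambda(\beta)$. *)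

theory Defs
  imports "HOL-Probability.Probability" "HOL-Library.Extended_Nat"
begin

definition slowly_varying :: "(real \<Rightarrow> real) \<Rightarrow> bool" where
  "slowly_varying L \<longleftrightarrow>
     L \<in> borel_measurable (restrict_space borel {0<..}) \<and>
     (\<forall>x>0. L x > 0) \<and>
     (\<forall>u>0. ((\<lambda>x. L (x * u) / L x) \<longlongrightarrow> 1) at_top)"

text \<open>
  A renewal sequence, possibly terminating: once it has reached infinity it stays there.
  The last assumption says that, given any finite past \<open>\<tau>\<^sub>0, \<dots>, \<tau>\<^sub>n\<close> (so that \<open>\<tau>\<^sub>n < \<infinity>\<close>),
  the next increment is distributed as \<open>\<tau>\<^sub>1\<close>; it is multiplied out to avoid conditioning
  on null events. The increment may be infinite (\<open>m = \<infinity>\<close>).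
\<close>
locale renewal_process = prob_space P for P :: "'a measure" +
  fixes \<tau> :: "nat \<Rightarrow> 'a \<Rightarrow> enat"
  assumes measurable_\<tau>: "\<And>n. \<tau> n \<in> measurable P (count_space UNIV)"
    and \<tau>_0: "AE x in P. \<tau> 0 x = 0"
    and \<tau>_increasing: "\<And>n. AE x in P. \<tau> n x < \<infinity> \<longrightarrow> \<tau> n x < \<tau> (Suc n) x"
    and \<tau>_absorbed: "\<And>n. AE x in P. \<tau> n x = \<infinity> \<longrightarrow> \<tau> (Suc n) x = \<infinity>"
    and \<tau>_renewal: "\<And>n (t :: nat \<Rightarrow> nat) (m :: enat).
      prob {x \<in> space P. (\<forall>i\<le>n. \<tau> i x = enat (t i)) \<and> \<tau> (Suc n) x = \<tau> n x + m} =
      prob {x \<in> space P. \<forall>i\<le>n. \<tau> i x = enat (t i)} * prob {x \<in> space P. \<tau> 1 x = m}"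

definition renewal_set :: "(nat \<Rightarrow> 'a \<Rightarrow> enat) \<Rightarrow> 'a \<Rightarrow> nat set" where
  "renewal_set \<tau> x = {n. \<exists>k. \<tau> k x = enat n}"

text \<open>The environment is indexed by the positive integers; \<open>\<omega> 0\<close> is unconstrained and unused.\<close>
locale environment = prob_space Q for Q :: "'b measure" +
  fixes \<omega> :: "nat \<Rightarrow> 'b \<Rightarrow> real"
  assumes indep_\<omega>: "indep_vars (\<lambda>_. borel) \<omega> {1..}"
    and identically_distributed_\<omega>: "\<And>n. n \<ge> 1 \<Longrightarrow> distr Q borel (\<omega> n) = distr Q borel (\<omega> 1)"
    and integrable_\<omega>: "integrable Q (\<omega> 1)"
    and square_integrable_\<omega>: "integrable Q (\<lambda>y. (\<omega> 1 y)\<^sup>2)"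
    and mean_\<omega>: "expectation (\<omega> 1) = 0"
    and variance_\<omega>: "variance (\<omega> 1) = 1"
    and exp_moments_\<omega>: "\<And>\<beta>. \<beta> \<ge> 0 \<Longrightarrow> integrable Q (\<lambda>y. exp (\<beta> * \<omega> 1 y))"

text \<open>
  The renewal process and the environment live on separate probability spaces \<open>P\<close> and \<open>Q\<close>,
  which encodes their independence. The partition function is a function of one realization
  \<open>w\<close> of the environment.
\<close>
definition partition_function ::
  "'a measure \<Rightarrow> (nat \<Rightarrow> 'a \<Rightarrow> enat) \<Rightarrow> real \<Rightarrow> real \<Rightarrow> (nat \<Rightarrow> real) \<Rightarrow> nat \<Rightarrow> real" where
  "partition_function P \<tau> \<beta> h w N =
     (\<integral>x. exp (\<Sum>n=1..N. (h + \<beta> * w n) * indicator (renewal_set \<tau> x) n) \<partial>P)"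

definition quenched_free_energy ::
  "'a measure \<Rightarrow> (nat \<Rightarrow> 'a \<Rightarrow> enat) \<Rightarrow> 'b measure \<Rightarrow> (nat \<Rightarrow> 'b \<Rightarrow> real) \<Rightarrow> real \<Rightarrow> real \<Rightarrow> real" where
  "quenched_free_energy P \<tau> Q \<omega> \<beta> h =
     lim (\<lambda>N. (\<integral>y. ln (partition_function P \<tau> \<beta> h (\<lambda>n. \<omega> n y) N) \<partial>Q) / real N)"

definition quenched_critical_point ::
  "'a measure \<Rightarrow> (nat \<Rightarrow> 'a \<Rightarrow> enat) \<Rightarrow> 'b measure \<Rightarrow> (nat \<Rightarrow> 'b \<Rightarrow> real) \<Rightarrow> real \<Rightarrow> real" where
  "quenched_critical_point P \<tau> Q \<omega> \<beta> = Inf {h. quenched_free_energy P \<tau> Q \<omega> \<beta> h > 0}"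

definition annealed_free_energy ::
  "'a measure \<Rightarrow> (nat \<Rightarrow> 'a \<Rightarrow> enat) \<Rightarrow> 'b measure \<Rightarrow> (nat \<Rightarrow> 'b \<Rightarrow> real) \<Rightarrow> real \<Rightarrow> real \<Rightarrow> real" where
  "annealed_free_energy P \<tau> Q \<omega> \<beta> h =
     lim (\<lambda>N. ln (\<integral>y. partition_function P \<tau> \<beta> h (\<lambda>n. \<omega> n y) N \<partial>Q) / real N)"

definition annealed_critical_point ::
  "'a measure \<Rightarrow> (nat \<Rightarrow> 'a \<Rightarrow> enat) \<Rightarrow> 'b measure \<Rightarrow> (nat \<Rightarrow> 'b \<Rightarrow> real) \<Rightarrow> real \<Rightarrow> real" where
  "annealed_critical_point P \<tau> Q \<omega> \<beta> = Inf {h. annealed_free_energy P \<tau> Q \<omega> \<beta> h > 0}"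

end

theory Submission
  imports Defs "HOL-Computational_Algebra.Formal_Power_Series" "HOL-Real_Asymp.Real_Asymp"
begin

text \<open>
  Jensen's inequality bounds the quenched free energy by the annealed one, and the annealed model is
  an explicit renewal computation. So the point is a lower bound for the quenched free energy at
  \<open>h\<^sub>c\<^sup>a(\<beta>) + v\<close> that has the annealed exponent.

  Dividing the inter-arrival law by \<open>\<rho> = P(\<tau>\<^sub>1 < \<infinity>)\<close> only shifts \<open>h\<close> by \<open>ln \<rho>\<close>, which makes the
  renewal recurrent. At the annealed critical point the partition function \<open>W\<^sub>N\<close> with free endpoint is a
  sum over renewal paths of products of \<open>1 + \<epsilon>\<^sub>n\<close>, where \<open>1 + \<epsilon>\<^sub>n = exp (\<beta> \<omega>\<^sub>n - \<lambda>(\<beta>))\<close> and the \<open>\<epsilon>\<^sub>n\<close>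
  are independent and centred with a variance \<open>\<kappa>\<close> that vanishes with \<open>\<beta>\<close>. Expanding the products
  (\<open>pinned_one_plus\<close>) rewrites \<open>W\<^sub>N\<close> as \<open>\<Sum>n\<le>N. X\<^sub>n\<close>, where \<open>X\<^sub>n\<close> is a pinned partition function with the
  renewal mass function \<open>u\<close> as its kernel and the \<open>\<epsilon>\<^sub>n\<close> as its weights. The \<open>X\<^sub>n\<close> are orthogonal, and
  \<open>E X\<^sub>n\<^sup>2\<close> is again a pinned partition function, with kernel \<open>u\<^sup>2\<close> and constant weight \<open>\<kappa>\<close>. Hence
  \<open>E W\<^sub>N\<^sup>2 \<le> 1 / (1 - \<kappa> \<Sum>u\<^sup>2)\<close> (\<open>critical_second_moment\<close>): a bound that is uniform in \<open>N\<close> for small \<open>\<beta>\<close>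
  provided that \<open>\<Sum>u\<^sup>2 < \<infinity>\<close>. This is where the assumption on \<open>\<alpha>\<close> and \<open>L\<close> enters: the generating
  function of \<open>u\<close> is \<open>1 / (1 - \<phi>)\<close>, where \<open>\<phi>\<close> is that of the kernel and
  \<open>\<bar>1 - \<phi>(e\<^sup>i\<^sup>t)\<bar> \<ge> c t\<^sup>\<alpha> L(1/t)\<close>, so Parseval's identity gives the summability
  (\<open>renewal_mass_square_summable\<close>).

  The renewal makes at least \<open>m \<approx> N\<^sup>b\<close> contacts before \<open>N\<close> with probability close to one, for every \<open>b < \<alpha>\<close>.
  Since \<open>E W\<^sub>N = 1\<close> and \<open>E W\<^sub>N\<^sup>2 \<le> 2\<close>, with probability at least \<open>1/16\<close> such paths still carry a fixed
  amount of \<open>W\<^sub>N\<close> (\<open>many_contacts_probability\<close>). Raising \<open>h\<close> by \<open>v\<close> multiplies this amount by at least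
  \<open>exp (v m)\<close>, while the path without contacts always gives a polynomial lower bound. Therefore
  \<open>E ln Z\<^sub>N \<ge> v m / 16 - O(ln N)\<close>. The mean of the logarithm of the pinned partition function is
  superadditive, so this bound in a single volume \<open>N \<approx> v powr (-1/a)\<close>, with \<open>a < b\<close>, already shows that the free
  energy is at least of order \<open>v powr (1/a)\<close> (\<open>free_energy_lower_exponent\<close>).

  Pinned partition functions are defined by their renewal recursion, for arbitrary kernels and weights.
  The same recursion then describes the quenched model, the annealed model, the renewal
  mass function, the terms \<open>X\<^sub>n\<close> and their variances.
\<close>

section \<open>Slowly varying functions\<close>

text \<open>
  The uniform convergence theorem, in additive form. If it failed along \<open>x\<^sub>n\<close> and \<open>u\<^sub>n\<close>, then most
  shifts \<open>v\<close> would still be harmless both from \<open>x\<^sub>n\<close> and, after translation, from \<open>x\<^sub>n + u\<^sub>n\<close>; a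
  common harmless shift compares \<open>h (x\<^sub>n + u\<^sub>n)\<close> with \<open>h x\<^sub>n\<close> through a third point.
\<close>
lemma slowly_varying_uniform:
  fixes h :: "real \<Rightarrow> real"
  assumes [measurable]: "h \<in> borel_measurable borel"
    and lim: "\<And>u. ((\<lambda>x. h (x + u) - h x) \<longlongrightarrow> 0) at_top"
    and "\<epsilon> > 0"
  shows "\<exists>X. \<forall>x\<ge>X. \<forall>u\<in>{0..1}. \<bar>h (x + u) - h x\<bar> < \<epsilon>"
proof (rule ccontr)
  assume "\<not> ?thesis"
  then have "\<forall>n::nat. \<exists>x u. x \<ge> real n \<and> u \<in> {0..1} \<and> \<bar>h (x + u) - h x\<bar> \<ge> \<epsilon>"
    by (meson not_le)
  then obtain x u where x: "\<And>n::nat. x n \<ge> real n" and u: "\<And>n. u n \<in> {0..1}"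
    and bad: "\<And>n. \<bar>h (x n + u n) - h (x n)\<bar> \<ge> \<epsilon>"
    by metis
  (* Along any sequence y that tends to infinity, the set of shifts in {0..2} that are harmless from n
     onwards increases to {0..2}, so its measure tends to 2. *)
  have big: "\<exists>n. measure lborel {v\<in>{0..2}. \<forall>m\<ge>n. \<bar>h (y m + v) - h (y m)\<bar> < \<epsilon> / 2} > 3 / 2"
    if y: "\<And>n::nat. y n \<ge> real n" for y
  proof -
    define V where "V n = {v\<in>{0..2::real}. \<forall>m\<ge>n. \<bar>h (y m + v) - h (y m)\<bar> < \<epsilon> / 2}" for n :: nat
    have V_sets: "V n \<in> sets lborel" for n
      unfolding V_def by measurable
    have "filterlim y at_top sequentially"
      by (rule filterlim_at_top_mono[OF filterlim_real_sequentially]) (use y in auto)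
    then have *: "(\<lambda>n. h (y n + v) - h (y n)) \<longlonglongrightarrow> 0" for v
      using lim[of v] by (rule filterlim_compose[rotated])
    have "(\<Union>n. V n) = {0..2}"
    proof (intro equalityI subsetI)
      fix v assume v: "v \<in> {0..2::real}"
      have "\<forall>\<^sub>F n in sequentially. \<bar>h (y n + v) - h (y n)\<bar> < \<epsilon> / 2"
        using tendstoD[OF *[of v], of "\<epsilon> / 2"] \<open>\<epsilon> > 0\<close> by (simp add: dist_real_def)
      then show "v \<in> (\<Union>n. V n)" using v by (auto simp: V_def eventually_sequentially)
    qed (auto simp: V_def)
    moreover have "(\<lambda>n. measure lborel (V n)) \<longlonglongrightarrow> measure lborel (\<Union>n. V n)"
    proof (rule Lim_measure_incseq)
      show "emeasure lborel (\<Union>n. V n) \<noteq> \<infinity>" unfolding calculation by simp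
    qed (use V_sets in \<open>auto simp: incseq_def V_def\<close>)
    ultimately have "(\<lambda>n. measure lborel (V n)) \<longlonglongrightarrow> 2" by simp
    then have "\<forall>\<^sub>F n in sequentially. measure lborel (V n) > 3 / 2"
      by (rule order_tendstoD) simp
    then show ?thesis unfolding V_def eventually_sequentially by auto
  qed
  define V where "V n = {v\<in>{0..2::real}. \<forall>m\<ge>n. \<bar>h (x m + v) - h (x m)\<bar> < \<epsilon> / 2}" for n :: nat
  define W where "W n = {v\<in>{0..2::real}. \<forall>m\<ge>n. \<bar>h ((x m + u m) + v) - h (x m + u m)\<bar> < \<epsilon> / 2}" for n :: nat
  obtain n1 where n1: "measure lborel (V n1) > 3 / 2"
    using big[of x] x unfolding V_def by blast
  obtain n2 where n2: "measure lborel (W n2) > 3 / 2"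
    using big[of "\<lambda>n. x n + u n"] x u unfolding W_def by (auto intro: add_increasing2)
  define n where "n = max n1 n2"
  have mono: "measure lborel A \<le> measure lborel B"
    if "A \<subseteq> B" "B \<subseteq> {0..3}" "A \<in> sets lborel" "B \<in> sets lborel" for A B :: "real set"
  proof (rule measure_mono_fmeasurable)
    show "B \<in> fmeasurable lborel"
      using that by (intro fmeasurableI) (auto intro: le_less_trans[OF emeasure_mono[of B "{0..3}"]])
  qed (use that in auto)
  have sets [measurable]: "V k \<in> sets borel" "W k \<in> sets borel" for k
    unfolding V_def W_def by measurable
  have Vn: "measure lborel (V n) > 3 / 2"
    by (rule less_le_trans[OF n1 mono]) (auto simp: n_def V_def)
  have Wn: "measure lborel (W n) > 3 / 2"
    by (rule less_le_trans[OF n2 mono]) (auto simp: n_def W_def)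
  (* V n and the translate of W n by u n lie in an interval of length 3 and have measure above 3/2 each,
     so they meet. *)
  define W' where "W' = {w. w - u n \<in> W n}"
  have W': "measure lborel W' = measure lborel (W n)"
  proof -
    have "measure lborel (W n) = measure (distr lborel borel (\<lambda>w. - u n + w)) (W n)"
      by (simp only: lborel_distr_plus)
    also have "\<dots> = measure lborel W'"
      by (subst measure_distr) (auto simp: W'_def vimage_def)
    finally show ?thesis ..
  qed
  have [measurable]: "W' \<in> sets borel" unfolding W'_def by measurable
  have sub: "V n \<union> W' \<subseteq> {0..3}"
    using u[of n] by (auto simp: V_def W'_def W_def)
  have "V n \<inter> W' \<noteq> {}"
  proof
    assume disj: "V n \<inter> W' = {}"
    have "measure lborel (V n \<union> W') = measure lborel (V n) + measure lborel W'"
    proof (rule measure_Union)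
      show "emeasure lborel (V n) \<noteq> \<infinity>" "emeasure lborel W' \<noteq> \<infinity>"
        using emeasure_mono[of "V n" "{0..3}" lborel] emeasure_mono[of W' "{0..3}" lborel] sub
        by (auto simp: top_unique)
    qed (use disj in auto)
    moreover have "measure lborel (V n \<union> W') \<le> measure lborel {0..3::real}"
      by (rule mono) (use sub in auto)
    ultimately show False using Vn Wn W' by simp
  qed
  then obtain v where v: "v \<in> V n" "v \<in> W'" by blast
  have "\<bar>h (x n + v) - h (x n)\<bar> < \<epsilon> / 2" using v(1) by (auto simp: V_def)
  moreover have "\<bar>h (x n + v) - h (x n + u n)\<bar> < \<epsilon> / 2"
    using v(2) by (auto simp: W'_def W_def)
  ultimately show False using bad[of n] by linarith
qed

text \<open>
  Potter's bound. In logarithmic coordinates, going from \<open>ln x\<close> to \<open>ln y\<close> takes about \<open>ln (y / x)\<close> steps of length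
  at most one, and by uniform convergence each changes \<open>ln L\<close> by at most \<open>\<delta>\<close>.
\<close>
lemma slowly_varying_potter:
  assumes L: "slowly_varying L" and "\<delta> > 0"
  shows "\<exists>A>0. \<exists>X\<ge>1. \<forall>x\<ge>X. \<forall>y\<ge>x. L y \<le> A * (y / x) powr \<delta> * L x \<and> L x \<le> A * (y / x) powr \<delta> * L y"
proof -
  have pos: "\<And>x. x > 0 \<Longrightarrow> L x > 0" and lim: "\<And>u. u > 0 \<Longrightarrow> ((\<lambda>x. L (x * u) / L x) \<longlongrightarrow> 1) at_top"
    and L_meas: "L \<in> borel_measurable (restrict_space borel {0<..})"
    using L by (auto simp: slowly_varying_def)
  define h where "h x = ln (L (exp x))" for x
  have [measurable]: "h \<in> borel_measurable borel"
  proof -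
    have "exp \<in> measurable borel (restrict_space borel {0::real<..})"
      by (rule measurable_restrict_space2) auto
    from measurable_compose[OF this L_meas] show ?thesis unfolding h_def by measurable
  qed
  have h_lim: "((\<lambda>x. h (x + u) - h x) \<longlongrightarrow> 0) at_top" for u
  proof -
    have "((\<lambda>x. L (exp x * exp u) / L (exp x)) \<longlongrightarrow> 1) at_top"
      using lim[of "exp u"] exp_at_top by (rule filterlim_compose) simp
    from tendsto_ln[OF this] have "((\<lambda>x. ln (L (exp x * exp u) / L (exp x))) \<longlongrightarrow> 0) at_top" by simp
    moreover have "ln (L (exp x * exp u) / L (exp x)) = h (x + u) - h x" for x
      using pos[of "exp x"] pos[of "exp x * exp u"] by (simp add: h_def ln_div exp_add)
    ultimately show ?thesis by simp
  qed
  from slowly_varying_uniform[of h, OF \<open>h \<in> borel_measurable borel\<close> h_lim \<open>\<delta> > 0\<close>] obtain X0 where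
    X0: "\<And>x u. x \<ge> X0 \<Longrightarrow> u \<in> {0..1} \<Longrightarrow> \<bar>h (x + u) - h x\<bar> < \<delta>" by blast
  have step: "\<bar>h (x + real k) - h x\<bar> \<le> \<delta> * real k" if "x \<ge> X0" for x k
  proof (induction k)
    case (Suc k)
    have "\<bar>h ((x + real k) + 1) - h (x + real k)\<bar> < \<delta>" by (rule X0) (use that in auto)
    then show ?case using Suc by (simp add: algebra_simps)
  qed simp
  have main: "\<bar>h y - h x\<bar> \<le> \<delta> * (y - x) + \<delta>" if "x \<ge> X0" "y \<ge> x" for x y
  proof -
    define k where "k = nat \<lfloor>y - x\<rfloor>"
    have k: "real k \<le> y - x" "y - x < real k + 1" unfolding k_def using that by linarith+
    have "\<bar>h ((x + real k) + (y - x - real k)) - h (x + real k)\<bar> < \<delta>"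
      by (rule X0) (use k that in auto)
    moreover have "\<delta> * real k \<le> \<delta> * (y - x)" using k \<open>\<delta> > 0\<close> by simp
    ultimately show ?thesis using step[OF that(1), of k] by (simp add: abs_le_iff) linarith
  qed
  have "L y \<le> exp \<delta> * (y / x) powr \<delta> * L x \<and> L x \<le> exp \<delta> * (y / x) powr \<delta> * L y"
    if xy: "x \<ge> max 1 (exp X0)" "y \<ge> x" for x y
  proof -
    have "x > 0" "y > 0" using xy by auto
    have "X0 \<le> ln x" using xy \<open>x > 0\<close> by (simp add: ln_ge_iff)
    moreover have "ln x \<le> ln y" using xy \<open>x > 0\<close> by simp
    ultimately have *: "\<bar>ln (L y) - ln (L x)\<bar> \<le> \<delta> * (ln y - ln x) + \<delta>"
      using main[of "ln x" "ln y"] \<open>x > 0\<close> \<open>y > 0\<close> by (simp add: h_def)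
    have e: "exp \<delta> * (y / x) powr \<delta> * L z = exp (\<delta> * (ln y - ln x) + \<delta> + ln (L z))" if "z > 0" for z
      using \<open>x > 0\<close> \<open>y > 0\<close> pos[OF that] by (simp add: powr_def exp_add ln_div mult_ac)
    show ?thesis unfolding e[OF \<open>x > 0\<close>] e[OF \<open>y > 0\<close>]
    proof
      have "exp (ln (L y)) \<le> exp (\<delta> * (ln y - ln x) + \<delta> + ln (L x))"
        "exp (ln (L x)) \<le> exp (\<delta> * (ln y - ln x) + \<delta> + ln (L y))"
        unfolding exp_le_cancel_iff using * by linarith+
      then show "L y \<le> exp (\<delta> * (ln y - ln x) + \<delta> + ln (L x))"
        "L x \<le> exp (\<delta> * (ln y - ln x) + \<delta> + ln (L y))"
        using pos[OF \<open>x > 0\<close>] pos[OF \<open>y > 0\<close>] by simp_all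
    qed
  qed
  then show ?thesis by (intro exI[of _ "exp \<delta>"] exI[of _ "max 1 (exp X0)"] conjI allI impI) auto
qed

section \<open>Pinning partition functions as renewal recursions\<close>

text \<open>
  The contribution of the paths with exactly \<open>j\<close> contacts, the last one at \<open>n\<close>, when a contact at \<open>i\<close> carries
  the weight \<open>f i\<close>. Keeping track of the number of contacts shows the dependence on a multiple of \<open>f\<close>.
\<close>
primrec pinned_steps :: "(nat \<Rightarrow> real) \<Rightarrow> (nat \<Rightarrow> real) \<Rightarrow> nat \<Rightarrow> nat \<Rightarrow> real" where
  "pinned_steps K f 0 n = (if n = 0 then 1 else 0)"
| "pinned_steps K f (Suc j) n = f n * (\<Sum>k<n. pinned_steps K f j k * K (n - k))"

definition pinned_partition :: "(nat \<Rightarrow> real) \<Rightarrow> (nat \<Rightarrow> real) \<Rightarrow> nat \<Rightarrow> real" where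
  "pinned_partition K f n = (\<Sum>j\<le>n. pinned_steps K f j n)"

definition tail :: "(nat \<Rightarrow> real) \<Rightarrow> nat \<Rightarrow> real" where
  "tail K m = 1 - (\<Sum>k=1..m. K k)"

text \<open>
  The endpoint is free: after the last contact \<open>n\<close> the next inter-arrival exceeds \<open>N - n\<close>.
\<close>
definition free_partition :: "(nat \<Rightarrow> real) \<Rightarrow> (nat \<Rightarrow> real) \<Rightarrow> nat \<Rightarrow> real" where
  "free_partition K f N = (\<Sum>n\<le>N. pinned_partition K f n * tail K (N - n))"

lemma pinned_steps_eq_0: "n < j \<Longrightarrow> pinned_steps K f j n = 0"
  by (induction j arbitrary: n) auto

lemma pinned_steps_nonneg:
  assumes "\<And>n. n \<ge> 1 \<Longrightarrow> K n \<ge> 0" "\<And>n. n \<ge> 1 \<Longrightarrow> f n \<ge> 0"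
  shows "pinned_steps K f j n \<ge> 0"
proof (induction j arbitrary: n)
  case (Suc j)
  then show ?case
    by (cases "n = 0") (auto intro!: mult_nonneg_nonneg sum_nonneg assms)
qed auto

lemma pinned_steps_scale: "pinned_steps K (\<lambda>n. c * f n) j n = c ^ j * pinned_steps K f j n"
  by (induction j arbitrary: n) (auto simp: sum_distrib_left mult_ac intro!: sum.cong)

lemma sum_pinned_steps:
  assumes "n \<le> J"
  shows "(\<Sum>j\<le>J. pinned_steps K f j n) = pinned_partition K f n"
  unfolding pinned_partition_def
  by (rule sum.mono_neutral_right) (use assms in \<open>auto simp: pinned_steps_eq_0\<close>)

lemma pinned_0 [simp]: "pinned_partition K f 0 = 1"
  by (simp add: pinned_partition_def)

lemma pinned_rec:
  assumes "n > 0"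
  shows "pinned_partition K f n = f n * (\<Sum>k<n. pinned_partition K f k * K (n - k))"
proof -
  obtain m where n: "n = Suc m" using assms gr0_implies_Suc by blast
  have "pinned_partition K f n = (\<Sum>j\<le>m. pinned_steps K f (Suc j) n)"
    unfolding pinned_partition_def n by (subst sum.atMost_Suc_shift) simp
  also have "\<dots> = f n * (\<Sum>k<n. (\<Sum>j\<le>m. pinned_steps K f j k) * K (n - k))"
    by (simp add: sum_distrib_left sum_distrib_right mult_ac) (rule sum.swap)
  also have "(\<Sum>k<n. (\<Sum>j\<le>m. pinned_steps K f j k) * K (n - k)) = (\<Sum>k<n. pinned_partition K f k * K (n - k))"
    by (rule sum.cong) (auto simp: n sum_pinned_steps)
  finally show ?thesis .
qed

lemma pinned_unique:
  assumes "z 0 = 1" "\<And>n. n > 0 \<Longrightarrow> z n = f n * (\<Sum>k<n. z k * K (n - k))"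
  shows "pinned_partition K f n = z n"
proof (induction n rule: less_induct)
  case (less n)
  show ?case
  proof (cases "n = 0")
    case False
    then show ?thesis using less by (simp add: pinned_rec assms(2))
  qed (simp add: assms)
qed

lemma pinned_cong:
  assumes "\<And>i. 1 \<le> i \<Longrightarrow> i \<le> n \<Longrightarrow> f i = g i"
  shows "pinned_partition K f n = pinned_partition K g n"
  using assms
proof (induction n rule: less_induct)
  case (less n)
  show ?case
  proof (cases "n = 0")
    case False
    have "pinned_partition K f k = pinned_partition K g k" if "k < n" for k
      using less that by auto
    then show ?thesis using less.prems[of n] False by (simp add: pinned_rec)
  qed simp
qed

lemma pinned_kernel_scale: "pinned_partition (\<lambda>n. c * K n) f n = pinned_partition K (\<lambda>n. c * f n) n"
  by (rule pinned_unique) (auto simp: pinned_rec sum_distrib_left mult_ac)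

lemma pinned_nonneg:
  assumes "\<And>n. n \<ge> 1 \<Longrightarrow> K n \<ge> 0" "\<And>n. n \<ge> 1 \<Longrightarrow> f n \<ge> 0"
  shows "pinned_partition K f n \<ge> 0"
  unfolding pinned_partition_def by (intro sum_nonneg pinned_steps_nonneg assms)

lemma pinned_ge_one_jump:
  assumes "\<And>n. n \<ge> 1 \<Longrightarrow> K n \<ge> 0" "\<And>n. n \<ge> 1 \<Longrightarrow> f n \<ge> 0" "n \<ge> 1"
  shows "pinned_partition K f n \<ge> K n * f n"
proof -
  have "pinned_partition K f 0 * K (n - 0) \<le> (\<Sum>k<n. pinned_partition K f k * K (n - k))"
    by (rule member_le_sum) (use assms in \<open>auto intro!: mult_nonneg_nonneg pinned_nonneg\<close>)
  from mult_left_mono[OF this, of "f n"] show ?thesis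
    using assms(2)[of n] assms(3) by (simp add: pinned_rec mult.commute)
qed

text \<open>
  Restricting to paths with a contact at \<open>N\<close> splits the weight into a factor for each side of \<open>N\<close>.
\<close>
lemma pinned_superadditive:
  assumes "\<And>n. n \<ge> 1 \<Longrightarrow> K n \<ge> 0" "\<And>n. n \<ge> 1 \<Longrightarrow> f n \<ge> 0"
  shows "pinned_partition K f N * pinned_partition K (\<lambda>i. f (N + i)) M \<le> pinned_partition K f (N + M)"
proof (induction M rule: less_induct)
  case (less M)
  show ?case
  proof (cases "M = 0")
    case False
    let ?g = "\<lambda>k. pinned_partition K f k * K (N + M - k)"
    have "pinned_partition K f N * (\<Sum>i<M. pinned_partition K (\<lambda>i. f (N + i)) i * K (M - i))
        \<le> (\<Sum>i<M. ?g (N + i))"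
      unfolding sum_distrib_left
    proof (rule sum_mono)
      fix i assume "i \<in> {..<M}"
      then show "pinned_partition K f N * (pinned_partition K (\<lambda>i. f (N + i)) i * K (M - i)) \<le> ?g (N + i)"
        using mult_right_mono[OF less[of i], of "K (M - i)"] assms(1)[of "M - i"] by (simp add: mult_ac)
    qed
    also have "\<dots> = sum ?g ((\<lambda>i. N + i) ` {..<M})"
      by (subst sum.reindex) auto
    also have "\<dots> \<le> (\<Sum>k<N+M. ?g k)"
      by (rule sum_mono2) (use assms in \<open>auto intro!: mult_nonneg_nonneg pinned_nonneg\<close>)
    finally have "f (N + M) * (pinned_partition K f N * (\<Sum>i<M. pinned_partition K (\<lambda>i. f (N + i)) i * K (M - i)))
        \<le> f (N + M) * (\<Sum>k<N+M. ?g k)"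
      using assms(2)[of "N + M"] False by (intro mult_left_mono) auto
    then show ?thesis using False by (simp add: pinned_rec[of M] pinned_rec[of "N + M"] mult_ac)
  qed simp
qed

lemma tail_0 [simp]: "tail K 0 = 1" by (simp add: tail_def)

lemma tail_Suc: "tail K (Suc m) = tail K m - K (Suc m)" by (simp add: tail_def)

lemma tail_decseq:
  assumes "\<And>n. n \<ge> 1 \<Longrightarrow> K n \<ge> 0" "m \<le> n"
  shows "tail K n \<le> tail K m"
  by (rule lift_Suc_antimono_le[of "tail K", OF _ assms(2)]) (use assms(1) in \<open>simp add: tail_Suc\<close>)

lemma tail_le_1:
  assumes "\<And>n. n \<ge> 1 \<Longrightarrow> K n \<ge> 0"
  shows "tail K n \<le> 1"
  using tail_decseq[of K 0 n] assms by simp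

lemma free_0 [simp]: "free_partition K f 0 = 1" by (simp add: free_partition_def)

lemma free_Suc:
  "free_partition K f (Suc N) = free_partition K f N + (f (Suc N) - 1) * (\<Sum>k<Suc N. pinned_partition K f k * K (Suc N - k))"
proof -
  have "(\<Sum>n\<le>N. pinned_partition K f n * tail K (Suc N - n))
      = (\<Sum>n\<le>N. pinned_partition K f n * tail K (N - n) - pinned_partition K f n * K (Suc N - n))"
    by (rule sum.cong) (auto simp: Suc_diff_le tail_Suc algebra_simps)
  then show ?thesis
    by (simp add: free_partition_def pinned_rec[of "Suc N"] sum_subtractf lessThan_Suc_atMost algebra_simps)
qed

text \<open>
  Without reward this is total probability, decomposed by the last contact.
\<close>
lemma free_one: "free_partition K (\<lambda>_. 1) N = 1"
  by (induction N) (simp_all add: free_Suc)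

lemma free_ge_tail:
  assumes "\<And>n. n \<ge> 1 \<Longrightarrow> K n \<ge> 0" "\<And>n. n \<ge> 1 \<Longrightarrow> f n \<ge> 0" "\<And>m. tail K m \<ge> 0"
  shows "free_partition K f N \<ge> tail K N"
proof -
  have "pinned_partition K f 0 * tail K (N - 0) \<le> free_partition K f N" unfolding free_partition_def
    by (rule member_le_sum) (use assms in \<open>auto intro!: mult_nonneg_nonneg pinned_nonneg\<close>)
  then show ?thesis by simp
qed

lemma pinned_le_free:
  assumes "\<And>n. n \<ge> 1 \<Longrightarrow> K n \<ge> 0" "\<And>n. n \<ge> 1 \<Longrightarrow> f n \<ge> 0" "\<And>m. tail K m \<ge> 0"
  shows "pinned_partition K f N \<le> free_partition K f N"
proof -
  have "pinned_partition K f N * tail K (N - N) \<le> free_partition K f N" unfolding free_partition_def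
    by (rule member_le_sum[where f="\<lambda>n. pinned_partition K f n * tail K (N - n)"])
       (use assms in \<open>auto intro!: mult_nonneg_nonneg pinned_nonneg\<close>)
  then show ?thesis by simp
qed

text \<open>
  A path with a free end can be completed by a last jump to \<open>N\<close>. The factor \<open>B\<close> is what it costs to replace
  the probability of a jump beyond \<open>N\<close> by that of a jump exactly to \<open>N\<close>.
\<close>
lemma free_le_pinned:
  assumes "\<And>n. n \<ge> 1 \<Longrightarrow> K n \<ge> 0" "\<And>n. n \<ge> 1 \<Longrightarrow> f n > 0" "N \<ge> 1"
    and B: "\<And>m. 1 \<le> m \<Longrightarrow> m \<le> N \<Longrightarrow> tail K m \<le> B * K m"
  shows "free_partition K f N \<le> pinned_partition K f N * (1 + B / f N)"
proof -
  have f: "f N > 0" using assms by auto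
  obtain M where N: "N = Suc M" using assms by (metis Suc_le_D One_nat_def)
  have "free_partition K f N = pinned_partition K f N + (\<Sum>n<N. pinned_partition K f n * tail K (N - n))"
    unfolding free_partition_def N by (simp add: lessThan_Suc_atMost)
  also have "(\<Sum>n<N. pinned_partition K f n * tail K (N - n)) \<le> (\<Sum>n<N. pinned_partition K f n * (B * K (N - n)))"
  proof (rule sum_mono)
    fix n assume "n \<in> {..<N}"
    moreover have "pinned_partition K f n \<ge> 0"
      using assms by (intro pinned_nonneg) (auto intro: less_imp_le)
    ultimately show "pinned_partition K f n * tail K (N - n) \<le> pinned_partition K f n * (B * K (N - n))"
      by (intro mult_left_mono B) auto
  qed
  also have "\<dots> = B * (\<Sum>n<N. pinned_partition K f n * K (N - n))"
    by (simp add: sum_distrib_left mult_ac)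
  also have "\<dots> = B * pinned_partition K f N / f N"
    using f assms(3) by (simp add: pinned_rec[of N])
  finally show ?thesis by (simp add: algebra_simps)
qed

lemma sum_pinned_const:
  "(1 - x) * (\<Sum>n\<le>N. pinned_partition K (\<lambda>_. x) n) = 1 - x * free_partition K (\<lambda>_. x) N"
proof (induction N)
  case (Suc N)
  then show ?case
    by (simp add: free_Suc pinned_rec[of "Suc N"] algebra_simps)
qed (simp add: algebra_simps)

text \<open>
  With weight \<open>x\<close> this is the expectation of \<open>x\<close> to the power of the number of contacts up to \<open>N\<close>. It is small if
  \<open>1 - x\<close> is much larger than the mean tail, which says that few contacts are unlikely.
\<close>
lemma free_const_le:
  assumes K: "\<And>n. n \<ge> 1 \<Longrightarrow> K n \<ge> 0" and T: "\<And>m. tail K m \<ge> 0" and x: "0 \<le> x" "x < 1"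
  shows "free_partition K (\<lambda>_. x) N \<le> (\<Sum>m\<le>N. tail K m) / real (N + 1) / (1 - x)"
proof -
  let ?z = "pinned_partition K (\<lambda>_. x)" and ?F = "free_partition K (\<lambda>_. x)"
  have z: "?z n \<ge> 0" for n using K x by (intro pinned_nonneg) auto
  have F: "?F n \<ge> 0" for n
    unfolding free_partition_def by (intro sum_nonneg mult_nonneg_nonneg z T)
  have dec: "?F (Suc n) \<le> ?F n" for n
  proof -
    have "(\<Sum>k<Suc n. ?z k * K (Suc n - k)) \<ge> 0"
      by (intro sum_nonneg mult_nonneg_nonneg z K) auto
    then have "(1 - x) * (\<Sum>k<Suc n. ?z k * K (Suc n - k)) \<ge> 0"
      using x by (intro mult_nonneg_nonneg) auto
    then show ?thesis unfolding free_Suc by (simp add: algebra_simps)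
  qed
  (* F is decreasing, so its last value is at most its average, which is a truncated Cauchy product. *)
  have "real (N + 1) * ?F N = (\<Sum>n\<le>N. ?F N)" by simp
  also have "\<dots> \<le> (\<Sum>n\<le>N. ?F n)"
    by (rule sum_mono) (use lift_Suc_antimono_le[of ?F, OF dec] in auto)
  also have "\<dots> = (\<Sum>(i,j)\<in>{(i,j). i+j \<le> N}. ?z i * tail K j)"
    unfolding free_partition_def by (rule sum.triangle_reindex_eq[symmetric])
  also have "\<dots> \<le> (\<Sum>(i,j)\<in>{..N} \<times> {..N}. ?z i * tail K j)"
    by (rule sum_mono2) (auto intro!: mult_nonneg_nonneg z T)
  also have "\<dots> = (\<Sum>i\<le>N. ?z i) * (\<Sum>j\<le>N. tail K j)"
    by (simp add: sum.cartesian_product[symmetric] sum_product)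
  also have "\<dots> \<le> 1 / (1 - x) * (\<Sum>j\<le>N. tail K j)"
  proof (rule mult_right_mono)
    have "(1 - x) * (\<Sum>i\<le>N. ?z i) \<le> 1"
      unfolding sum_pinned_const using x F[of N] by simp
    then show "(\<Sum>i\<le>N. ?z i) \<le> 1 / (1 - x)" using x by (simp add: field_simps)
  qed (auto intro!: sum_nonneg T)
  finally have "?F N \<le> (1 / (1 - x) * (\<Sum>j\<le>N. tail K j)) / real (N + 1)"
    by (subst pos_le_divide_eq) (auto simp: mult.commute)
  then show ?thesis by (simp add: mult.commute)
qed

text \<open>
  Expanding the products of \<open>1 + g\<close> selects a subset of the contacts, and summing over the other ones
  turns each gap between selected contacts into the renewal mass function \<open>u\<close>; for the free partition function
  the piece after the last selected contact sums to one. With generating functions: \<open>U (1 - K) = 1\<close>, and \<open>Y U\<close>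
  satisfies the recursion for the weights \<open>1 + g\<close>, where \<open>U\<close> and \<open>Y\<close> belong to \<open>u\<close> and to the selected contacts.
\<close>
lemma pinned_one_plus:
  fixes K g defines "u \<equiv> pinned_partition K (\<lambda>_. 1)"
  shows "pinned_partition K (\<lambda>n. 1 + g n) n = (\<Sum>k\<le>n. pinned_partition u g k * u (n - k))"
    and "free_partition K (\<lambda>n. 1 + g n) N = (\<Sum>n\<le>N. pinned_partition u g n)"
proof -
  define U where "U = Abs_fps u"
  define Y where "Y = Abs_fps (pinned_partition u g)"
  define KK where "KK = Abs_fps (\<lambda>n. if n = 0 then 0 else K n)"
  define T where "T = Abs_fps (tail K)"
  have conv: "(\<Sum>i=0..n. a i * fps_nth KK (n - i)) = (\<Sum>i<n. a i * K (n - i))" for a n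
    by (rule sum.mono_neutral_cong_right) (auto simp: KK_def)
  have UK: "U * (1 - KK) = 1"
  proof (rule fps_ext)
    fix n
    have "fps_nth (U * KK) n = (\<Sum>k<n. u k * K (n - k))"
      by (simp add: fps_mult_nth U_def conv)
    then show "fps_nth (U * (1 - KK)) n = fps_nth 1 n"
      by (cases "n = 0") (auto simp: algebra_simps U_def u_def pinned_rec[of n])
  qed
  define Z where "Z = Y * U"
  have Z_nth: "fps_nth Z n = (\<Sum>k\<le>n. pinned_partition u g k * u (n - k))" for n
    by (simp add: Z_def Y_def U_def fps_mult_nth atLeast0AtMost)
  have ZK: "Z * KK = Z - Y"
  proof -
    have "Z * (1 - KK) = Y" unfolding Z_def using UK by (simp add: mult.assoc)
    then show ?thesis by (simp add: algebra_simps)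
  qed
  have main: "pinned_partition K (\<lambda>n. 1 + g n) n = fps_nth Z n" for n
  proof (rule pinned_unique)
    show "fps_nth Z 0 = 1" by (simp add: Z_nth u_def)
    fix n :: nat assume n: "n > 0"
    have "fps_nth Z n = pinned_partition u g n + (\<Sum>k<n. pinned_partition u g k * u (n - k))"
      unfolding Z_nth using n by (simp add: lessThan_Suc_atMost[symmetric] u_def)
    moreover have "(\<Sum>k<n. fps_nth Z k * K (n - k)) = fps_nth Z n - pinned_partition u g n"
      using arg_cong[OF ZK, of "\<lambda>f. fps_nth f n"] by (simp add: fps_mult_nth conv Y_def)
    moreover have "pinned_partition u g n = g n * (\<Sum>k<n. pinned_partition u g k * u (n - k))"
      by (rule pinned_rec[OF n])
    ultimately show "fps_nth Z n = (1 + g n) * (\<Sum>k<n. fps_nth Z k * K (n - k))"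
      by (simp add: algebra_simps)
  qed
  show "pinned_partition K (\<lambda>n. 1 + g n) n = (\<Sum>k\<le>n. pinned_partition u g k * u (n - k))"
    by (simp add: main Z_nth)
  have UT: "U * T = Abs_fps (\<lambda>_. 1)"
  proof (rule fps_ext)
    fix n
    show "fps_nth (U * T) n = fps_nth (Abs_fps (\<lambda>_. 1)) n"
      using free_one[of K n] by (simp add: free_partition_def fps_mult_nth U_def T_def u_def atLeast0AtMost)
  qed
  have "free_partition K (\<lambda>n. 1 + g n) N = fps_nth (Z * T) N"
    by (simp add: free_partition_def main fps_mult_nth T_def atLeast0AtMost)
  also have "Z * T = Y * Abs_fps (\<lambda>_. 1)"
    unfolding Z_def UT[symmetric] by (simp add: mult.assoc)
  also have "fps_nth \<dots> N = (\<Sum>n\<le>N. pinned_partition u g n)"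
    by (simp add: fps_mult_nth Y_def atLeast0AtMost)
  finally show "free_partition K (\<lambda>n. 1 + g n) N = (\<Sum>n\<le>N. pinned_partition u g n)" .
qed

text \<open>
  Chernoff's bound, used as a substitute for the restriction to paths with at least \<open>m\<close> contacts: the second
  term on the left dominates the weight of the paths with fewer contacts.
\<close>
lemma free_tilt:
  assumes "\<And>n. n \<ge> 1 \<Longrightarrow> K n \<ge> 0" "\<And>n. n \<ge> 1 \<Longrightarrow> f n \<ge> 0" "\<And>m. tail K m \<ge> 0"
    and vs: "v \<ge> 0" "s \<ge> 0"
  shows "exp (v * m) * (free_partition K f N - exp (s * m) * free_partition K (\<lambda>n. exp (- s) * f n) N)
    \<le> free_partition K (\<lambda>n. exp v * f n) N"
proof -
  (* Compare the coefficients of the paths with j contacts: for j < m the left side is negative. *)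
  have e: "exp (v * m) * (1 - exp (s * m) * exp (- s) ^ j) \<le> exp v ^ j" for j
  proof -
    have p: "exp v ^ j = exp (v * j)" "exp (s * m) * exp (- s) ^ j = exp (s * (m - j))"
      by (simp_all add: exp_of_nat2_mult[symmetric] exp_add[symmetric] algebra_simps)
    show ?thesis
    proof (cases "m \<le> j")
      case True
      have "exp (v * m) * (1 - exp (s * (m - j))) \<le> exp (v * m) * 1"
        by (intro mult_left_mono) auto
      also have "\<dots> \<le> exp (v * j)" using True vs by (simp add: mult_left_mono)
      finally show ?thesis unfolding p .
    next
      case False
      then have "1 - exp (s * (m - j)) \<le> 0" using vs by simp
      then have "exp (v * m) * (1 - exp (s * (m - j))) \<le> 0"
        by (simp add: mult_nonneg_nonpos)
      also have "0 \<le> exp (v * j)" by simp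
      finally show ?thesis unfolding p .
    qed
  qed
  have "exp (v * m) * (pinned_partition K f n - exp (s * m) * pinned_partition K (\<lambda>n. exp (- s) * f n) n)
      \<le> pinned_partition K (\<lambda>n. exp v * f n) n" for n
  proof -
    have "exp (v * m) * (pinned_partition K f n - exp (s * m) * pinned_partition K (\<lambda>n. exp (- s) * f n) n)
      = (\<Sum>j\<le>n. exp (v * m) * (1 - exp (s * m) * exp (- s) ^ j) * pinned_steps K f j n)"
      unfolding pinned_partition_def pinned_steps_scale by (simp add: sum_distrib_left sum_subtractf algebra_simps)
    also have "\<dots> \<le> (\<Sum>j\<le>n. exp v ^ j * pinned_steps K f j n)"
      by (intro sum_mono mult_right_mono e pinned_steps_nonneg assms)
    also have "\<dots> = pinned_partition K (\<lambda>n. exp v * f n) n"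
      unfolding pinned_partition_def pinned_steps_scale ..
    finally show ?thesis .
  qed
  then have "(\<Sum>n\<le>N. exp (v * m) * (pinned_partition K f n - exp (s * m) * pinned_partition K (\<lambda>n. exp (- s) * f n) n)
      * tail K (N - n)) \<le> free_partition K (\<lambda>n. exp v * f n) N"
    unfolding free_partition_def by (intro sum_mono mult_right_mono assms)
  then show ?thesis
    by (simp add: free_partition_def sum_distrib_left sum_subtractf algebra_simps)
qed

lemma pinned_le_exp:
  assumes "\<And>n. n \<ge> 1 \<Longrightarrow> K n \<ge> 0" "\<And>m. tail K m \<ge> 0" "\<And>n. n \<ge> 1 \<Longrightarrow> f n \<ge> 0"
    and y: "\<And>n. n \<ge> 1 \<Longrightarrow> f n \<le> exp (a n)" "\<And>n. n \<ge> 1 \<Longrightarrow> a n \<ge> 0"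
  shows "pinned_partition K f n \<le> exp (\<Sum>i=1..n. a i)"
proof (induction n rule: less_induct)
  case (less n)
  show ?case
  proof (cases n)
    case (Suc m)
    have "(\<Sum>k<n. pinned_partition K f k * K (n - k)) \<le> (\<Sum>k<n. exp (\<Sum>i=1..m. a i) * K (n - k))"
    proof (rule sum_mono)
      fix k assume k: "k \<in> {..<n}"
      have "pinned_partition K f k \<le> exp (\<Sum>i=1..k. a i)" using less k by simp
      also have "\<dots> \<le> exp (\<Sum>i=1..m. a i)"
        using k Suc y by (auto intro!: sum_mono2)
      finally show "pinned_partition K f k * K (n - k) \<le> exp (\<Sum>i=1..m. a i) * K (n - k)"
        using k assms by (intro mult_right_mono) auto
    qed
    also have "\<dots> = exp (\<Sum>i=1..m. a i) * (\<Sum>k<n. K (n - k))" by (simp add: sum_distrib_left)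
    also have "(\<Sum>k<n. K (n - k)) = (\<Sum>k=1..n. K k)"
      by (rule sum.reindex_bij_witness[of _ "\<lambda>k. n - k" "\<lambda>k. n - k"]) auto
    also have "exp (\<Sum>i=1..m. a i) * (\<Sum>k=1..n. K k) \<le> exp (\<Sum>i=1..m. a i) * 1"
      using assms(2)[of n] by (intro mult_left_mono) (auto simp: tail_def)
    finally have *: "(\<Sum>k<n. pinned_partition K f k * K (n - k)) \<le> exp (\<Sum>i=1..m. a i)" by simp
    have "pinned_partition K f n \<le> exp (a n) * exp (\<Sum>i=1..m. a i)"
    proof -
      have "(\<Sum>k<n. pinned_partition K f k * K (n - k)) \<ge> 0"
        by (intro sum_nonneg mult_nonneg_nonneg pinned_nonneg assms(1,3)) auto
      then show ?thesis
        using Suc y(1)[of n] assms(3)[of n] unfolding pinned_rec[of n, OF zero_less_Suc[of m, folded Suc]]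
        by (intro mult_mono *) auto
    qed
    then show ?thesis by (simp add: Suc exp_add mult.commute)
  qed simp
qed

text \<open>
  Tilting the kernel by \<open>exp (- s k)\<close> makes it so defective that the reward \<open>v\<close> no longer compensates.
\<close>
lemma pinned_const_le_exp:
  assumes K: "\<And>n. n \<ge> 1 \<Longrightarrow> K n \<ge> 0" and T: "\<And>n. (\<Sum>k=1..n. K k * exp (- s * real k)) \<le> exp (- v)"
  shows "pinned_partition K (\<lambda>_. exp v) n \<le> exp (s * real n)"
proof (induction n rule: less_induct)
  case (less n)
  show ?case
  proof (cases "n = 0")
    case False
    have "(\<Sum>k<n. pinned_partition K (\<lambda>_. exp v) k * K (n - k)) \<le> (\<Sum>k<n. exp (s * real k) * K (n - k))"
      by (intro sum_mono mult_right_mono less K) auto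
    also have "\<dots> = (\<Sum>k<n. exp (s * real n) * (K (n - k) * exp (- s * real (n - k))))"
      by (rule sum.cong) (auto simp: of_nat_diff exp_diff exp_minus algebra_simps)
    also have "\<dots> = exp (s * real n) * (\<Sum>k=1..n. K k * exp (- s * real k))"
      unfolding sum_distrib_left
      by (rule sum.reindex_bij_witness[of _ "\<lambda>k. n - k" "\<lambda>k. n - k"]) auto
    also have "\<dots> \<le> exp (s * real n) * exp (- v)"
      by (intro mult_left_mono T) auto
    finally have "exp v * (\<Sum>k<n. pinned_partition K (\<lambda>_. exp v) k * K (n - k)) \<le> exp v * (exp (s * real n) * exp (- v))"
      by (intro mult_left_mono) auto
    also have "\<dots> = exp (s * real n)" by (simp add: exp_minus field_simps)
    finally show ?thesis using False by (simp add: pinned_rec)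
  qed simp
qed

section \<open>Inter-arrival laws with regularly varying tails\<close>

text \<open>
  The total mass one makes the renewal recurrent. Then the tails tend to zero, so that many contacts are likely,
  and the annealed model is critical at zero reward.
\<close>
locale pinning_kernel =
  fixes K :: "nat \<Rightarrow> real" and \<alpha> :: real and L :: "real \<Rightarrow> real"
  assumes L: "slowly_varying L" and \<alpha>_pos: "\<alpha> > 0"
    and K_eq: "\<And>n. n \<ge> 1 \<Longrightarrow> K n = L (real n) / real n powr (1 + \<alpha>)"
    and K_sums: "(\<lambda>n. K (Suc n)) sums 1"
begin

lemma L_pos: "x > 0 \<Longrightarrow> L x > 0"
  using L by (auto simp: slowly_varying_def)

lemma K_pos: "n \<ge> 1 \<Longrightarrow> K n > 0"
  by (simp add: K_eq L_pos)

lemma K_nonneg: "n \<ge> 1 \<Longrightarrow> K n \<ge> 0"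
  using K_pos less_imp_le by blast

lemma tail_suminf: "(\<lambda>k. K (Suc (m + k))) sums tail K m"
proof -
  have "(\<Sum>k=1..m. K k) = (\<Sum>k<m. K (Suc k))"
    by (simp add: sum.shift_bounds_cl_Suc_ivl[of _ 0] flip: sum.atLeast1_atMost_eq lessThan_Suc_atMost)
  with sums_split_initial_segment[OF K_sums, of m] show ?thesis
    by (simp add: tail_def add.commute)
qed

lemma tail_nonneg: "tail K m \<ge> 0"
  using sums_le[OF _ sums_zero tail_suminf[of m]] K_nonneg by auto

text \<open>
  Potter's bound covers large arguments; the finitely many other ones only affect the constant.
\<close>
lemma L_poly_bounds:
  assumes "\<delta> > 0"
  shows "\<exists>C>0. \<forall>n\<ge>1. L (real n) \<le> C * real n powr \<delta> \<and> real n powr (- \<delta>) \<le> C * L (real n)"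
proof -
  obtain A X where A: "A > 0" and X: "X \<ge> 1" and pot: "\<And>x y. x \<ge> X \<Longrightarrow> y \<ge> x \<Longrightarrow>
      L y \<le> A * (y / x) powr \<delta> * L x \<and> L x \<le> A * (y / x) powr \<delta> * L y"
    using slowly_varying_potter[OF L assms] by blast
  define M where "M = nat \<lceil>X\<rceil>"
  have M: "real M \<ge> X" "M \<ge> 1" using X unfolding M_def by linarith+
  define C where "C = A * L M + A / L M + (\<Sum>n=1..M. L (real n)) + (\<Sum>n=1..M. 1 / L (real n))"
  have LM: "L M > 0" using M L_pos by simp
  have s: "(\<Sum>n=1..M. L (real n)) \<ge> 0" "(\<Sum>n=1..M. 1 / L (real n)) \<ge> 0"
    by (auto intro!: sum_nonneg divide_nonneg_nonneg less_imp_le[OF L_pos])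
  have C: "C \<ge> A * L M" "C \<ge> A / L M" "C > 0" "C \<ge> (\<Sum>n=1..M. L (real n))" "C \<ge> (\<Sum>n=1..M. 1 / L (real n))"
    using A LM s by (auto simp: C_def add_increasing add_pos_nonneg add_nonneg_nonneg add_pos_pos)
  have "L (real n) \<le> C * real n powr \<delta> \<and> real n powr (- \<delta>) \<le> C * L (real n)" if n: "n \<ge> 1" for n
  proof (cases "n \<le> M")
    case True
    have Ln: "L (real n) > 0" using n L_pos by simp
    have "L (real n) \<le> (\<Sum>n=1..M. L (real n))"
      by (rule member_le_sum) (use n True in \<open>auto intro: less_imp_le[OF L_pos]\<close>)
    also have "\<dots> \<le> C * 1" using C by simp
    also have "\<dots> \<le> C * real n powr \<delta>"
      using n assms C by (intro mult_left_mono ge_one_powr_ge_zero) auto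
    finally have 1: "L (real n) \<le> C * real n powr \<delta>" .
    have "1 / L (real n) \<le> (\<Sum>n=1..M. 1 / L (real n))"
      by (rule member_le_sum[where f="\<lambda>n. 1 / L (real n)"]) (use n True in \<open>auto intro: less_imp_le[OF L_pos]\<close>)
    also have "\<dots> \<le> C" using C by simp
    finally have "1 \<le> C * L (real n)" using Ln by (simp add: field_simps)
    moreover have "real n powr (- \<delta>) \<le> real n powr 0"
      using n assms by (intro powr_mono) auto
    ultimately have "real n powr (- \<delta>) \<le> C * L (real n)" using n by simp
    with 1 show ?thesis by simp
  next
    case False
    have p: "(real n / real M) powr \<delta> \<le> real n powr \<delta>"
      using assms M n by (intro powr_mono2) (auto simp: field_simps)
    have pm: "L n \<le> A * (real n / real M) powr \<delta> * L M" "L M \<le> A * (real n / real M) powr \<delta> * L n"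
      using pot[of M n] M False by auto
    have "L n \<le> A * (real n / real M) powr \<delta> * L M" by (rule pm)
    also have "\<dots> \<le> A * real n powr \<delta> * L M" using A LM p by (intro mult_right_mono mult_left_mono) auto
    also have "\<dots> = (A * L M) * real n powr \<delta>" by simp
    also have "\<dots> \<le> C * real n powr \<delta>" using C by (intro mult_right_mono) auto
    finally have 1: "L (real n) \<le> C * real n powr \<delta>" .
    have "L n > 0" using n L_pos by simp
    have "L M \<le> A * (real n / real M) powr \<delta> * L n" by (rule pm)
    also have "\<dots> \<le> A * real n powr \<delta> * L n" using A \<open>L n > 0\<close> p by (intro mult_right_mono mult_left_mono) auto
    finally have "real n powr (- \<delta>) \<le> A / L M * L n" using LM n by (simp add: powr_minus field_simps)
    also have "\<dots> \<le> C * L n" using C \<open>L n > 0\<close> by (intro mult_right_mono) auto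
    finally show ?thesis using 1 by simp
  qed
  with \<open>C > 0\<close> show ?thesis by blast
qed

lemma K_poly_lower: "\<exists>C>0. \<forall>n\<ge>1. 1 \<le> C * real n powr (2 + \<alpha>) * K n"
proof -
  obtain C where C: "C > 0" "\<And>n. n \<ge> 1 \<Longrightarrow> real n powr (- 1) \<le> C * L (real n)"
    using L_poly_bounds[of 1] by auto
  have "1 \<le> C * real n powr (2 + \<alpha>) * K n" if n: "n \<ge> 1" for n
  proof -
    have "1 = real n powr (2 + \<alpha>) / real n powr (1 + \<alpha>) * real n powr (- 1)"
      using n by (simp add: powr_diff[symmetric] powr_add[symmetric])
    also have "\<dots> \<le> real n powr (2 + \<alpha>) / real n powr (1 + \<alpha>) * (C * L (real n))"
      using C(2)[OF n] by (intro mult_left_mono) auto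
    finally show ?thesis using n by (simp add: K_eq mult_ac)
  qed
  with C(1) show ?thesis by blast
qed

lemma K_moment_summable:
  assumes "a < \<alpha>"
  shows "summable (\<lambda>n. K (Suc n) * real (Suc n) powr a)"
proof -
  define \<delta> where "\<delta> = (\<alpha> - a) / 2"
  obtain C where C: "C > 0" "\<And>n. n \<ge> 1 \<Longrightarrow> L (real n) \<le> C * real n powr \<delta>"
    using L_poly_bounds[of \<delta>] assms by (auto simp: \<delta>_def)
  have b: "K n * real n powr a \<le> C * real n powr (-1 - \<delta>)" if n: "n \<ge> 1" for n
  proof -
    have "K n * real n powr a = L (real n) * (real n powr a / real n powr (1 + \<alpha>))"
      using n by (simp add: K_eq)
    also have "\<dots> \<le> C * real n powr \<delta> * (real n powr a / real n powr (1 + \<alpha>))"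
      using C(2)[OF n] by (intro mult_right_mono) auto
    also have "\<dots> = C * real n powr (\<delta> + (a - (1 + \<alpha>)))"
      by (simp only: powr_add powr_diff mult.assoc)
    also have "\<delta> + (a - (1 + \<alpha>)) = -1 - \<delta>" by (simp add: \<delta>_def field_simps)
    finally show ?thesis .
  qed
  have "summable (\<lambda>n. real n powr (-1 - \<delta>))"
    using assms by (subst summable_real_powr_iff) (auto simp: \<delta>_def)
  then have "summable (\<lambda>n. C * real (Suc n) powr (-1 - \<delta>))"
    by (subst (asm) summable_Suc_iff[symmetric]) (rule summable_mult)
  then show ?thesis
    by (rule summable_comparison_test'[where N=0]) (use b[of "Suc _"] K_nonneg in simp)
qed

text \<open>
  Markov's inequality for the moment of order \<open>a\<close>.
\<close>
lemma tail_upper: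
  assumes "0 \<le> a" "a < \<alpha>"
  shows "\<exists>C>0. \<forall>m. tail K m \<le> C * real (m + 1) powr (- a)"
proof -
  let ?f = "\<lambda>n. K (Suc n) * real (Suc n) powr a"
  have sf: "summable ?f" by (rule K_moment_summable[OF assms(2)])
  have f0: "?f n \<ge> 0" for n using K_nonneg[of "Suc n"] by simp
  have "tail K m \<le> (suminf ?f + 1) * real (m + 1) powr (- a)" for m
  proof -
    have "real (m + 1) powr a * tail K m = (\<Sum>k. real (m + 1) powr a * K (Suc (m + k)))"
      using sums_mult[OF tail_suminf[of m]] sums_unique by blast
    also have "\<dots> \<le> (\<Sum>k. ?f (k + m))"
    proof (rule suminf_le)
      fix k
      have "real (m + 1) powr a \<le> real (Suc (m + k)) powr a"
        using assms by (intro powr_mono2) auto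
      then show "real (m + 1) powr a * K (Suc (m + k)) \<le> ?f (k + m)"
        using K_nonneg[of "Suc (m + k)"] by (simp add: mult.commute add.commute mult_left_mono)
      show "summable (\<lambda>k. ?f (k + m))" using sf by (subst summable_iff_shift)
    qed (rule sums_summable[OF sums_mult[OF tail_suminf[of m]]])
    also have "\<dots> \<le> suminf ?f"
      using suminf_split_initial_segment[OF sf, of m] sum_nonneg[of "{..<m}" ?f] f0 by simp
    finally have "real (m + 1) powr a * tail K m \<le> suminf ?f + 1" by simp
    then show ?thesis by (simp add: powr_minus field_simps)
  qed
  moreover have "suminf ?f + 1 > 0" using suminf_nonneg[OF sf f0] by simp
  ultimately show ?thesis by blast
qed

text \<open>
  Averaging the bounds for the single tails keeps the exponent as long as \<open>a < 1\<close>.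
\<close>
lemma mean_tail_upper:
  assumes "0 \<le> a" "a < \<alpha>" "a < 1"
  shows "\<exists>C>0. \<forall>N. (\<Sum>m\<le>N. tail K m) / real (N + 1) \<le> C * real (N + 1) powr (- a)"
proof -
  obtain C where C: "C > 0" "\<And>m. tail K m \<le> C * real (m + 1) powr (- a)"
    using tail_upper[OF assms(1,2)] by blast
  have p: "(1 - a) * (\<Sum>m\<le>N. real (m + 1) powr (- a)) \<le> real (N + 1) powr (1 - a)" for N
  proof (induction N)
    case 0
    then show ?case using assms by simp
  next
    case (Suc N)
    define y where "y = real (N + 2)"
    have y: "y \<ge> 2" by (simp add: y_def)
    (* Bernoulli's inequality for the exponent 1 - a, read as weighted arithmetic and geometric means. *)
    have "((y - 1) / y) powr (1 - a) * 1 powr a \<le> (1 - a) * ((y - 1) / y) + a * 1"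
      by (rule Youngs_inequality_0) (use assms y in auto)
    also have "\<dots> = 1 - (1 - a) / y" using y by (simp add: field_simps)
    finally have "(y - 1) powr (1 - a) \<le> (1 - (1 - a) / y) * y powr (1 - a)"
      using y by (simp add: powr_divide field_simps)
    also have "\<dots> = y powr (1 - a) - (1 - a) * y powr (- a)"
      using y by (simp add: powr_diff powr_minus field_simps)
    finally have "(y - 1) powr (1 - a) + (1 - a) * y powr (- a) \<le> y powr (1 - a)" by simp
    then show ?case using Suc by (simp add: y_def algebra_simps)
  qed
  have "(\<Sum>m\<le>N. tail K m) / real (N + 1) \<le> C / (1 - a) * real (N + 1) powr (- a)" for N
  proof -
    have "(\<Sum>m\<le>N. tail K m) \<le> C * (\<Sum>m\<le>N. real (m + 1) powr (- a))"
      unfolding sum_distrib_left by (intro sum_mono C)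
    also have "\<dots> \<le> C * (real (N + 1) powr (1 - a) / (1 - a))"
      using p[of N] C assms by (intro mult_left_mono) (auto simp: field_simps)
    also have "\<dots> = C / (1 - a) * real (N + 1) powr (- a) * real (N + 1)"
      by (simp add: powr_diff powr_minus field_simps)
    finally show ?thesis by (simp add: pos_divide_le_eq del: of_nat_add of_nat_Suc)
  qed
  moreover have "C / (1 - a) > 0" using C assms by simp
  ultimately show ?thesis by blast
qed

lemma tail_lower:
  assumes "a > \<alpha>"
  shows "\<exists>c>0. \<forall>n. c * real (n + 1) powr (- a) \<le> tail K n"
proof -
  obtain C where C: "C > 0" "\<And>n. n \<ge> 1 \<Longrightarrow> real n powr (- (a - \<alpha>)) \<le> C * L (real n)"
    using L_poly_bounds[of "a - \<alpha>"] assms by auto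
  have K_lower: "real n powr (- 1 - a) / C \<le> K n" if n: "n \<ge> 1" for n
  proof -
    have "real n powr (- 1 - a) = real n powr (- (a - \<alpha>)) / real n powr (1 + \<alpha>)"
      by (simp only: powr_diff[symmetric]) (simp add: algebra_simps)
    also have "\<dots> \<le> C * L (real n) / real n powr (1 + \<alpha>)"
      using C(2)[OF n] by (intro divide_right_mono) auto
    finally show ?thesis using n C(1) by (simp add: K_eq field_simps)
  qed
  have "2 powr (- 1 - a) / C * real (n + 1) powr (- a) \<le> tail K n" for n
  proof -
    have "2 powr (- 1 - a) / C * real (n + 1) powr (- a)
        = real (n + 1) * ((2 * real (n + 1)) powr (- 1 - a) / C)"
    proof -
      have "real (n + 1) * real (n + 1) powr (- 1 - a) = real (n + 1) powr (- a)"
        by (subst powr_mult_base) auto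
      moreover have "(2 * real (n + 1)) powr (- 1 - a) = 2 powr (- 1 - a) * real (n + 1) powr (- 1 - a)"
        by (rule powr_mult)
      ultimately show ?thesis by (metis (no_types, lifting) mult.left_commute times_divide_eq_left times_divide_eq_right)
    qed
    also have "\<dots> = (\<Sum>k=n+1..2*n+1. (2 * real (n + 1)) powr (- 1 - a) / C)" by simp
    also have "\<dots> \<le> (\<Sum>k=n+1..2*n+1. K k)"
    proof (rule sum_mono)
      fix k assume k: "k \<in> {n+1..2*n+1}"
      have "(2 * real (n + 1)) powr (- 1 - a) \<le> real k powr (- 1 - a)"
        using k assms \<alpha>_pos by (intro powr_mono2') auto
      then have "(2 * real (n + 1)) powr (- 1 - a) / C \<le> real k powr (- 1 - a) / C"
        using C by (simp add: divide_right_mono)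
      with K_lower[of k] k show "(2 * real (n + 1)) powr (- 1 - a) / C \<le> K k" by simp
    qed
    also have "\<dots> = tail K n - tail K (2 * n + 1)"
      unfolding tail_def using sum.ub_add_nat[of 1 n K "n + 1"] by (simp add: mult_2)
    also have "\<dots> \<le> tail K n" using tail_nonneg by simp
    finally show ?thesis .
  qed
  moreover have "2 powr (- 1 - a) / C > 0" using C by simp
  ultimately show ?thesis by blast
qed

text \<open>
  Jumps longer than \<open>1 / s\<close> lose at least the factor \<open>exp (- 1)\<close>, and they have probability of order
  \<open>s powr \<alpha>\<close> up to a slowly varying factor. This bounds the annealed free energy from above.
\<close>
lemma laplace_upper:
  assumes "a > \<alpha>"
  shows "\<exists>c>0. \<forall>s. 0 < s \<longrightarrow> s \<le> 1 \<longrightarrow> (\<forall>n. (\<Sum>k=1..n. K k * exp (- s * real k)) \<le> 1 - c * s powr a)"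
proof -
  obtain c where c: "c > 0" "\<And>n. c * real (n + 1) powr (- a) \<le> tail K n"
    using tail_lower[OF assms] by blast
  define c' where "c' = (1 - exp (- 1)) * (c * 2 powr (- a))"
  have "(\<Sum>k=1..n. K k * exp (- s * real k)) \<le> 1 - c' * s powr a" if s: "0 < s" "s \<le> 1" for s n
  proof -
    define M where "M = nat \<lfloor>1 / s\<rfloor>"
    have M: "real M \<le> 1 / s" "1 / s < real M + 1" using s unfolding M_def by simp_all
    have "(\<Sum>k=1..n. K k * exp (- s * real k)) \<le> (\<Sum>k=1..M + n. K k * exp (- s * real k))"
      by (rule sum_mono2) (auto intro!: mult_nonneg_nonneg K_nonneg)
    also have "\<dots> = (\<Sum>k=1..M. K k * exp (- s * real k)) + (\<Sum>k=M+1..M + n. K k * exp (- s * real k))"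
      using sum.ub_add_nat[of 1 M "\<lambda>k. K k * exp (- s * real k)" n] by simp
    also have "\<dots> \<le> (\<Sum>k=1..M. K k * 1) + (\<Sum>k=M+1..M + n. K k * exp (- 1))"
    proof (intro add_mono sum_mono mult_left_mono)
      fix k assume "k \<in> {M+1..M+n}"
      then have "real k > 1 / s" using M by auto
      then show "exp (- s * real k) \<le> exp (- 1)" using s by (simp add: field_simps)
    qed (use s K_nonneg in auto)
    also have "(\<Sum>k=M+1..M + n. K k * exp (- 1)) \<le> exp (- 1) * tail K M"
    proof -
      have "(\<Sum>k=M+1..M+n. K k) = tail K M - tail K (M + n)"
        unfolding tail_def using sum.ub_add_nat[of 1 M K n] by simp
      also have "\<dots> \<le> tail K M" using tail_nonneg by simp
      finally show ?thesis by (simp add: sum_distrib_right[symmetric] mult.commute)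
    qed
    also have "(\<Sum>k=1..M. K k * 1) = 1 - tail K M" by (simp add: tail_def)
    finally have 1: "(\<Sum>k=1..n. K k * exp (- s * real k)) \<le> 1 - (1 - exp (- 1)) * tail K M"
      by (simp add: algebra_simps)
    have "c * 2 powr (- a) * s powr a = c * (2 / s) powr (- a)"
      using s by (simp add: powr_divide powr_minus field_simps)
    also have "\<dots> \<le> c * real (M + 1) powr (- a)"
    proof (rule mult_left_mono, rule powr_mono2')
      have "1 \<le> 1 / s" using s by simp
      then show "real (M + 1) \<le> 2 / s" using M by (simp add: field_simps)
    qed (use assms \<alpha>_pos c in auto)
    also have "\<dots> \<le> tail K M" by (rule c)
    finally have "(1 - exp (- 1)) * (c * 2 powr (- a) * s powr a) \<le> (1 - exp (- 1)) * tail K M"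
      by (intro mult_left_mono) auto
    moreover have "c' * s powr a = (1 - exp (- 1)) * (c * 2 powr (- a) * s powr a)" by (simp add: c'_def)
    ultimately show ?thesis using 1 by linarith
  qed
  moreover have "c' > 0" using c by (simp add: c'_def)
  ultimately show ?thesis by blast
qed

end

section \<open>Square summability of the renewal mass function\<close>

lemma integral_cos_multiple:
  fixes j :: int
  shows "((\<lambda>t. cos (of_int j * t)) has_integral (if j = 0 then pi else 0)) {0..pi}"
proof (cases "j = 0")
  case True
  then show ?thesis using has_integral_const_real[of "1::real" 0 pi] by simp
next
  case False
  have "((\<lambda>t. cos (of_int j * t)) has_integral (sin (of_int j * pi) / of_int j - sin (of_int j * 0) / of_int j)) {0..pi}"
  proof (rule fundamental_theorem_of_calculus)
    fix x :: real
    have "((\<lambda>t. sin (of_int j * t) / of_int j) has_real_derivative cos (of_int j * x)) (at x within {0..pi})"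
      using False by (auto intro!: derivative_eq_intros)
    then show "((\<lambda>t. sin (of_int j * t) / of_int j) has_vector_derivative cos (of_int j * x)) (at x within {0..pi})"
      by (simp add: has_real_derivative_iff_has_vector_derivative)
  qed simp
  moreover have "sin (of_int j * pi) = 0" by (metis mult.commute sin_npi_int)
  ultimately show ?thesis using False by simp
qed

lemma parseval_half_circle_finite:
  fixes a :: "nat \<Rightarrow> real"
  shows "((\<lambda>t. (cmod (\<Sum>n<k. complex_of_real (a n) * cis (real n * t)))\<^sup>2) has_integral pi * (\<Sum>n<k. (a n)\<^sup>2)) {0..pi}"
proof -
  have e: "(cmod (\<Sum>n<k. complex_of_real (a n) * cis (real n * t)))\<^sup>2
      = (\<Sum>n<k. \<Sum>m<k. a n * a m * cos (real_of_int (int n - int m) * t))" for t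
  proof -
    have "(cmod (\<Sum>n<k. complex_of_real (a n) * cis (real n * t)))\<^sup>2
      = (\<Sum>n<k. a n * cos (real n * t))\<^sup>2 + (\<Sum>n<k. a n * sin (real n * t))\<^sup>2"
      by (simp add: cmod_power2)
    also have "\<dots> = (\<Sum>n<k. \<Sum>m<k. a n * a m * cos (real_of_int (int n - int m) * t))"
      by (simp add: power2_eq_square sum_product sum.distrib[symmetric] cos_diff left_diff_distrib
          algebra_simps)
    finally show ?thesis .
  qed
  have "((\<lambda>t. \<Sum>n<k. \<Sum>m<k. a n * a m * cos (real_of_int (int n - int m) * t)) has_integral
      (\<Sum>n<k. \<Sum>m<k. a n * a m * (if int n - int m = 0 then pi else 0))) {0..pi}"
    by (intro has_integral_sum has_integral_mult_right integral_cos_multiple) auto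
  moreover have "(\<Sum>n<k. \<Sum>m<k. a n * a m * (if int n - int m = 0 then pi else 0)) = pi * (\<Sum>n<k. (a n)\<^sup>2)"
    by (simp add: sum_distrib_left power2_eq_square mult_ac if_distrib[of "(*) _"] sum.delta cong: if_cong)
  ultimately show ?thesis unfolding e by simp
qed

text \<open>
  Real coefficients make the modulus even, so that half of the circle suffices.
\<close>
lemma parseval_half_circle:
  fixes a :: "nat \<Rightarrow> real"
  assumes a: "summable (\<lambda>n. \<bar>a n\<bar>)"
  defines "F \<equiv> \<lambda>t. \<Sum>n. complex_of_real (a n) * cis (real n * t)"
  shows "(\<lambda>t. (cmod (F t))\<^sup>2) integrable_on {0..pi}"
    and "(\<Sum>n<k. (a n)\<^sup>2) \<le> integral {0..pi} (\<lambda>t. (cmod (F t))\<^sup>2) / pi"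
proof -
  let ?S = "\<lambda>k t. (cmod (\<Sum>n<k. complex_of_real (a n) * cis (real n * t)))\<^sup>2"
  let ?A = "\<Sum>n. \<bar>a n\<bar>"
  have bound: "cmod (\<Sum>n<k. complex_of_real (a n) * cis (real n * t)) \<le> ?A" for k t
  proof -
    have "cmod (\<Sum>n<k. complex_of_real (a n) * cis (real n * t)) \<le> (\<Sum>n<k. \<bar>a n\<bar>)"
      by (rule order_trans[OF norm_sum]) (simp add: norm_mult)
    also have "\<dots> \<le> ?A" by (rule sum_le_suminf[OF a]) auto
    finally show ?thesis .
  qed
  have conv: "(\<lambda>k. ?S k t) \<longlonglongrightarrow> (cmod (F t))\<^sup>2" for t
  proof -
    have "summable (\<lambda>n. complex_of_real (a n) * cis (real n * t))"
      by (rule summable_norm_cancel) (use a in \<open>simp add: norm_mult\<close>)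
    from summable_LIMSEQ[OF this] show ?thesis unfolding F_def by (intro tendsto_intros)
  qed
  have dc: "(\<lambda>t. (cmod (F t))\<^sup>2) integrable_on {0..pi} \<and>
      (\<lambda>k. integral {0..pi} (?S k)) \<longlonglongrightarrow> integral {0..pi} (\<lambda>t. (cmod (F t))\<^sup>2)"
  proof -
    have 1: "?S k integrable_on {0..pi}" for k
      using parseval_half_circle_finite[of a k] by (rule has_integral_integrable)
    have 2: "(\<lambda>t::real. ?A\<^sup>2) integrable_on {0..pi}" by (rule integrable_const_ivl)
    have 3: "norm (?S k t) \<le> ?A\<^sup>2" for k t using power_mono[OF bound[of t k], of 2] by simp
    show ?thesis using dominated_convergence[OF 1 2 3 conv] by blast
  qed
  then show "(\<lambda>t. (cmod (F t))\<^sup>2) integrable_on {0..pi}" by blast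
  have i: "integral {0..pi} (?S k) = pi * (\<Sum>n<k. (a n)\<^sup>2)" for k
    using parseval_half_circle_finite[of a k] by (rule integral_unique)
  have "pi * (\<Sum>n<k. (a n)\<^sup>2) \<le> integral {0..pi} (\<lambda>t. (cmod (F t))\<^sup>2)"
  proof (rule LIMSEQ_le_const)
    show "(\<lambda>k. pi * (\<Sum>n<k. (a n)\<^sup>2)) \<longlonglongrightarrow> integral {0..pi} (\<lambda>t. (cmod (F t))\<^sup>2)"
      using dc unfolding i by blast
    show "\<exists>N. \<forall>n\<ge>N. pi * (\<Sum>n<k. (a n)\<^sup>2) \<le> pi * (\<Sum>n<n. (a n)\<^sup>2)"
      by (intro exI[of _ k]) (auto intro!: mult_left_mono sum_mono2)
  qed
  then show "(\<Sum>n<k. (a n)\<^sup>2) \<le> integral {0..pi} (\<lambda>t. (cmod (F t))\<^sup>2) / pi"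
    by (simp add: field_simps)
qed

lemma cmod_square_le_inverse:
  fixes x y :: complex
  assumes "x * y = 1" "0 < g" "g \<le> cmod y"
  shows "(cmod x)\<^sup>2 \<le> 1 / g\<^sup>2"
proof -
  have "cmod x * cmod y = 1" using assms(1) by (metis norm_mult norm_one)
  then have "cmod x = 1 / cmod y" using assms(2,3) by (metis eq_divide_imp less_le_trans less_irrefl)
  also have "\<dots> \<le> 1 / g" using assms(2,3) by (intro divide_left_mono mult_pos_pos) linarith+
  finally have "(cmod x)\<^sup>2 \<le> (1 / g)\<^sup>2" by (intro power_mono) auto
  then show ?thesis by (simp add: power_divide)
qed

lemma one_minus_cos_ge:
  fixes x :: real
  assumes "0 \<le> x" "x \<le> 1"
  shows "x\<^sup>2 / 4 \<le> 1 - cos x"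
proof -
  have c: "cos t \<ge> 1 / 2" if "0 \<le> t" "t \<le> 1" for t :: real
  proof -
    have "cos (pi / 3) \<le> cos t" using that pi_gt3 by (intro cos_monotone_0_pi_le) auto
    then show ?thesis by (simp add: cos_60)
  qed
  have s: "t / 2 \<le> sin t" if "0 \<le> t" "t \<le> 1" for t :: real
  proof -
    have "sin 0 - 0 / 2 \<le> sin t - t / 2"
      by (rule DERIV_nonneg_imp_nondecreasing[OF that(1)])
         (use that c in \<open>auto intro!: derivative_eq_intros exI\<close>)
    then show ?thesis by simp
  qed
  have "1 - cos 0 - 0\<^sup>2 / 4 \<le> 1 - cos x - x\<^sup>2 / 4"
  proof (rule DERIV_nonneg_imp_nondecreasing[OF assms(1)])
    fix t assume "0 \<le> t" "t \<le> x"
    then show "\<exists>y. ((\<lambda>x. 1 - cos x - x\<^sup>2 / 4) has_real_derivative y) (at t) \<and> 0 \<le> y"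
      using s[of t] assms by (intro exI[of _ "sin t - t / 2"]) (auto intro!: derivative_eq_intros)
  qed
  then show ?thesis by simp
qed

text \<open>
  The steps between consecutive reciprocals \<open>1 / m\<close> turn an integral near \<open>0\<close> into a series. The bound \<open>B\<close>
  controls the remaining interval around \<open>0\<close> and disappears in the limit.
\<close>
lemma integral_le_harmonic_steps:
  fixes q :: "real \<Rightarrow> real"
  assumes q: "q integrable_on {0..pi}" and bd: "\<And>t. 0 \<le> t \<Longrightarrow> t \<le> pi \<Longrightarrow> q t \<le> B"
    and G: "\<And>m t. m \<ge> 1 \<Longrightarrow> 1 / real (m + 1) \<le> t \<Longrightarrow> t \<le> 1 / real m \<Longrightarrow> q t \<le> G m"
    and G0: "\<And>t. 1 \<le> t \<Longrightarrow> t \<le> pi \<Longrightarrow> q t \<le> G0"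
    and sG: "summable (\<lambda>m. G (Suc m) / (real (Suc m) * real (Suc m + 1)))"
    and G_nonneg: "\<And>m. G m \<ge> 0"
  shows "integral {0..pi} q \<le> (\<Sum>m. G (Suc m) / (real (Suc m) * real (Suc m + 1))) + G0 * (pi - 1)"
proof -
  let ?S = "\<Sum>m. G (Suc m) / (real (Suc m) * real (Suc m + 1))"
  have int: "q integrable_on {a..b}" if "0 \<le> a" "b \<le> pi" for a b
    by (rule integrable_on_subinterval[OF q]) (use that in auto)
  have le: "integral {a..b} q \<le> C * (b - a)" if "0 \<le> a" "a \<le> b" "b \<le> pi" "\<And>t. a \<le> t \<Longrightarrow> t \<le> b \<Longrightarrow> q t \<le> C" for a b C
  proof -
    have "integral {a..b} q \<le> integral {a..b} (\<lambda>_. C)"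
      by (rule integral_le) (use that int in auto)
    then show ?thesis using that by (simp add: mult.commute)
  qed
  have pi1: "1 \<le> pi" using pi_gt3 by simp
  have steps: "integral {1 / real (Suc M)..1} q \<le> (\<Sum>m<M. G (Suc m) / (real (Suc m) * real (Suc m + 1)))" for M
  proof (induction M)
    case (Suc M)
    let ?a = "1 / real (Suc (Suc M))" and ?b = "1 / real (Suc M)"
    have ab: "0 \<le> ?a" "?a \<le> ?b" "?b \<le> 1" by (auto simp: field_simps)
    have "integral {?a..1} q = integral {?a..?b} q + integral {?b..1} q"
      by (rule Henstock_Kurzweil_Integration.integral_combine[symmetric]) (use ab pi1 int in auto)
    moreover have "integral {?a..?b} q \<le> G (Suc M) * (?b - ?a)"
    proof (rule le)
      show "?b \<le> pi" using ab pi1 by linarith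
    qed (use ab G[of "Suc M"] in auto)
    moreover have "?b - ?a = 1 / (real (Suc M) * real (Suc M + 1))" by (simp add: field_simps)
    ultimately show ?case using Suc by simp
  qed simp
  have B0: "integral {0..pi} q \<le> B * (1 / real (Suc M)) + (?S + G0 * (pi - 1))" for M
  proof -
    let ?b = "1 / real (Suc M)"
    have b: "0 \<le> ?b" "?b \<le> 1" by auto
    have "integral {0..pi} q = integral {0..1} q + integral {1..pi} q"
      by (rule Henstock_Kurzweil_Integration.integral_combine[symmetric]) (use pi1 int in auto)
    also have "integral {0..1} q = integral {0..?b} q + integral {?b..1} q"
      by (rule Henstock_Kurzweil_Integration.integral_combine[symmetric]) (use b pi1 int in auto)
    finally have "integral {0..pi} q = integral {0..?b} q + integral {?b..1} q + integral {1..pi} q" .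
    moreover have "integral {0..?b} q \<le> B * (?b - 0)"
    proof (rule le)
      show "?b \<le> pi" using b pi1 by linarith
      then show "q t \<le> B" if "0 \<le> t" "t \<le> ?b" for t using that by (intro bd) linarith+
    qed simp_all
    moreover have "integral {1..pi} q \<le> G0 * (pi - 1)" by (rule le) (use pi1 G0 in auto)
    moreover have "(\<Sum>m<M. G (Suc m) / (real (Suc m) * real (Suc m + 1))) \<le> ?S"
      by (rule sum_le_suminf[OF sG]) (auto intro!: divide_nonneg_nonneg G_nonneg)
    ultimately show ?thesis using steps[of M] by simp
  qed
  have "(\<lambda>M. B * (1 / real (Suc M)) + (?S + G0 * (pi - 1))) \<longlonglongrightarrow> B * 0 + (?S + G0 * (pi - 1))"
    by (intro tendsto_intros LIMSEQ_Suc[OF lim_1_over_n])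
  then have "integral {0..pi} q \<le> B * 0 + (?S + G0 * (pi - 1))"
    by (rule LIMSEQ_le_const) (use B0 in blast)
  then show ?thesis by simp
qed

context pinning_kernel
begin

definition renewal_mass :: "nat \<Rightarrow> real" where "renewal_mass = pinned_partition K (\<lambda>_. 1)"

lemma renewal_mass_bounds: "0 \<le> renewal_mass n" "renewal_mass n \<le> 1"
proof -
  show "0 \<le> renewal_mass n" unfolding renewal_mass_def by (rule pinned_nonneg) (auto intro: K_nonneg)
  have "renewal_mass n \<le> free_partition K (\<lambda>_. 1) n"
    unfolding renewal_mass_def by (rule pinned_le_free) (auto intro: K_nonneg tail_nonneg)
  then show "renewal_mass n \<le> 1" by (simp add: free_one)
qed

lemma renewal_equation:
  fixes z :: complex
  assumes z: "cmod z < 1"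
  shows "(\<Sum>n. renewal_mass n * z ^ n) * (1 - (\<Sum>n. K (Suc n) * z ^ Suc n)) = 1"
    and "summable (\<lambda>n. cmod (K (Suc n) * z ^ Suc n))"
proof -
  define b where "b n = (if n = 0 then 1 else - complex_of_real (K n) * z ^ n)" for n
  have su: "summable (\<lambda>n. cmod (renewal_mass n * z ^ n))"
  proof (rule summable_comparison_test'[where N=0])
    show "summable (\<lambda>n. cmod z ^ n)" using z by (simp add: summable_geometric)
    show "norm (cmod (renewal_mass n * z ^ n)) \<le> cmod z ^ n" for n
      using renewal_mass_bounds[of n] by (simp add: norm_mult norm_power mult_left_le_one_le)
  qed
  show sK: "summable (\<lambda>n. cmod (K (Suc n) * z ^ Suc n))"
  proof (rule summable_comparison_test'[where N=0])
    show "summable (\<lambda>n. K (Suc n))" using K_sums by (rule sums_summable)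
    show "norm (cmod (K (Suc n) * z ^ Suc n)) \<le> K (Suc n)" for n
      using K_nonneg[of "Suc n"] power_le_one[of "cmod z" "Suc n"] z
      by (simp add: norm_mult norm_power mult_left_le power_Suc[symmetric] del: power_Suc)
  qed
  have sb': "summable (\<lambda>n. cmod (b (Suc n)))" using sK by (simp add: b_def norm_mult)
  then have sb: "summable (\<lambda>n. cmod (b n))" by (subst (asm) summable_Suc_iff)
  have suminf_b: "(\<Sum>n. b n) = 1 - (\<Sum>n. K (Suc n) * z ^ Suc n)"
  proof -
    have "(\<Sum>n. b (Suc n)) = (\<Sum>n. - (K (Suc n) * z ^ Suc n))" by (simp add: b_def)
    also have "\<dots> = - (\<Sum>n. K (Suc n) * z ^ Suc n)" by (rule suminf_minus[OF summable_norm_cancel[OF sK]])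
    finally have "suminf b - b 0 = - (\<Sum>n. K (Suc n) * z ^ Suc n)"
      unfolding suminf_split_head[OF summable_norm_cancel[OF sb]] .
    moreover have "b 0 = 1" by (simp add: b_def)
    ultimately show ?thesis by (simp add: algebra_simps)
  qed
  have conv: "(\<Sum>i\<le>n. (renewal_mass i * z ^ i) * b (n - i)) = (if n = 0 then 1 else 0)" for n
  proof (cases n)
    case (Suc m)
    have "(\<Sum>i\<le>n. (renewal_mass i * z ^ i) * b (n - i)) = renewal_mass n * z ^ n + (\<Sum>i<n. (renewal_mass i * z ^ i) * b (n - i))"
      by (simp add: Suc lessThan_Suc_atMost b_def)
    also have "(\<Sum>i<n. (renewal_mass i * z ^ i) * b (n - i)) = (\<Sum>i<n. - (complex_of_real (renewal_mass i * K (n - i)) * z ^ n))"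
      by (rule sum.cong) (auto simp: b_def power_add[symmetric] mult_ac)
    also have "\<dots> = - (complex_of_real (\<Sum>i<n. renewal_mass i * K (n - i)) * z ^ n)"
      by (simp add: sum_negf sum_distrib_right)
    also have "(\<Sum>i<n. renewal_mass i * K (n - i)) = renewal_mass n" using pinned_rec[of n K "\<lambda>_. 1"] Suc by (simp add: renewal_mass_def)
    finally show ?thesis using Suc by simp
  qed (simp add: b_def renewal_mass_def)
  have "(\<lambda>n. if n = 0 then 1 else 0) sums ((\<Sum>n. renewal_mass n * z ^ n) * (\<Sum>n. b n))"
    using Cauchy_product_sums[OF su sb] unfolding conv .
  moreover have "(\<lambda>n. if n = 0 then 1 else 0) sums (1::complex)"
    using sums_single[of 0 "\<lambda>_. 1::complex"] by simp
  ultimately show "(\<Sum>n. renewal_mass n * z ^ n) * (1 - (\<Sum>n. K (Suc n) * z ^ Suc n)) = 1"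
    unfolding suminf_b by (rule sums_unique2)
qed

text \<open>
  Compare real parts term by term. Replacing negative cosines by zero makes the bound independent of \<open>r\<close>: a
  factor \<open>r ^ n\<close> in front of a nonnegative cosine can only help.
\<close>
lemma generating_function_gap:
  assumes r: "0 \<le> r" "r < 1"
  shows "(\<Sum>n=1..N. K n * (1 - max 0 (cos (real n * t)))) \<le> cmod (1 - (\<Sum>n. complex_of_real (K (Suc n)) * (complex_of_real r * cis t) ^ Suc n))"
proof -
  let ?z = "complex_of_real r * cis t"
  let ?g = "\<lambda>n. K (Suc n) * (1 - r ^ Suc n * cos (real (Suc n) * t))"
  have z: "cmod ?z < 1" using r by (simp add: norm_mult)
  have "(\<lambda>n. complex_of_real (K (Suc n)) * ?z ^ Suc n) sums (\<Sum>n. K (Suc n) * ?z ^ Suc n)"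
    by (rule summable_sums[OF summable_norm_cancel[OF renewal_equation(2)[OF z]]])
  from sums_diff[OF K_sums sums_Re[OF this]]
  have "(\<lambda>n. K (Suc n) - Re (complex_of_real (K (Suc n)) * ?z ^ Suc n)) sums
      Re (1 - (\<Sum>n. K (Suc n) * ?z ^ Suc n))" by simp
  moreover have "Re (complex_of_real (K n) * ?z ^ n) = K n * (r ^ n * cos (real n * t))" for n
    by (simp add: power_mult_distrib Complex.DeMoivre flip: of_real_power)
  ultimately have "?g sums Re (1 - (\<Sum>n. K (Suc n) * ?z ^ Suc n))"
    by (simp only: right_diff_distrib mult_1_right)
  moreover have pos: "?g n \<ge> 0" for n
  proof -
    have "r ^ Suc n * cos (real (Suc n) * t) \<le> 1 * 1"
      using r power_le_one[of r "Suc n"]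
      by (metis abs_cos_le_one abs_ge_self abs_le_D1 less_imp_le mult_left_le mult_1 order_trans zero_le_power)
    then show ?thesis using K_nonneg[of "Suc n"] by (intro mult_nonneg_nonneg) auto
  qed
  ultimately have "(\<Sum>n<N. ?g n) \<le> Re (1 - (\<Sum>n. K (Suc n) * ?z ^ Suc n))"
    using sum_le_suminf[of ?g "{..<N}"] sums_unique sums_summable by fastforce
  also have "\<dots> \<le> cmod (1 - (\<Sum>n. K (Suc n) * ?z ^ Suc n))" by (rule complex_Re_le_cmod)
  finally have 1: "(\<Sum>n<N. ?g n) \<le> cmod (1 - (\<Sum>n. K (Suc n) * ?z ^ Suc n))" .
  have "(\<Sum>n=1..N. K n * (1 - max 0 (cos (real n * t)))) = (\<Sum>n<N. K (Suc n) * (1 - max 0 (cos (real (Suc n) * t))))"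
    by (rule sum.reindex_bij_witness[of _ Suc "\<lambda>n. n - 1"]) auto
  also have "\<dots> \<le> (\<Sum>n<N. ?g n)"
  proof (rule sum_mono)
    fix n assume n: "n \<in> {..<N}"
    have "r ^ Suc n * cos (real (Suc n) * t) \<le> r ^ Suc n * max 0 (cos (real (Suc n) * t))"
      using r by (intro mult_left_mono) auto
    also have "\<dots> \<le> 1 * max 0 (cos (real (Suc n) * t))"
      using r power_le_one[of r "Suc n"] by (intro mult_right_mono) auto
    finally have "r ^ Suc n * cos (real (Suc n) * t) \<le> max 0 (cos (real (Suc n) * t))" by simp
    then show "K (Suc n) * (1 - max 0 (cos (real (Suc n) * t))) \<le> ?g n"
      using K_nonneg[of "Suc n"] by (intro mult_left_mono) auto
  qed
  finally show ?thesis using 1 by linarith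
qed

text \<open>
  The indices between \<open>M / 2\<close> and \<open>M\<close> suffice, since there \<open>L\<close> is comparable to \<open>L M\<close>.
\<close>
lemma truncated_second_moment_lower:
  assumes "\<alpha> < 1"
  shows "\<exists>C>0. \<forall>M\<ge>1. real M powr (2 - \<alpha>) * L (real M) \<le> C * (\<Sum>n=1..M. (real n)\<^sup>2 * K n)"
proof -
  obtain A X where A: "A > 0" and X: "X \<ge> 1" and pot: "\<And>x y. x \<ge> X \<Longrightarrow> y \<ge> x \<Longrightarrow>
      L y \<le> A * (y / x) powr 1 * L x"
    using slowly_varying_potter[OF L, of 1] by auto
  define N where "N = nat \<lceil>2 * X\<rceil>"
  have N: "real N \<ge> 2 * X" unfolding N_def by linarith
  let ?l = "\<lambda>M::nat. real M powr (2 - \<alpha>) * L (real M)" and ?s = "\<lambda>M. (\<Sum>n=1..M. (real n)\<^sup>2 * K n)"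
  define C1 where "C1 = (\<Sum>M=1..N. ?l M) / K 1"
  define C2 where "C2 = 2 * A * 2 powr (2 - \<alpha>)"
  have l: "?l M \<ge> 0" for M using L_pos[of "real M"] by (cases "M = 0") auto
  have K1: "K 1 > 0" by (rule K_pos) simp
  have s1: "?s M \<ge> K 1" if "M \<ge> 1" for M
    using member_le_sum[of 1 "{1..M}" "\<lambda>n. (real n)\<^sup>2 * K n"] that K_nonneg by auto
  have C: "C1 \<ge> 0" "C2 > 0" using K1 A l by (auto simp: C1_def C2_def intro!: divide_nonneg_pos sum_nonneg)
  have "?l M \<le> (C1 + C2) * ?s M" if M: "M \<ge> 1" for M
  proof (cases "M \<le> N")
    case True
    have "?l M \<le> (\<Sum>M=1..N. ?l M)" by (rule member_le_sum) (use M True l in auto)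
    also have "\<dots> = C1 * K 1" using K1 by (simp add: C1_def)
    also have "\<dots> \<le> (C1 + C2) * ?s M" using s1[OF M] C K1 by (intro mult_mono) auto
    finally show ?thesis .
  next
    case False
    define k where "k = (M + 1) div 2"
    have kk: "M \<le> 2 * k" "2 * k \<le> M + 1" "k \<ge> 1" "k \<le> M" using M unfolding k_def by linarith+
    then have "real M \<le> real (2 * k)" "real (2 * k) \<le> real (M + 1)" by (simp_all only: of_nat_le_iff)
    with kk have k: "real k \<ge> real M / 2" "k \<ge> 1" "k \<le> M" "real (M + 1 - k) \<ge> real M / 2"
      by (simp_all add: of_nat_diff)
    have LM: "L (real M) > 0" using M L_pos by simp
    let ?c = "(real M / 2) powr (1 - \<alpha>) * (L (real M) / (2 * A))"
    have c: "?c \<ge> 0" using A LM by simp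
    have "?l M / C2 = real M / 2 * ?c"
    proof -
      have "real M / 2 * (real M / 2) powr (1 - \<alpha>) = (real M / 2) powr (1 + (1 - \<alpha>))"
        using M by (subst powr_add) simp
      then show ?thesis using A unfolding C2_def by (simp add: powr_divide field_simps)
    qed
    also have "\<dots> \<le> real (M + 1 - k) * ?c" using k c by (intro mult_right_mono) auto
    also have "\<dots> = (\<Sum>n=k..M. ?c)" using k by simp
    also have "\<dots> \<le> (\<Sum>n=k..M. (real n)\<^sup>2 * K n)"
    proof (rule sum_mono)
      fix n assume n: "n \<in> {k..M}"
      have nM: "real n \<ge> real M / 2" using n k by (meson atLeastAtMost_iff of_nat_mono order_trans)
      have n1: "n \<ge> 1" using n k by auto
      have "real n \<ge> X" using nM N False by simp
      then have "L (real M) \<le> A * (real M / real n) powr 1 * L (real n)"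
        using n by (intro pot) auto
      also have "\<dots> = A * (real M / real n) * L (real n)" using n1 by simp
      also have "\<dots> \<le> A * 2 * L (real n)"
        using nM n1 A L_pos[of "real n"] by (intro mult_right_mono mult_left_mono) (auto simp: field_simps)
      finally have 1: "L (real M) / (2 * A) \<le> L (real n)" using A by (simp add: field_simps)
      have "(real M / 2) powr (1 - \<alpha>) \<le> real n powr (1 - \<alpha>)"
        using nM assms by (intro powr_mono2) auto
      then have "?c \<le> real n powr (1 - \<alpha>) * L (real n)" using 1 A LM by (intro mult_mono) auto
      also have "real n powr (1 - \<alpha>) = real n powr 2 / real n powr (1 + \<alpha>)"
        by (simp only: powr_diff[symmetric]) simp
      also have "\<dots> * L (real n) = (real n)\<^sup>2 * K n" using n1 by (simp add: K_eq powr_numeral)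
      finally show "?c \<le> (real n)\<^sup>2 * K n" .
    qed
    also have "\<dots> \<le> ?s M" using k K_nonneg by (intro sum_mono2) auto
    finally have "?l M \<le> C2 * ?s M" using C by (simp add: field_simps)
    also have "\<dots> \<le> (C1 + C2) * ?s M" using C s1[OF M] K1 by (intro mult_right_mono) auto
    finally show ?thesis .
  qed
  moreover have "C1 + C2 > 0" using C by simp
  ultimately show ?thesis by blast
qed

text \<open>
  For \<open>\<alpha> = 1 / 2\<close> this is the assumption itself; for \<open>\<alpha> < 1 / 2\<close> the power dominates the slowly varying factor.
\<close>
lemma L_square_summable:
  assumes "(0 < \<alpha> \<and> \<alpha> < 1 / 2) \<or>
      (\<alpha> = 1 / 2 \<and> summable (\<lambda>n. 1 / (real (Suc n) * (L (real (Suc n)))\<^sup>2)))"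
  shows "summable (\<lambda>n. real (Suc n) powr (2 * \<alpha> - 2) / (L (real (Suc n)))\<^sup>2)"
  using assms
proof
  assume "\<alpha> = 1 / 2 \<and> summable (\<lambda>n. 1 / (real (Suc n) * (L (real (Suc n)))\<^sup>2))"
  then show ?thesis by (simp add: powr_minus powr_one field_simps)
next
  assume a: "0 < \<alpha> \<and> \<alpha> < 1 / 2"
  define \<delta> where "\<delta> = (1 / 2 - \<alpha>) / 2"
  obtain C where C: "C > 0" "\<And>n. n \<ge> 1 \<Longrightarrow> real n powr (- \<delta>) \<le> C * L (real n)"
    using L_poly_bounds[of \<delta>] a by (auto simp: \<delta>_def)
  have b: "real n powr (2 * \<alpha> - 2) / (L (real n))\<^sup>2 \<le> C\<^sup>2 * real n powr (\<alpha> - 3 / 2)" if n: "n \<ge> 1" for n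
  proof -
    have Ln: "L (real n) > 0" using n L_pos by simp
    have "(real n powr (- \<delta>))\<^sup>2 \<le> (C * L (real n))\<^sup>2" by (intro power_mono C n) auto
    then have "1 / (L (real n))\<^sup>2 \<le> C\<^sup>2 * real n powr (2 * \<delta>)"
      using Ln n by (simp add: powr_minus power_mult_distrib powr_power field_simps)
    then have "real n powr (2 * \<alpha> - 2) * (1 / (L (real n))\<^sup>2) \<le> real n powr (2 * \<alpha> - 2) * (C\<^sup>2 * real n powr (2 * \<delta>))"
      by (intro mult_left_mono) auto
    also have "\<dots> = C\<^sup>2 * real n powr (2 * \<alpha> - 2 + 2 * \<delta>)" by (simp add: powr_add)
    also have "2 * \<alpha> - 2 + 2 * \<delta> = \<alpha> - 3 / 2" by (simp add: \<delta>_def field_simps)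
    finally show ?thesis by simp
  qed
  have "summable (\<lambda>n. real n powr (\<alpha> - 3 / 2))"
    using a by (subst summable_real_powr_iff) auto
  then have "summable (\<lambda>n. C\<^sup>2 * real (Suc n) powr (\<alpha> - 3 / 2))"
    by (subst (asm) summable_Suc_iff[symmetric]) (rule summable_mult)
  then show ?thesis
    by (rule summable_comparison_test'[where N=0]) (use b[of "Suc _"] in simp)
qed

text \<open>
  By Parseval, \<open>\<Sum>u\<^sup>2\<close> is bounded by the integral of \<open>1 / \<bar>1 - \<phi>\<bar>\<^sup>2\<close>. For \<open>t\<close> between \<open>1 / (m + 1)\<close> and \<open>1 / m\<close> the gap
  \<open>\<bar>1 - \<phi>\<bar>\<close> is at least of order \<open>m powr (- \<alpha>) * L m\<close>, because \<open>1 - cos (n t)\<close> is of order \<open>(n t)\<^sup>2\<close> for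
  \<open>n \<le> m\<close>. Working at radius \<open>r < 1\<close> avoids all questions of convergence; every estimate is uniform in \<open>r\<close>.
\<close>
theorem renewal_mass_square_summable:
  assumes "(0 < \<alpha> \<and> \<alpha> < 1 / 2) \<or>
      (\<alpha> = 1 / 2 \<and> summable (\<lambda>n. 1 / (real (Suc n) * (L (real (Suc n)))\<^sup>2)))"
  shows "summable (\<lambda>n. (renewal_mass n)\<^sup>2)"
proof -
  have "\<alpha> < 1" using assms by auto
  obtain C where C: "C > 0" "\<And>M. M \<ge> 1 \<Longrightarrow> real M powr (2 - \<alpha>) * L (real M) \<le> C * (\<Sum>n=1..M. (real n)\<^sup>2 * K n)"
    using truncated_second_moment_lower[OF \<open>\<alpha> < 1\<close>] by blast
  define D where "D = (16 * C)\<^sup>2"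
  define G where "G M = D * (real M powr (2 * \<alpha>) / (L (real M))\<^sup>2)" for M :: nat
  (* Away from 0 the single jump length n = 1 keeps the generating function of K away from 1. *)
  define G0 where "G0 = 1 / (K 1 * (1 - cos 1))\<^sup>2"
  have G_nonneg: "G m \<ge> 0" for m by (simp add: G_def D_def)
  have cos1: "0 < cos (1::real)" using cos_gt_zero[of 1] pi_gt3 by simp
  have cos1': "cos (1::real) < 1" using one_minus_cos_ge[of 1] by simp
  have sG: "summable (\<lambda>m. G (Suc m) / (real (Suc m) * real (Suc m + 1)))"
  proof (rule summable_comparison_test'[where N=0, OF summable_mult[OF L_square_summable[OF assms], of D]])
    fix m
    have "G (Suc m) / (real (Suc m) * real (Suc m + 1)) \<le> G (Suc m) / (real (Suc m) * real (Suc m))"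
      using G_nonneg by (intro divide_left_mono) auto
    also have "\<dots> = D * (real (Suc m) powr (2 * \<alpha> - 2) / (L (real (Suc m)))\<^sup>2)"
      by (simp add: G_def powr_diff powr_numeral power2_eq_square field_simps)
    finally show "norm (G (Suc m) / (real (Suc m) * real (Suc m + 1))) \<le> D * (real (Suc m) powr (2 * \<alpha> - 2) / (L (real (Suc m)))\<^sup>2)"
      using G_nonneg[of "Suc m"] by simp
  qed
  define T where "T = ((\<Sum>m. G (Suc m) / (real (Suc m) * real (Suc m + 1))) + G0 * (pi - 1)) / pi"
  have main: "(\<Sum>n<k. (renewal_mass n * r ^ n)\<^sup>2) \<le> T" if r: "0 < r" "r < 1" for r k
  proof -
    let ?F = "\<lambda>t. \<Sum>n. complex_of_real (renewal_mass n * r ^ n) * cis (real n * t)"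
    let ?Q = "\<lambda>t. 1 - (\<Sum>n. complex_of_real (K (Suc n)) * (complex_of_real r * cis t) ^ Suc n)"
    have summ: "summable (\<lambda>n. \<bar>renewal_mass n * r ^ n\<bar>)"
    proof (rule summable_comparison_test'[where N=0])
      show "summable (\<lambda>n. r ^ n)" using r by (simp add: summable_geometric)
      show "norm \<bar>renewal_mass n * r ^ n\<bar> \<le> r ^ n" for n
        using renewal_mass_bounds[of n] r by (simp add: abs_mult mult_left_le_one_le)
    qed
    have FQ: "?F t * ?Q t = 1" for t
    proof -
      have "complex_of_real (renewal_mass n * r ^ n) * cis (real n * t) = complex_of_real (renewal_mass n) * (complex_of_real r * cis t) ^ n" for n
        by (simp only: power_mult_distrib Complex.DeMoivre of_real_mult of_real_power mult.assoc)
      then have *: "?F t = (\<Sum>n. complex_of_real (renewal_mass n) * (complex_of_real r * cis t) ^ n)" by presburger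
      have "cmod (complex_of_real r * cis t) < 1" using r by (simp add: norm_mult)
      then show ?thesis unfolding * by (rule renewal_equation(1))
    qed
    have le: "(cmod (?F t))\<^sup>2 \<le> 1 / g\<^sup>2" if "0 < g" "g \<le> cmod (?Q t)" for g t
      by (rule cmod_square_le_inverse[OF FQ that])
    have "integral {0..pi} (\<lambda>t. (cmod (?F t))\<^sup>2) \<le> (\<Sum>m. G (Suc m) / (real (Suc m) * real (Suc m + 1))) + G0 * (pi - 1)"
    proof (rule integral_le_harmonic_steps)
      show "(\<lambda>t. (cmod (?F t))\<^sup>2) integrable_on {0..pi}"
        by (rule parseval_half_circle(1)[OF summ])
      show "(cmod (?F t))\<^sup>2 \<le> (\<Sum>n. \<bar>renewal_mass n * r ^ n\<bar>)\<^sup>2" for t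
      proof (rule power_mono)
        have "cmod (?F t) \<le> (\<Sum>n. cmod (complex_of_real (renewal_mass n * r ^ n) * cis (real n * t)))"
          by (rule summable_norm) (use summ in \<open>simp add: norm_mult abs_mult norm_power power_abs\<close>)
        then show "cmod (?F t) \<le> (\<Sum>n. \<bar>renewal_mass n * r ^ n\<bar>)"
          using r by (simp add: norm_mult abs_mult norm_power)
      qed simp
      show "(cmod (?F t))\<^sup>2 \<le> G m" if m: "m \<ge> 1" and t: "1 / real (m + 1) \<le> t" "t \<le> 1 / real m" for m t
      proof -
        have t0: "t > 0" using t(1) by (smt (verit) divide_pos_pos of_nat_0_less_iff zero_less_one add_gr_0)
        have Lm: "L (real m) > 0" using m L_pos by simp
        have nt: "0 \<le> real n * t" "real n * t \<le> 1" if "n \<le> m" for n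
        proof -
          show "0 \<le> real n * t" using t0 by simp
          have "real n * t \<le> real m * t" using that t0 by simp
          also have "\<dots> \<le> 1" using t m by (simp add: field_simps)
          finally show "real n * t \<le> 1" .
        qed
        define g where "g = real m powr (- \<alpha>) * L (real m) / (16 * C)"
        have g: "g > 0" using Lm C m by (simp add: g_def)
        have "real m powr (2 - \<alpha>) = (real m)\<^sup>2 * real m powr (- \<alpha>)"
          using m by (simp add: powr_diff powr_minus powr_numeral field_simps)
        then have "g = (1 / (16 * (real m)\<^sup>2)) * (real m powr (2 - \<alpha>) * L (real m)) / C"
          using m by (simp add: g_def)
        also have "\<dots> \<le> (1 / (16 * (real m)\<^sup>2)) * (C * (\<Sum>n=1..m. (real n)\<^sup>2 * K n)) / C"
          using C m by (intro divide_right_mono mult_left_mono) auto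
        also have "\<dots> = (1 / (2 * real m))\<^sup>2 / 4 * (\<Sum>n=1..m. (real n)\<^sup>2 * K n)"
          using C by (simp add: power2_eq_square field_simps)
        also have "\<dots> \<le> t\<^sup>2 / 4 * (\<Sum>n=1..m. (real n)\<^sup>2 * K n)"
        proof (intro mult_right_mono divide_right_mono power_mono)
          have "1 / (2 * real m) \<le> 1 / real (m + 1)" using m by (simp add: field_simps)
          then show "1 / (2 * real m) \<le> t" using t by linarith
        qed (auto intro!: sum_nonneg mult_nonneg_nonneg K_nonneg)
        also have "\<dots> = (\<Sum>n=1..m. K n * ((real n * t)\<^sup>2 / 4))"
          by (simp add: sum_distrib_left power_mult_distrib mult_ac)
        also have "\<dots> \<le> (\<Sum>n=1..m. K n * (1 - cos (real n * t)))"
          by (intro sum_mono mult_left_mono one_minus_cos_ge nt K_nonneg) auto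
        also have "\<dots> = (\<Sum>n=1..m. K n * (1 - max 0 (cos (real n * t))))"
        proof (rule sum.cong)
          fix n assume "n \<in> {1..m}"
          then have "0 \<le> cos (real n * t)"
            using nt[of n] pi_gt3 by (intro cos_ge_zero) auto
          then show "K n * (1 - cos (real n * t)) = K n * (1 - max 0 (cos (real n * t)))" by simp
        qed simp
        also have "\<dots> \<le> cmod (?Q t)"
          by (rule generating_function_gap) (use r in auto)
        finally have "(cmod (?F t))\<^sup>2 \<le> 1 / g\<^sup>2" by (intro le g)
        also have "1 / g\<^sup>2 = G m"
          using Lm m C by (simp add: g_def G_def D_def powr_minus power_divide power_mult_distrib powr_power field_simps)
        finally show ?thesis .
      qed
      show "(cmod (?F t))\<^sup>2 \<le> G0" if t: "1 \<le> t" "t \<le> pi" for t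
        unfolding G0_def
      proof (rule le)
        show "0 < K 1 * (1 - cos 1)" using K_pos[of 1] cos1' by simp
        show "K 1 * (1 - cos 1) \<le> cmod (?Q t)"
        proof -
          have "cos t \<le> cos 1" using t by (intro cos_monotone_0_pi_le) auto
          then have "K 1 * (1 - cos 1) \<le> K 1 * (1 - max 0 (cos t))"
            using K_nonneg[of 1] cos1 by (intro mult_left_mono) auto
          moreover have "(\<Sum>n=1..1. K n * (1 - max 0 (cos (real n * t)))) \<le> cmod (?Q t)"
            by (rule generating_function_gap) (use r in auto)
          ultimately show ?thesis by simp
        qed
      qed
      show "summable (\<lambda>m. G (Suc m) / (real (Suc m) * real (Suc m + 1)))" by (rule sG)
      show "G m \<ge> 0" for m by (rule G_nonneg)
    qed
    then have "integral {0..pi} (\<lambda>t. (cmod (?F t))\<^sup>2) / pi \<le> T"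
      unfolding T_def by (intro divide_right_mono) auto
    with parseval_half_circle(2)[OF summ, of k] show ?thesis by linarith
  qed
  have bound: "(\<Sum>n<k. (renewal_mass n)\<^sup>2) \<le> T" for k
  proof (rule tendsto_upperbound)
    show "((\<lambda>r. \<Sum>n<k. (renewal_mass n * r ^ n)\<^sup>2) \<longlongrightarrow> (\<Sum>n<k. (renewal_mass n)\<^sup>2)) (at_left 1)"
      by (auto intro!: tendsto_eq_intros)
    show "\<forall>\<^sub>F r in at_left 1. (\<Sum>n<k. (renewal_mass n * r ^ n)\<^sup>2) \<le> T"
      by (rule eventually_mono[OF eventually_at_left_real[of 0 1]]) (use main in auto)
  qed simp
  show ?thesis
    by (rule summableI_nonneg_bounded[where x=T]) (use bound in auto)
qed

end

section \<open>The partition function of the renewal process\<close>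

text \<open>
  Only the term of the last renewal up to \<open>N\<close> survives in the sum: the last factor is the indicator that the
  renewal after \<open>n\<close> lies beyond \<open>N\<close>.
\<close>
lemma renewal_path_decomposition:
  fixes s :: "nat \<Rightarrow> enat" and f :: "nat \<Rightarrow> real"
  assumes s0: "s 0 = 0" and inc: "\<And>n. s n < \<infinity> \<Longrightarrow> s n < s (Suc n)" and absorb: "\<And>n. s n = \<infinity> \<Longrightarrow> s (Suc n) = \<infinity>"
  shows "(\<Prod>n=1..N. if \<exists>k. s k = enat n then f n else 1)
    = (\<Sum>n\<le>N. \<Sum>j\<le>n. (\<Prod>i=1..j. f (the_enat (s i))) * of_bool (s j = enat n)
        * (1 - (\<Sum>m=1..N-n. of_bool (s (Suc j) = enat (n + m)))))"
    and "s j = enat n \<Longrightarrow> i \<le> j \<Longrightarrow> s i = enat (the_enat (s i)) \<and> the_enat (s i) \<le> n"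
proof -
  have step: "s n \<le> s (Suc n)" for n
    using inc[of n] absorb[of n] by (cases "s n") auto
  have mono: "s i \<le> s j" if "i \<le> j" for i j
    by (rule lift_Suc_mono_le[of s, OF step that])
  show before_finite: "s i = enat (the_enat (s i)) \<and> the_enat (s i) \<le> n" if "s j = enat n" "i \<le> j" for i j n
    using mono[OF that(2)] that(1) by (cases "s i") auto
  have strict: "s i < s j" if "i < j" "s i = enat n" for i j n
    using inc[of i] mono[of "Suc i" j] that by (auto intro: less_le_trans)
  have inj: "i = j" if "s i = enat n" "s j = enat n" for i j n
    using strict[of i j n] strict[of j i n] that by (cases i j rule: linorder_cases) auto
  have ge: "enat j \<le> s j" for j
  proof (induction j)
    case (Suc j)
    then show ?case using inc[of j] absorb[of j] by (cases "s j"; cases "s (Suc j)") auto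
  qed (simp add: s0 zero_enat_def[symmetric])
  (* The index of the last renewal up to N. *)
  define J where "J = Max {j. s j \<le> enat N}"
  have fin: "finite {j. s j \<le> enat N}"
  proof (rule finite_subset[of _ "{..N}"])
    show "{j. s j \<le> enat N} \<subseteq> {..N}"
    proof
      fix j assume "j \<in> {j. s j \<le> enat N}"
      then have "enat j \<le> enat N" using order_trans[OF ge[of j]] by blast
      then show "j \<in> {..N}" by simp
    qed
  qed simp
  have "0 \<in> {j. s j \<le> enat N}" by (simp add: s0)
  then have "J \<in> {j. s j \<le> enat N}" unfolding J_def using fin by (intro Max_in) auto
  then obtain n0 where n0: "s J = enat n0" "n0 \<le> N" by (cases "s J") auto
  have J_max: "i \<le> J" if "s i \<le> enat N" for i
    unfolding J_def using fin that by (intro Max_ge) auto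
  have J_iff: "s i \<le> enat N \<longleftrightarrow> i \<le> J" for i
    using J_max[of i] mono[of i J] n0 by (auto intro: order_trans)
  have Jn0: "J \<le> n0" using ge[of J] n0 by simp
  have summand: "of_bool (s j = enat n) * (1 - (\<Sum>m=1..N-n. of_bool (s (Suc j) = enat (n + m)))) =
      (if j = J \<and> n = n0 then 1 else 0 :: real)" if n: "n \<le> N" for j n
  proof (cases "s j = enat n")
    case False
    then show ?thesis using n0 by auto
  next
    case True
    have jJ: "j \<le> J" using J_iff[of j] True n by simp
    show ?thesis
    proof (cases "s (Suc j) \<le> enat N")
      case le: True
      then obtain k where k: "s (Suc j) = enat k" "k \<le> N" by (cases "s (Suc j)") auto
      have kn: "n < k" using inc[of j] True k by simp
      have "(\<Sum>m=1..N-n. of_bool (s (Suc j) = enat (n + m))) = (\<Sum>m=1..N-n. if m = k - n then 1 else 0 :: real)"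
        by (rule sum.cong) (use k kn in auto)
      also have "\<dots> = 1" using k kn by (subst sum.delta) auto
      finally have "(\<Sum>m=1..N-n. of_bool (s (Suc j) = enat (n + m))) = (1::real)" .
      moreover have "j \<noteq> J" using J_iff[of "Suc j"] le by auto
      ultimately show ?thesis by simp
    next
      case gt: False
      have "(\<Sum>m=1..N-n. of_bool (s (Suc j) = enat (n + m))) = (0::real)"
        by (rule sum.neutral) (use gt n in auto)
      moreover have "j = J" using J_iff[of "Suc j"] gt jJ by auto
      moreover have "n = n0" using True n0 \<open>j = J\<close> by simp
      ultimately show ?thesis using True by simp
    qed
  qed
  have "(\<Sum>n\<le>N. \<Sum>j\<le>n. (\<Prod>i=1..j. f (the_enat (s i))) * of_bool (s j = enat n)
        * (1 - (\<Sum>m=1..N-n. of_bool (s (Suc j) = enat (n + m)))))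
     = (\<Sum>n\<le>N. \<Sum>j\<le>n. (\<Prod>i=1..j. f (the_enat (s i))) * (if j = J \<and> n = n0 then 1 else 0))"
    by (intro sum.cong refl) (use summand in \<open>simp add: mult.assoc\<close>)
  also have "\<dots> = (\<Sum>n\<le>N. if n = n0 then (\<Prod>i=1..J. f (the_enat (s i))) else 0)"
  proof (rule sum.cong)
    fix n assume "n \<in> {..N}"
    have "(\<Sum>j\<le>n. (\<Prod>i=1..j. f (the_enat (s i))) * (if j = J \<and> n = n0 then 1 else 0))
        = (\<Sum>j\<le>n. if j = J then (if n = n0 then (\<Prod>i=1..J. f (the_enat (s i))) else 0) else 0)"
      by (rule sum.cong) auto
    also have "\<dots> = (if n = n0 then (\<Prod>i=1..J. f (the_enat (s i))) else 0)"
      using Jn0 by (subst sum.delta) auto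
    finally show "(\<Sum>j\<le>n. (\<Prod>i=1..j. f (the_enat (s i))) * (if j = J \<and> n = n0 then 1 else 0))
      = (if n = n0 then (\<Prod>i=1..J. f (the_enat (s i))) else 0)" .
  qed simp
  also have "\<dots> = (\<Prod>i=1..J. f (the_enat (s i)))" using n0 by simp
  also have "\<dots> = (\<Prod>n\<in>{n\<in>{1..N}. \<exists>k. s k = enat n}. f n)"
  proof (rule prod.reindex_bij_betw)
    show "bij_betw (\<lambda>i. the_enat (s i)) {1..J} {n \<in> {1..N}. \<exists>k. s k = enat n}"
    proof (rule bij_betwI')
      fix i j assume "i \<in> {1..J}" "j \<in> {1..J}"
      then show "(the_enat (s i) = the_enat (s j)) = (i = j)"
        using before_finite[OF n0(1), of i] before_finite[OF n0(1), of j] inj[of i "the_enat (s i)" j] by auto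
    next
      fix i assume "i \<in> {1..J}"
      then show "the_enat (s i) \<in> {n \<in> {1..N}. \<exists>k. s k = enat n}"
        using before_finite[OF n0(1), of i] n0(2) ge[of i] by (cases "s i") auto
    next
      fix n assume "n \<in> {n \<in> {1..N}. \<exists>k. s k = enat n}"
      then obtain k where k: "s k = enat n" "1 \<le> n" "n \<le> N" by auto
      moreover have "k \<noteq> 0"
      proof
        assume "k = 0"
        then show False using k s0 by (simp add: zero_enat_def)
      qed
      ultimately show "\<exists>i\<in>{1..J}. n = the_enat (s i)" using J_iff[of k] by (intro bexI[of _ k]) auto
    qed
  qed
  also have "\<dots> = (\<Prod>n=1..N. if \<exists>k. s k = enat n then f n else 1)"
    by (rule prod.mono_neutral_cong_left) auto
  finally show "(\<Prod>n=1..N. if \<exists>k. s k = enat n then f n else 1)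
    = (\<Sum>n\<le>N. \<Sum>j\<le>n. (\<Prod>i=1..j. f (the_enat (s i))) * of_bool (s j = enat n)
        * (1 - (\<Sum>m=1..N-n. of_bool (s (Suc j) = enat (n + m)))))" ..
qed

context renewal_process
begin

lemma AE_renewal_path:
  "AE x in P. \<tau> 0 x = 0 \<and> (\<forall>n. \<tau> n x < \<infinity> \<longrightarrow> \<tau> n x < \<tau> (Suc n) x) \<and> (\<forall>n. \<tau> n x = \<infinity> \<longrightarrow> \<tau> (Suc n) x = \<infinity>)"
  using \<tau>_0 \<tau>_increasing \<tau>_absorbed by (simp add: AE_all_countable)

lemma measurable_of_\<tau> [measurable]: "(\<lambda>x. g (\<tau> n x)) \<in> borel_measurable P" for g :: "enat \<Rightarrow> real"
  by (rule measurable_compose[OF measurable_\<tau>]) simp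

lemma sets_\<tau> [measurable]: "{x \<in> space P. \<tau> n x = c} \<in> sets P"
  using measurable_sets[OF measurable_\<tau>[of n], of "{c}"] by (simp add: vimage_def Int_def conj_commute)

definition path_weight :: "(nat \<Rightarrow> real) \<Rightarrow> nat \<Rightarrow> nat \<Rightarrow> 'a \<Rightarrow> real" where
  "path_weight f j n x = (\<Prod>i=1..j. f (the_enat (\<tau> i x))) * of_bool (\<tau> j x = enat n)"

lemma path_weight_measurable [measurable]: "path_weight f j n \<in> borel_measurable P"
proof -
  have "(\<lambda>x. of_bool (\<tau> j x = enat n) :: real) \<in> borel_measurable P"
    by (rule measurable_of_\<tau>[of "\<lambda>e. of_bool (e = enat n)"])
  moreover have "(\<lambda>x. f (the_enat (\<tau> i x))) \<in> borel_measurable P" for i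
    by (rule measurable_of_\<tau>[of "\<lambda>e. f (the_enat e)"])
  ultimately show ?thesis unfolding path_weight_def by measurable
qed

text \<open>
  The renewal property is given for events that fix a whole finite past. Almost surely such an event is one
  of finitely many if \<open>\<tau>\<^sub>j = n\<close>, since the path up to \<open>j\<close> does not exceed \<open>n\<close>, and summing over them yields the property for
  functions of the past.
\<close>
lemma path_weight_Markov:
  fixes f :: "nat \<Rightarrow> real"
  shows "integrable P (path_weight f j n)"
    and "integrable P (\<lambda>x. path_weight f j n x * of_bool (\<tau> (Suc j) x = enat (n + m)))"
    and "(\<integral>x. path_weight f j n x * of_bool (\<tau> (Suc j) x = enat (n + m)) \<partial>P)
      = (\<integral>x. path_weight f j n x \<partial>P) * prob {x \<in> space P. \<tau> 1 x = enat m}"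
proof -
  (* The possible pasts of length j that end at n. *)
  define T where "T = {t \<in> {..j} \<rightarrow>\<^sub>E {..n}. t j = n}"
  define A where "A t = {x \<in> space P. \<forall>i\<le>j. \<tau> i x = enat (t i)}" for t :: "nat \<Rightarrow> nat"
  define B where "B = {x \<in> space P. \<tau> (Suc j) x = enat (n + m)}"
  define \<phi> where "\<phi> t = (\<Prod>i=1..j. f (t i))" for t :: "nat \<Rightarrow> nat"
  have finT: "finite T" unfolding T_def by (rule finite_subset[OF _ finite_PiE[of "{..j}" "\<lambda>_. {..n}"]]) auto
  have A_sets [measurable]: "A t \<in> sets P" for t
  proof -
    have "A t = (\<Inter>i\<in>{..j}. {x \<in> space P. \<tau> i x = enat (t i)})" by (auto simp: A_def)
    also have "\<dots> \<in> sets P" by (intro sets.finite_INT) auto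
    finally show ?thesis .
  qed
  have B_sets [measurable]: "B \<in> sets P" unfolding B_def by measurable
  have exp: "AE x in P. path_weight f j n x = (\<Sum>t\<in>T. \<phi> t * indicator (A t) x)"
    using AE_renewal_path AE_space
  proof eventually_elim
    case (elim x)
    show ?case
    proof (cases "\<tau> j x = enat n")
      case True
      let ?t = "restrict (\<lambda>i. the_enat (\<tau> i x)) {..j}"
      have b: "\<tau> i x = enat (the_enat (\<tau> i x)) \<and> the_enat (\<tau> i x) \<le> n" if "i \<le> j" for i
        by (rule renewal_path_decomposition(2)[of "\<lambda>i. \<tau> i x", OF _ _ _ True that]) (use elim in auto)
      have t: "?t \<in> T" using b True by (auto simp: T_def)
      have "(\<Sum>t\<in>T. \<phi> t * indicator (A t) x) = (\<Sum>t\<in>T. if t = ?t then \<phi> ?t else 0)"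
      proof (rule sum.cong)
        fix t assume "t \<in> T"
        then have ext: "t \<in> extensional {..j}" by (auto simp: T_def PiE_def)
        have "x \<in> A t \<longleftrightarrow> t = ?t"
        proof
          assume "x \<in> A t"
          then show "t = ?t" using ext by (intro extensionalityI[of t "{..j}"]) (auto simp: A_def)
        next
          assume "t = ?t"
          moreover have "x \<in> A ?t" using b elim by (auto simp: A_def)
          ultimately show "x \<in> A t" by simp
        qed
        then show "\<phi> t * indicator (A t) x = (if t = ?t then \<phi> ?t else 0)" by (auto simp: indicator_def)
      qed simp
      also have "\<dots> = \<phi> ?t" using t finT by simp
      also have "\<dots> = path_weight f j n x" using True by (simp add: path_weight_def \<phi>_def)
      finally show ?thesis ..
    next
      case False
      then have "x \<notin> A t" if "t \<in> T" for t using that by (auto simp: A_def T_def)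
      then show ?thesis using False by (simp add: path_weight_def)
    qed
  qed
  then have exp': "AE x in P. path_weight f j n x * of_bool (\<tau> (Suc j) x = enat (n + m)) = (\<Sum>t\<in>T. \<phi> t * indicator (A t \<inter> B) x)"
    using AE_space
  proof eventually_elim
    case (elim x)
    have "of_bool (\<tau> (Suc j) x = enat (n + m)) = (indicator B x :: real)"
      using elim by (auto simp: B_def indicator_def)
    then show ?case using elim by (simp add: sum_distrib_right indicator_inter_arith mult.assoc)
  qed
  have meas2: "(\<lambda>x. path_weight f j n x * of_bool (\<tau> (Suc j) x = enat (n + m))) \<in> borel_measurable P"
    using measurable_of_\<tau>[of "\<lambda>e. of_bool (e = enat (n + m))" "Suc j"] by measurable
  have i1: "integrable P (\<lambda>x. \<Sum>t\<in>T. \<phi> t * indicator (A t) x)"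
    by (intro Bochner_Integration.integrable_sum integrable_mult_right) (auto simp: integrable_indicator_iff emeasure_eq_measure)
  have i2: "integrable P (\<lambda>x. \<Sum>t\<in>T. \<phi> t * indicator (A t \<inter> B) x)"
    by (intro Bochner_Integration.integrable_sum integrable_mult_right) (auto simp: integrable_indicator_iff emeasure_eq_measure)
  show "integrable P (path_weight f j n)"
    using i1 by (subst integrable_cong_AE[OF _ _ exp]) auto
  show "integrable P (\<lambda>x. path_weight f j n x * of_bool (\<tau> (Suc j) x = enat (n + m)))"
    using i2 by (subst integrable_cong_AE[OF meas2 _ exp']) auto
  have p: "prob (A t \<inter> B) = prob (A t) * prob {x \<in> space P. \<tau> 1 x = enat m}" if "t \<in> T" for t
  proof -
    have "A t \<inter> B = {x \<in> space P. (\<forall>i\<le>j. \<tau> i x = enat (t i)) \<and> \<tau> (Suc j) x = \<tau> j x + enat m}"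
      using that by (auto simp: A_def B_def T_def)
    then show ?thesis unfolding A_def using \<tau>_renewal[of j t "enat m"] by simp
  qed
  have "(\<integral>x. path_weight f j n x * of_bool (\<tau> (Suc j) x = enat (n + m)) \<partial>P)
    = (\<integral>x. (\<Sum>t\<in>T. \<phi> t * indicator (A t \<inter> B) x) \<partial>P)"
    by (rule integral_cong_AE[OF meas2 _ exp']) measurable
  also have "\<dots> = (\<Sum>t\<in>T. \<phi> t * prob (A t \<inter> B))"
    by (subst Bochner_Integration.integral_sum) (auto intro!: integrable_mult_right simp: integrable_indicator_iff emeasure_eq_measure)
  also have "\<dots> = (\<Sum>t\<in>T. \<phi> t * prob (A t)) * prob {x \<in> space P. \<tau> 1 x = enat m}"
    by (simp add: sum_distrib_right p mult.assoc)
  also have "(\<Sum>t\<in>T. \<phi> t * prob (A t)) = (\<integral>x. (\<Sum>t\<in>T. \<phi> t * indicator (A t) x) \<partial>P)"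
    by (subst Bochner_Integration.integral_sum) (auto intro!: integrable_mult_right simp: integrable_indicator_iff emeasure_eq_measure)
  also have "\<dots> = (\<integral>x. path_weight f j n x \<partial>P)"
    by (rule integral_cong_AE[OF _ _ AE_symmetric[OF exp]]) measurable
  finally show "(\<integral>x. path_weight f j n x * of_bool (\<tau> (Suc j) x = enat (n + m)) \<partial>P)
      = (\<integral>x. path_weight f j n x \<partial>P) * prob {x \<in> space P. \<tau> 1 x = enat m}" .
qed

lemma integral_path_weight:
  assumes K: "\<And>n. n \<ge> 1 \<Longrightarrow> prob {x \<in> space P. \<tau> 1 x = enat n} = K n"
  shows "(\<integral>x. path_weight f j n x \<partial>P) = pinned_steps K f j n"
proof (induction j arbitrary: n)
  case 0
  have "(\<integral>x. path_weight f 0 n x \<partial>P) = (\<integral>x. (if n = 0 then 1 else 0) \<partial>P)"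
    using AE_renewal_path
    by (intro integral_cong_AE) (auto simp: path_weight_def zero_enat_def elim!: eventually_mono)
  then show ?case by (simp add: prob_space)
next
  case (Suc j)
  have "(\<integral>x. path_weight f (Suc j) n x \<partial>P)
      = (\<integral>x. (\<Sum>k<n. f n * (path_weight f j k x * of_bool (\<tau> (Suc j) x = enat (k + (n - k))))) \<partial>P)"
  proof (rule integral_cong_AE)
    show "AE x in P. path_weight f (Suc j) n x = (\<Sum>k<n. f n * (path_weight f j k x * of_bool (\<tau> (Suc j) x = enat (k + (n - k)))))"
      using AE_renewal_path
    proof eventually_elim
      case (elim x)
      show ?case
      proof (cases "\<tau> (Suc j) x = enat n")
        case True
        then obtain l where l: "\<tau> j x = enat l" using elim by (cases "\<tau> j x") auto
        then have "\<tau> j x < \<tau> (Suc j) x" using elim by auto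
        then have "l < n" using l True by simp
        have "(\<Sum>k<n. f n * (path_weight f j k x * of_bool (\<tau> (Suc j) x = enat (k + (n - k)))))
          = (\<Sum>k<n. if k = l then f n * (\<Prod>i=1..j. f (the_enat (\<tau> i x))) else 0)"
          by (rule sum.cong) (use True l in \<open>auto simp: path_weight_def\<close>)
        also have "\<dots> = path_weight f (Suc j) n x"
          using \<open>l < n\<close> True by (simp add: path_weight_def mult.commute)
        finally show ?thesis ..
      next
        case False
        then show ?thesis by (auto simp: path_weight_def)
      qed
    qed
    show "(\<lambda>x. \<Sum>k<n. f n * (path_weight f j k x * of_bool (\<tau> (Suc j) x = enat (k + (n - k))))) \<in> borel_measurable P"
      by (intro borel_measurable_sum borel_measurable_times borel_measurable_const borel_measurable_integrable[OF path_weight_Markov(2)])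
  qed measurable
  also have "\<dots> = (\<Sum>k<n. f n * (pinned_steps K f j k * K (n - k)))"
    by (subst Bochner_Integration.integral_sum)
       (auto intro!: integrable_mult_right path_weight_Markov(2) sum.cong simp only: integral_mult_right_zero path_weight_Markov(3) Suc K lessThan_iff)
  finally show ?case by (simp add: sum_distrib_left)
qed

theorem partition_function_eq_free:
  assumes K: "\<And>n. n \<ge> 1 \<Longrightarrow> prob {x \<in> space P. \<tau> 1 x = enat n} = K n"
  shows "partition_function P \<tau> \<beta> h w N = free_partition K (\<lambda>n. exp (h + \<beta> * w n)) N"
proof -
  define f where "f n = exp (h + \<beta> * w n)" for n
  have G: "exp (\<Sum>n=1..N. (h + \<beta> * w n) * indicator (renewal_set \<tau> x) n)
      = (\<Prod>n=1..N. if \<exists>k. \<tau> k x = enat n then f n else 1)" for x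
    by (subst exp_sum) (auto simp: renewal_set_def f_def intro!: prod.cong)
  have [measurable]: "{x \<in> space P. \<exists>k. \<tau> k x = enat n} \<in> sets P" for n by measurable
  have m1: "(\<lambda>x. \<Prod>n=1..N. if \<exists>k. \<tau> k x = enat n then f n else 1) \<in> borel_measurable P"
    by (intro borel_measurable_prod) measurable
  let ?W = "\<lambda>n j m x. path_weight f j n x * of_bool (\<tau> (Suc j) x = enat (n + m))"
  have "partition_function P \<tau> \<beta> h w N
    = (\<integral>x. (\<Sum>n\<le>N. \<Sum>j\<le>n. path_weight f j n x - (\<Sum>m=1..N-n. ?W n j m x)) \<partial>P)"
    unfolding partition_function_def G
  proof (rule integral_cong_AE[OF m1])
    show "AE x in P. (\<Prod>n=1..N. if \<exists>k. \<tau> k x = enat n then f n else 1) =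
        (\<Sum>n\<le>N. \<Sum>j\<le>n. path_weight f j n x - (\<Sum>m=1..N-n. ?W n j m x))"
      using AE_renewal_path
    proof eventually_elim
      case (elim x)
      have "(\<Prod>n=1..N. if \<exists>k. \<tau> k x = enat n then f n else 1)
        = (\<Sum>n\<le>N. \<Sum>j\<le>n. (\<Prod>i=1..j. f (the_enat (\<tau> i x))) * of_bool (\<tau> j x = enat n)
          * (1 - (\<Sum>m=1..N-n. of_bool (\<tau> (Suc j) x = enat (n + m)))))"
        by (rule renewal_path_decomposition(1)[of "\<lambda>i. \<tau> i x"]) (use elim in blast)+
      then show ?case
        by (simp only: path_weight_def right_diff_distrib sum_distrib_left mult.assoc mult_1_right)
    qed
    show "(\<lambda>x. \<Sum>n\<le>N. \<Sum>j\<le>n. path_weight f j n x - (\<Sum>m=1..N-n. ?W n j m x)) \<in> borel_measurable P"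
      by (intro borel_measurable_sum borel_measurable_diff path_weight_measurable borel_measurable_integrable[OF path_weight_Markov(2)])
  qed
  also have "\<dots> = (\<Sum>n\<le>N. \<Sum>j\<le>n. pinned_steps K f j n - (\<Sum>m=1..N-n. pinned_steps K f j n * K m))"
  proof -
    have "(\<integral>x. path_weight f j n x - (\<Sum>m=1..M. ?W n j m x) \<partial>P)
        = pinned_steps K f j n - (\<Sum>m=1..M. pinned_steps K f j n * K m)" for n j M
    proof -
      have "(\<integral>x. path_weight f j n x - (\<Sum>m=1..M. ?W n j m x) \<partial>P)
        = (\<integral>x. path_weight f j n x \<partial>P) - (\<Sum>m=1..M. \<integral>x. ?W n j m x \<partial>P)"
        by (subst Bochner_Integration.integral_diff Bochner_Integration.integral_sum
            | intro Bochner_Integration.integrable_sum path_weight_Markov refl)+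
      also have "\<dots> = pinned_steps K f j n - (\<Sum>m=1..M. pinned_steps K f j n * K m)"
        by (intro arg_cong2[where f="(-)"] sum.cong integral_path_weight K)
           (auto simp only: path_weight_Markov(3) integral_path_weight[OF K] K atLeastAtMost_iff)
      finally show ?thesis .
    qed
    then show ?thesis
      by (subst Bochner_Integration.integral_sum | intro sum.cong refl Bochner_Integration.integrable_sum
          Bochner_Integration.integrable_diff path_weight_Markov)+
  qed
  also have "\<dots> = free_partition K f N"
    by (simp add: free_partition_def pinned_partition_def tail_def sum_distrib_left sum_distrib_right sum_subtractf algebra_simps)
  finally show ?thesis by (simp add: f_def[abs_def])
qed

end

section \<open>Averages over the environment\<close>

text \<open>
  Fekete's lemma, with the limit identified as an upper bound of the sequence.
\<close>
lemma superadditive_limit: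
  fixes a :: "nat \<Rightarrow> real"
  assumes super: "\<And>m n. m \<ge> 1 \<Longrightarrow> n \<ge> 1 \<Longrightarrow> a m + a n \<le> a (m + n)"
    and bound: "\<And>n. n \<ge> 1 \<Longrightarrow> a n \<le> C * real n"
  shows "\<exists>l. (\<lambda>n. a n / real n) \<longlonglongrightarrow> l \<and> (\<forall>n\<ge>1. a n / real n \<le> l)"
proof -
  define l where "l = (SUP n\<in>{1..}. a n / real n)"
  have bdd: "bdd_above ((\<lambda>n. a n / real n) ` {1..})"
    by (rule bdd_aboveI2[of _ _ C]) (use bound in \<open>auto simp: field_simps\<close>)
  have le: "a n / real n \<le> l" if "n \<ge> 1" for n
    unfolding l_def by (rule cSUP_upper[OF _ bdd]) (use that in auto)
  have "(\<lambda>n. a n / real n) \<longlonglongrightarrow> l"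
  proof (rule LIMSEQ_I)
    fix e :: real assume e: "e > 0"
    obtain m where m: "m \<ge> 1" "l - e / 2 < a m / real m"
    proof -
      have "l - e / 2 < l" using e by simp
      then show ?thesis unfolding l_def using less_cSUP_iff[OF _ bdd, of "l - e / 2"] that by (auto simp: l_def)
    qed
    have iter: "real q * a m + a r \<le> a (q * m + r)" if "r \<ge> 1" for q r
    proof (induction q)
      case (Suc q)
      have "a m + a (q * m + r) \<le> a (m + (q * m + r))" using m that by (intro super) auto
      then show ?case using Suc by (simp add: algebra_simps)
    qed simp
    define D where "D = \<bar>a m\<bar> + (\<Sum>r=1..m. \<bar>a r\<bar>)"
    have D: "D \<ge> 0" by (auto simp: D_def intro!: add_nonneg_nonneg sum_nonneg)
    have lower: "a n \<ge> real n * (a m / real m) - D" if n: "n \<ge> 1" for n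
    proof -
      (* Division with remainder in {1..m} instead of {0..<m}, since superadditivity needs positive arguments. *)
      define q where "q = (n - 1) div m"
      define r where "r = (n - 1) mod m + 1"
      have nq: "n = q * m + r" "r \<ge> 1" "r \<le> m"
        using n m(1) by (auto simp: q_def r_def Suc_le_eq)
      have "\<bar>a r\<bar> \<le> (\<Sum>r=1..m. \<bar>a r\<bar>)" by (rule member_le_sum) (use nq in auto)
      moreover have "real q * a m = real n * (a m / real m) - real r / real m * a m"
        using m(1) by (simp add: nq(1) field_simps)
      moreover have "real r / real m * a m \<le> \<bar>a m\<bar>"
      proof -
        have "real r / real m * a m \<le> real r / real m * \<bar>a m\<bar>" by (intro mult_left_mono) auto
        also have "\<dots> \<le> 1 * \<bar>a m\<bar>" using nq m by (intro mult_right_mono) auto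
        finally show ?thesis by simp
      qed
      ultimately show ?thesis using iter[OF nq(2), of q, folded nq(1)] unfolding D_def by linarith
    qed
    obtain n0 where n0: "n0 \<ge> 1" "real n0 > 2 * D / e"
    proof -
      obtain n0 :: nat where "real n0 > max 1 (2 * D / e)" using reals_Archimedean2 by blast
      then show ?thesis using that[of n0] by simp
    qed
    have "norm (a n / real n - l) < e" if n: "n \<ge> n0" for n
    proof -
      have n1: "n \<ge> 1" using n n0 by auto
      have "real n > 2 * D / e" using n n0 by (meson less_le_trans of_nat_mono)
      then have "D / real n < e / 2" using e n1 by (simp add: field_simps)
      moreover have "a n / real n \<ge> a m / real m - D / real n"
        using divide_right_mono[OF lower[OF n1], of "real n"] n1 by (simp add: diff_divide_distrib)
      ultimately show ?thesis using m(2) le[OF n1] by (simp add: abs_less_iff)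
    qed
    then show "\<exists>n0. \<forall>n\<ge>n0. norm (a n / real n - l) < e" by blast
  qed
  with le show ?thesis by blast
qed

text \<open>
  With \<open>K\<close> normalised by \<open>S\<close> this is a geometric series: each contact contributes at most the factor \<open>c S\<close>.
\<close>
lemma sum_pinned_const_le:
  assumes K: "\<And>n. n \<ge> 1 \<Longrightarrow> K n \<ge> 0" and S: "\<And>n. (\<Sum>k=1..n. K k) \<le> S" "S > 0"
    and c: "0 \<le> c" "c * S < 1"
  shows "(\<Sum>n\<le>N. pinned_partition K (\<lambda>_. c) n) \<le> 1 / (1 - c * S)"
proof -
  let ?K = "\<lambda>n. (1 / S) * K n"
  have e: "pinned_partition ?K (\<lambda>_. c * S) n = pinned_partition K (\<lambda>_. c) n" for n
    unfolding pinned_kernel_scale using S(2) by simp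
  have t: "tail ?K m \<ge> 0" for m
    using S(1)[of m] S(2) by (simp add: tail_def sum_distrib_left[symmetric] sum_divide_distrib[symmetric])
  have "free_partition ?K (\<lambda>_. c * S) N \<ge> tail ?K N"
    by (rule free_ge_tail) (use K S c t in auto)
  then have "c * S * free_partition ?K (\<lambda>_. c * S) N \<ge> 0" using t[of N] c S by (intro mult_nonneg_nonneg) auto
  then have "(1 - c * S) * (\<Sum>n\<le>N. pinned_partition K (\<lambda>_. c) n) \<le> 1"
    using sum_pinned_const[of "c * S" ?K N] unfolding e by linarith
  then show ?thesis using c by (simp add: field_simps)
qed

lemma pinned_measurable_PiM:
  fixes g :: "real \<Rightarrow> real"
  assumes [measurable]: "g \<in> borel_measurable borel"
  shows "n \<le> m \<Longrightarrow> (\<lambda>w. pinned_partition K (\<lambda>i. g (w i)) n) \<in> borel_measurable (Pi\<^sub>M {1..m} (\<lambda>_. borel))"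
proof (induction n rule: less_induct)
  case (less n)
  show ?case
  proof (cases "n = 0")
    case False
    have "(\<lambda>w. w n) \<in> borel_measurable (Pi\<^sub>M {1..m} (\<lambda>_. borel :: real measure))"
      using False less by (intro measurable_component_singleton) auto
    moreover have "(\<lambda>w. \<Sum>k<n. pinned_partition K (\<lambda>i. g (w i)) k * K (n - k)) \<in> borel_measurable (Pi\<^sub>M {1..m} (\<lambda>_. borel))"
      using less by (intro borel_measurable_sum borel_measurable_times) auto
    ultimately have "(\<lambda>w. g (w n) * (\<Sum>k<n. pinned_partition K (\<lambda>i. g (w i)) k * K (n - k))) \<in> borel_measurable (Pi\<^sub>M {1..m} (\<lambda>_. borel))"
      by measurable
    then show ?thesis using False by (simp add: pinned_rec)
  qed simp
qed

context environment
begin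

lemma \<omega>_measurable [measurable]: "n \<ge> 1 \<Longrightarrow> \<omega> n \<in> borel_measurable Q"
  using indep_\<omega> by (auto simp: indep_vars_def2)

lemma integral_single_site:
  fixes g :: "real \<Rightarrow> real"
  assumes [measurable]: "g \<in> borel_measurable borel" and n: "n \<ge> 1"
  shows "(\<integral>y. g (\<omega> n y) \<partial>Q) = (\<integral>y. g (\<omega> 1 y) \<partial>Q)"
    and "integrable Q (\<lambda>y. g (\<omega> n y)) \<longleftrightarrow> integrable Q (\<lambda>y. g (\<omega> 1 y))"
proof -
  note [measurable] = \<omega>_measurable[OF n] \<omega>_measurable[OF order_refl]
  have "(\<integral>y. g (\<omega> n y) \<partial>Q) = (\<integral>x. g x \<partial>distr Q borel (\<omega> n))"
    by (subst integral_distr) auto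
  also have "\<dots> = (\<integral>y. g (\<omega> 1 y) \<partial>Q)"
    unfolding identically_distributed_\<omega>[OF n] by (subst integral_distr) auto
  finally show "(\<integral>y. g (\<omega> n y) \<partial>Q) = (\<integral>y. g (\<omega> 1 y) \<partial>Q)" .
  have "integrable Q (\<lambda>y. g (\<omega> n y)) \<longleftrightarrow> integrable (distr Q borel (\<omega> n)) g"
    by (subst integrable_distr_eq) auto
  also have "\<dots> \<longleftrightarrow> integrable Q (\<lambda>y. g (\<omega> 1 y))"
    unfolding identically_distributed_\<omega>[OF n] by (subst integrable_distr_eq) auto
  finally show "integrable Q (\<lambda>y. g (\<omega> n y)) \<longleftrightarrow> integrable Q (\<lambda>y. g (\<omega> 1 y))" .
qed

text \<open>
  The disorder at \<open>n\<close> is independent of every function of the disorder at earlier sites.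
\<close>
lemma integral_past_times_present:
  fixes g :: "real \<Rightarrow> real" and H :: "(nat \<Rightarrow> real) \<Rightarrow> real"
  assumes [measurable]: "g \<in> borel_measurable borel" and n: "n \<ge> 1"
    and H [measurable]: "H \<in> borel_measurable (Pi\<^sub>M {1..n-1} (\<lambda>_. borel))"
    and X: "\<And>y. X y = H (\<lambda>i\<in>{1..n-1}. \<omega> i y)"
    and int: "integrable Q X" "integrable Q (\<lambda>y. g (\<omega> 1 y))"
  shows "integrable Q (\<lambda>y. g (\<omega> n y) * X y)"
    and "(\<integral>y. g (\<omega> n y) * X y \<partial>Q) = (\<integral>y. g (\<omega> 1 y) \<partial>Q) * (\<integral>y. X y \<partial>Q)"
proof -
  have "indep_var (Pi\<^sub>M {n} (\<lambda>_. borel)) (\<lambda>y. \<lambda>i\<in>{n}. \<omega> i y) (Pi\<^sub>M {1..n-1} (\<lambda>_. borel)) (\<lambda>y. \<lambda>i\<in>{1..n-1}. \<omega> i y)"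
    by (rule indep_var_restrict[OF indep_\<omega>]) (use n in auto)
  then have "indep_var borel ((\<lambda>w. g (w n)) \<circ> (\<lambda>y. \<lambda>i\<in>{n}. \<omega> i y)) borel (H \<circ> (\<lambda>y. \<lambda>i\<in>{1..n-1}. \<omega> i y))"
    by (rule indep_var_compose) measurable
  moreover have "(\<lambda>w. g (w n)) \<circ> (\<lambda>y. \<lambda>i\<in>{n}. \<omega> i y) = (\<lambda>y. g (\<omega> n y))" by auto
  moreover have "H \<circ> (\<lambda>y. \<lambda>i\<in>{1..n-1}. \<omega> i y) = X" using X by auto
  ultimately have ind: "indep_var borel (\<lambda>y. g (\<omega> n y)) borel X" by simp
  have i: "integrable Q (\<lambda>y. g (\<omega> n y))" using int integral_single_site(2)[OF assms(1) n] by simp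
  show "integrable Q (\<lambda>y. g (\<omega> n y) * X y)" by (rule indep_var_integrable[OF ind i int(1)])
  show "(\<integral>y. g (\<omega> n y) * X y \<partial>Q) = (\<integral>y. g (\<omega> 1 y) \<partial>Q) * (\<integral>y. X y \<partial>Q)"
    using indep_var_lebesgue_integral[OF ind i int(1)] integral_single_site(1)[OF assms(1) n] by simp
qed

lemma pinned_restrict:
  assumes "n \<le> m"
  shows "pinned_partition K (\<lambda>i. g (\<omega> i y)) n = pinned_partition K (\<lambda>i. g ((\<lambda>i\<in>{1..m}. \<omega> i y) i)) n"
  by (rule pinned_cong) (use assms in auto)

lemma pinned_measurable [measurable]:
  assumes "g \<in> borel_measurable borel"
  shows "(\<lambda>y. pinned_partition K (\<lambda>i. g (\<omega> i y)) n) \<in> borel_measurable Q"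
proof -
  have "(\<lambda>y. \<lambda>i\<in>{1..n}. \<omega> i y) \<in> measurable Q (Pi\<^sub>M {1..n} (\<lambda>_. borel))"
    by (intro measurable_restrict) simp
  from measurable_compose[OF this pinned_measurable_PiM[OF assms order_refl]]
  show ?thesis using pinned_restrict[OF order_refl, of K g _ n] by simp
qed

lemma free_measurable [measurable]:
  assumes "g \<in> borel_measurable borel"
  shows "(\<lambda>y. free_partition K (\<lambda>i. g (\<omega> i y)) n) \<in> borel_measurable Q"
  unfolding free_partition_def using pinned_measurable[OF assms] by measurable

lemma expectation_pinned:
  fixes g :: "real \<Rightarrow> real"
  assumes g: "g \<in> borel_measurable borel" and int: "integrable Q (\<lambda>y. g (\<omega> 1 y))"
  shows "integrable Q (\<lambda>y. pinned_partition K (\<lambda>i. g (\<omega> i y)) n) \<and>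
    (\<integral>y. pinned_partition K (\<lambda>i. g (\<omega> i y)) n \<partial>Q) = pinned_partition K (\<lambda>_. \<integral>y. g (\<omega> 1 y) \<partial>Q) n"
proof (induction n rule: less_induct)
  case (less n)
  show ?case
  proof (cases "n = 0")
    case True
    then show ?thesis by (simp add: prob_space)
  next
    case False
    define X where "X y = (\<Sum>k<n. pinned_partition K (\<lambda>i. g (\<omega> i y)) k * K (n - k))" for y
    have iX: "integrable Q X" unfolding X_def
      using less by (intro Bochner_Integration.integrable_sum integrable_mult_left) auto
    have EX: "(\<integral>y. X y \<partial>Q) = (\<Sum>k<n. pinned_partition K (\<lambda>_. \<integral>y. g (\<omega> 1 y) \<partial>Q) k * K (n - k))"
      unfolding X_def using less by (subst Bochner_Integration.integral_sum) auto
    let ?H = "\<lambda>w. \<Sum>k<n. pinned_partition K (\<lambda>i. g (w i)) k * K (n - k)"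
    have XH: "X y = ?H (\<lambda>i\<in>{1..n-1}. \<omega> i y)" for y
      unfolding X_def
      by (intro sum.cong arg_cong2[where f="(*)"] pinned_restrict refl) auto
    have H: "?H \<in> borel_measurable (Pi\<^sub>M {1..n-1} (\<lambda>_. borel))"
      by (intro borel_measurable_sum borel_measurable_times pinned_measurable_PiM g) auto
    have rec: "pinned_partition K (\<lambda>i. g (\<omega> i y)) n = g (\<omega> n y) * X y" for y
      using False by (simp add: pinned_rec X_def)
    have n1: "1 \<le> n" using False by simp
    note past = integral_past_times_present[OF g n1 H XH iX int]
    have "(\<integral>y. g (\<omega> 1 y) \<partial>Q) * (\<integral>y. X y \<partial>Q) = pinned_partition K (\<lambda>_. \<integral>y. g (\<omega> 1 y) \<partial>Q) n"
      unfolding EX using False by (subst pinned_rec) auto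
    with past show ?thesis unfolding rec by simp
  qed
qed

lemma expectation_free:
  fixes g :: "real \<Rightarrow> real"
  assumes g: "g \<in> borel_measurable borel" and int: "integrable Q (\<lambda>y. g (\<omega> 1 y))"
  shows "integrable Q (\<lambda>y. free_partition K (\<lambda>i. g (\<omega> i y)) n)"
    and "(\<integral>y. free_partition K (\<lambda>i. g (\<omega> i y)) n \<partial>Q) = free_partition K (\<lambda>_. \<integral>y. g (\<omega> 1 y) \<partial>Q) n"
  unfolding free_partition_def using expectation_pinned[OF g int, of K]
  by (auto intro!: Bochner_Integration.integrable_sum integrable_mult_left simp: Bochner_Integration.integral_sum)

text \<open>
  The recursion writes \<open>X\<^sub>n\<close> as \<open>g (\<omega>\<^sub>n)\<close> times a linear combination of earlier terms. A centred new factor makes \<open>X\<^sub>n\<close>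
  orthogonal to the past, and squaring the recursion shows that the variances satisfy the same recursion with
  squared kernel and weight \<open>E g\<^sup>2\<close>.
\<close>
lemma pinned_orthogonality:
  fixes g :: "real \<Rightarrow> real" and u :: "nat \<Rightarrow> real"
  assumes g: "g \<in> borel_measurable borel" and int: "integrable Q (\<lambda>y. g (\<omega> 1 y))" "integrable Q (\<lambda>y. (g (\<omega> 1 y))\<^sup>2)"
    and mean: "(\<integral>y. g (\<omega> 1 y) \<partial>Q) = 0"
  defines "X \<equiv> \<lambda>n y. pinned_partition u (\<lambda>i. g (\<omega> i y)) n"
  shows "integrable Q (\<lambda>y. X k y * X l y)"
    and "(\<integral>y. X k y * X l y \<partial>Q) = (if k = l then pinned_partition (\<lambda>n. (u n)\<^sup>2) (\<lambda>_. \<integral>y. (g (\<omega> 1 y))\<^sup>2 \<partial>Q) k else 0)"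
proof -
  let ?\<kappa> = "\<integral>y. (g (\<omega> 1 y))\<^sup>2 \<partial>Q" and ?p = "\<lambda>k. pinned_partition (\<lambda>n. (u n)\<^sup>2) (\<lambda>_. \<integral>y. (g (\<omega> 1 y))\<^sup>2 \<partial>Q) k"
  have g2: "(\<lambda>x. (g x)\<^sup>2) \<in> borel_measurable borel" using g by measurable
  have "\<forall>k\<le>n. \<forall>l\<le>n. integrable Q (\<lambda>y. X k y * X l y) \<and> (\<integral>y. X k y * X l y \<partial>Q) = (if k = l then ?p k else 0)" for n
  proof (induction n)
    case 0
    then show ?case by (simp add: X_def prob_space)
  next
    case (Suc n)
    define S where "S y = (\<Sum>k<Suc n. X k y * u (Suc n - k))" for y
    define HX where "HX k w = pinned_partition u (\<lambda>i. g (w i)) k" for k and w :: "nat \<Rightarrow> real"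
    define HS where "HS w = (\<Sum>k<Suc n. HX k w * u (Suc n - k))" for w
    have HX: "HX k \<in> borel_measurable (Pi\<^sub>M {1..Suc n-1} (\<lambda>_. borel))" if "k \<le> n" for k
      unfolding HX_def by (rule pinned_measurable_PiM[OF g]) (use that in simp)
    have HS: "HS \<in> borel_measurable (Pi\<^sub>M {1..Suc n-1} (\<lambda>_. borel))"
      unfolding HS_def by (intro borel_measurable_sum borel_measurable_times HX) auto
    have XH: "X k y = HX k (\<lambda>i\<in>{1..Suc n-1}. \<omega> i y)" if "k \<le> n" for k y
      unfolding X_def HX_def by (rule pinned_restrict) (use that in simp)
    have SH: "S y = HS (\<lambda>i\<in>{1..Suc n-1}. \<omega> i y)" for y
      unfolding S_def HS_def by (intro sum.cong) (auto simp: XH)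
    have rec: "X (Suc n) y = g (\<omega> (Suc n) y) * S y" for y
      unfolding X_def S_def by (simp only: pinned_rec[of "Suc n"] zero_less_Suc)
    have IH: "integrable Q (\<lambda>y. X k y * X l y)" "(\<integral>y. X k y * X l y \<partial>Q) = (if k = l then ?p k else 0)"
      if "k < Suc n" "l < Suc n" for k l
      using Suc that by auto
    have SX: "integrable Q (\<lambda>y. S y * X l y)" if "l < Suc n" for l
    proof -
      have "S y * X l y = (\<Sum>k<Suc n. u (Suc n - k) * (X k y * X l y))" for y
        unfolding S_def sum_distrib_right by (rule sum.cong) auto
      then show ?thesis
        using IH(1)[OF _ that] by (auto intro!: Bochner_Integration.integrable_sum integrable_mult_right simp del: sum.lessThan_Suc)
    qed
    have S2: "S y * S y = (\<Sum>k<Suc n. \<Sum>l<Suc n. (u (Suc n - k) * u (Suc n - l)) * (X k y * X l y))" for y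
      unfolding S_def sum_product by (intro sum.cong) auto
    have iS2: "integrable Q (\<lambda>y. S y * S y)"
      unfolding S2 by (intro Bochner_Integration.integrable_sum integrable_mult_right IH) auto
    have ES2: "(\<integral>y. S y * S y \<partial>Q) = (\<Sum>k<Suc n. ?p k * (u (Suc n - k))\<^sup>2)"
    proof -
      have "(\<integral>y. S y * S y \<partial>Q) = (\<Sum>k<Suc n. \<Sum>l<Suc n. (u (Suc n - k) * u (Suc n - l)) * (\<integral>y. X k y * X l y \<partial>Q))"
      proof -
        have "(\<integral>y. S y * S y \<partial>Q) = (\<Sum>k<Suc n. \<integral>y. (\<Sum>l<Suc n. (u (Suc n - k) * u (Suc n - l)) * (X k y * X l y)) \<partial>Q)"
          unfolding S2
          by (rule Bochner_Integration.integral_sum) (intro Bochner_Integration.integrable_sum integrable_mult_right IH, auto)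
        also have "\<dots> = (\<Sum>k<Suc n. \<Sum>l<Suc n. \<integral>y. (u (Suc n - k) * u (Suc n - l)) * (X k y * X l y) \<partial>Q)"
          by (intro sum.cong refl Bochner_Integration.integral_sum integrable_mult_right IH) auto
        finally show ?thesis by (simp only: integral_mult_right_zero)
      qed
      also have "\<dots> = (\<Sum>k<Suc n. \<Sum>l<Suc n. if l = k then ?p k * (u (Suc n - k))\<^sup>2 else 0)"
        by (intro sum.cong refl) (simp add: IH(2) power2_eq_square)
      also have "\<dots> = (\<Sum>k<Suc n. ?p k * (u (Suc n - k))\<^sup>2)"
        by (intro sum.cong refl) (simp only: sum.delta finite_lessThan if_True)
      finally show ?thesis .
    qed
    have new: "integrable Q (\<lambda>y. X (Suc n) y * X l y) \<and> (\<integral>y. X (Suc n) y * X l y \<partial>Q) = 0" if "l < Suc n" for l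
    proof -
      have "(\<lambda>w. HS w * HX l w) \<in> borel_measurable (Pi\<^sub>M {1..Suc n-1} (\<lambda>_. borel))"
        using HS HX[of l] that by (intro borel_measurable_times) auto
      moreover have "S y * X l y = (\<lambda>w. HS w * HX l w) (\<lambda>i\<in>{1..Suc n-1}. \<omega> i y)" for y
        using SH[of y] XH[of l y] that by simp
      ultimately show ?thesis
        using integral_past_times_present[OF g, of "Suc n" "\<lambda>w. HS w * HX l w" "\<lambda>y. S y * X l y"] SX[OF that] int mean
        by (simp add: rec mult.assoc)
    qed
    have diag: "integrable Q (\<lambda>y. X (Suc n) y * X (Suc n) y) \<and> (\<integral>y. X (Suc n) y * X (Suc n) y \<partial>Q) = ?p (Suc n)"
    proof -
      have "(\<lambda>w. HS w * HS w) \<in> borel_measurable (Pi\<^sub>M {1..Suc n-1} (\<lambda>_. borel))"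
        using HS by (intro borel_measurable_times)
      moreover have "S y * S y = (\<lambda>w. HS w * HS w) (\<lambda>i\<in>{1..Suc n-1}. \<omega> i y)" for y
        using SH[of y] by simp
      moreover have "X (Suc n) y * X (Suc n) y = (g (\<omega> (Suc n) y))\<^sup>2 * (S y * S y)" for y
        by (simp add: rec power2_eq_square)
      moreover note integral_past_times_present[OF g2, of "Suc n" "\<lambda>w. HS w * HS w" "\<lambda>y. S y * S y"]
      moreover have "?p (Suc n) = ?\<kappa> * (\<integral>y. S y * S y \<partial>Q)"
        unfolding ES2 by (subst pinned_rec) auto
      ultimately show ?thesis using iS2 int by simp
    qed
    show ?case
    proof (intro allI impI)
      fix k l assume "k \<le> Suc n" "l \<le> Suc n"
      then consider "k \<le> n" "l \<le> n" | "k = Suc n" "l \<le> n" | "k \<le> n" "l = Suc n" | "k = Suc n" "l = Suc n"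
        by linarith
      then show "integrable Q (\<lambda>y. X k y * X l y) \<and> (\<integral>y. X k y * X l y \<partial>Q) = (if k = l then ?p k else 0)"
        using Suc new[of l] new[of k] diag by cases (auto simp: mult.commute)
    qed
  qed
  then show "integrable Q (\<lambda>y. X k y * X l y)" "(\<integral>y. X k y * X l y \<partial>Q) = (if k = l then ?p k else 0)"
    by (meson max.cobounded1 max.cobounded2)+
qed

lemma free_second_moment:
  fixes g :: "real \<Rightarrow> real"
  assumes g: "g \<in> borel_measurable borel" and int: "integrable Q (\<lambda>y. g (\<omega> 1 y))" "integrable Q (\<lambda>y. (g (\<omega> 1 y))\<^sup>2)"
    and mean: "(\<integral>y. g (\<omega> 1 y) \<partial>Q) = 0"
  shows "integrable Q (\<lambda>y. (free_partition K (\<lambda>i. 1 + g (\<omega> i y)) N)\<^sup>2)"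
    and "(\<integral>y. (free_partition K (\<lambda>i. 1 + g (\<omega> i y)) N)\<^sup>2 \<partial>Q) =
      (\<Sum>n\<le>N. pinned_partition (\<lambda>n. (pinned_partition K (\<lambda>_. 1) n)\<^sup>2) (\<lambda>_. \<integral>y. (g (\<omega> 1 y))\<^sup>2 \<partial>Q) n)"
proof -
  note O = pinned_orthogonality[OF g int mean, of "pinned_partition K (\<lambda>_. 1)"]
  have e: "(free_partition K (\<lambda>i. 1 + g (\<omega> i y)) N)\<^sup>2 = (\<Sum>k\<le>N. \<Sum>l\<le>N. pinned_partition (pinned_partition K (\<lambda>_. 1)) (\<lambda>i. g (\<omega> i y)) k * pinned_partition (pinned_partition K (\<lambda>_. 1)) (\<lambda>i. g (\<omega> i y)) l)" for y
    by (simp only: pinned_one_plus(2) power2_eq_square sum_product)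
  show "integrable Q (\<lambda>y. (free_partition K (\<lambda>i. 1 + g (\<omega> i y)) N)\<^sup>2)"
    unfolding e by (intro Bochner_Integration.integrable_sum O)
  show "(\<integral>y. (free_partition K (\<lambda>i. 1 + g (\<omega> i y)) N)\<^sup>2 \<partial>Q) =
      (\<Sum>n\<le>N. pinned_partition (\<lambda>n. (pinned_partition K (\<lambda>_. 1) n)\<^sup>2) (\<lambda>_. \<integral>y. (g (\<omega> 1 y))\<^sup>2 \<partial>Q) n)"
    unfolding e
    by (simp add: Bochner_Integration.integral_sum Bochner_Integration.integrable_sum O cong: if_cong)
qed

text \<open>
  The environment seen from \<open>N\<close> has the same law; both finite-dimensional laws are the same product measure.
\<close>
lemma integral_shift:
  assumes H: "H \<in> borel_measurable (Pi\<^sub>M {1..m} (\<lambda>_. borel :: real measure))" and m: "m \<ge> 1"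
  shows "(\<integral>y. H (\<lambda>i\<in>{1..m}. \<omega> (N + i) y) \<partial>Q) = (\<integral>y. (H (\<lambda>i\<in>{1..m}. \<omega> i y) :: real) \<partial>Q)"
proof -
  let ?\<mu> = "distr Q borel (\<omega> 1)"
  have d: "distr Q (Pi\<^sub>M {1..m} (\<lambda>_. borel)) (\<lambda>y. \<lambda>i\<in>{1..m}. \<omega> (N + i) y) = Pi\<^sub>M {1..m} (\<lambda>_. ?\<mu>)" for N
  proof -
    have \<mu>: "prob_space ?\<mu>" by (rule prob_space_distr) simp
    have "indep_vars (\<lambda>_. borel) \<omega> {N+1..N+m}"
      by (rule indep_vars_subset[OF indep_\<omega>]) auto
    then have "distr Q (Pi\<^sub>M {N+1..N+m} (\<lambda>_. borel)) (\<lambda>y. \<lambda>i\<in>{N+1..N+m}. \<omega> i y) = Pi\<^sub>M {N+1..N+m} (\<lambda>i. distr Q borel (\<omega> i))"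
      using m by (subst (asm) indep_vars_iff_distr_eq_PiM') auto
    also have "\<dots> = Pi\<^sub>M {N+1..N+m} (\<lambda>_. ?\<mu>)"
      by (intro PiM_cong refl identically_distributed_\<omega>) auto
    finally have *: "distr Q (Pi\<^sub>M {N+1..N+m} (\<lambda>_. borel)) (\<lambda>y. \<lambda>i\<in>{N+1..N+m}. \<omega> i y) = Pi\<^sub>M {N+1..N+m} (\<lambda>_. ?\<mu>)" .
    have "Pi\<^sub>M {1..m} (\<lambda>_. ?\<mu>) = distr (Pi\<^sub>M {N+1..N+m} (\<lambda>_. ?\<mu>)) (Pi\<^sub>M {1..m} (\<lambda>_. ?\<mu>)) (\<lambda>w. \<lambda>i\<in>{1..m}. w (N + i))"
      by (rule distr_PiM_reindex[symmetric, where M="\<lambda>_. ?\<mu>", OF \<mu>]) auto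
    also have "\<dots> = distr (Pi\<^sub>M {N+1..N+m} (\<lambda>_. ?\<mu>)) (Pi\<^sub>M {1..m} (\<lambda>_. borel)) (\<lambda>w. \<lambda>i\<in>{1..m}. w (N + i))"
      by (intro distr_cong sets_PiM_cong) auto
    also have "\<dots> = distr Q (Pi\<^sub>M {1..m} (\<lambda>_. borel)) ((\<lambda>w. \<lambda>i\<in>{1..m}. w (N + i)) \<circ> (\<lambda>y. \<lambda>i\<in>{N+1..N+m}. \<omega> i y))"
      unfolding *[symmetric]
      by (intro distr_distr measurable_restrict measurable_component_singleton \<omega>_measurable) auto
    also have "\<dots> = distr Q (Pi\<^sub>M {1..m} (\<lambda>_. borel)) (\<lambda>y. \<lambda>i\<in>{1..m}. \<omega> (N + i) y)"
      by (intro distr_cong) auto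
    finally show ?thesis ..
  qed
  have i: "(\<integral>y. H (\<lambda>i\<in>{1..m}. \<omega> (N + i) y) \<partial>Q) = (\<integral>w. H w \<partial>Pi\<^sub>M {1..m} (\<lambda>_. ?\<mu>))" for N
    unfolding d[of N, symmetric]
    by (rule integral_distr[symmetric, OF _ H]) (auto intro!: measurable_restrict)
  show ?thesis using i[of N] i[of 0] by simp
qed

end

section \<open>Quenched free energy and the annealed bound\<close>

text \<open>
  The existence of the free energy rests on these properties of the kernel. The possibly defective
  inter-arrival law shares them with its normalisation, so the free energies of both can be compared.
\<close>
locale polynomial_kernel =
  fixes K :: "nat \<Rightarrow> real" and B p :: real
  assumes K_pos: "\<And>n. n \<ge> 1 \<Longrightarrow> K n > 0"
    and tail_nonneg: "\<And>m. tail K m \<ge> 0"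
    and B: "B \<ge> 1" and p: "p \<ge> 0"
    and K_lower: "\<And>n. n \<ge> 1 \<Longrightarrow> 1 \<le> B * real n powr p * K n"
begin

lemma K_nonneg: "n \<ge> 1 \<Longrightarrow> K n \<ge> 0"
  using K_pos less_imp_le by blast

lemma poly_ge_1: "N \<ge> 1 \<Longrightarrow> B * real N powr p \<ge> 1"
  using B p mult_mono[of 1 B 1 "real N powr p"] ge_one_powr_ge_zero[of "real N" p] by simp

lemma tail_le_poly_K:
  assumes "1 \<le> m" "m \<le> N"
  shows "tail K m \<le> (B * real N powr p) * K m"
proof -
  have "tail K m \<le> 1" using tail_le_1[OF K_nonneg] .
  also have "\<dots> \<le> (B * real m powr p) * K m" using K_lower assms by simp
  also have "\<dots> \<le> (B * real N powr p) * K m"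
    using assms B p K_nonneg[of m] by (intro mult_right_mono mult_left_mono powr_mono2) auto
  finally show ?thesis .
qed

lemma pinned_pos:
  assumes "\<And>n. n \<ge> 1 \<Longrightarrow> f n > 0"
  shows "pinned_partition K f n > 0"
proof (cases "n = 0")
  case False
  have "0 < K n * f n" using False K_pos[of n] assms[of n] by simp
  also have "\<dots> \<le> pinned_partition K f n"
    by (rule pinned_ge_one_jump) (use False K_nonneg assms less_imp_le in auto)
  finally show ?thesis .
qed simp

text \<open>
  Free and pinned partition functions differ by a polynomial factor and the disorder at the endpoint, hence
  have the same exponential growth.
\<close>
lemma free_exp_bounds:
  assumes N: "N \<ge> 1"
  shows "pinned_partition K (\<lambda>i. exp (t i)) N \<le> free_partition K (\<lambda>i. exp (t i)) N"
    and "ln (free_partition K (\<lambda>i. exp (t i)) N) \<le> ln (pinned_partition K (\<lambda>i. exp (t i)) N) + ln (2 * (B * real N powr p)) + \<bar>t N\<bar>"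
    and "free_partition K (\<lambda>i. exp (t i)) N > 0"
proof -
  let ?D = "B * real N powr p"
  have D: "?D \<ge> 1" by (rule poly_ge_1[OF N])
  have pos: "pinned_partition K (\<lambda>i. exp (t i)) N > 0" by (rule pinned_pos) simp
  show le: "pinned_partition K (\<lambda>i. exp (t i)) N \<le> free_partition K (\<lambda>i. exp (t i)) N"
    by (rule pinned_le_free) (auto intro: K_nonneg tail_nonneg)
  then show fpos: "free_partition K (\<lambda>i. exp (t i)) N > 0" using pos by simp
  have "free_partition K (\<lambda>i. exp (t i)) N \<le> pinned_partition K (\<lambda>i. exp (t i)) N * (1 + ?D / exp (t N))"
    by (rule free_le_pinned) (use N K_nonneg tail_le_poly_K in auto)
  also have "\<dots> \<le> pinned_partition K (\<lambda>i. exp (t i)) N * (2 * ?D * exp \<bar>t N\<bar>)"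
  proof (rule mult_left_mono)
    have "?D / exp (t N) = ?D * exp (- t N)" by (simp add: exp_minus field_simps)
    also have "\<dots> \<le> ?D * exp \<bar>t N\<bar>" using D by (intro mult_left_mono) auto
    finally have "?D / exp (t N) \<le> ?D * exp \<bar>t N\<bar>" .
    moreover have "1 * 1 \<le> ?D * exp \<bar>t N\<bar>" using D by (intro mult_mono) auto
    ultimately show "1 + ?D / exp (t N) \<le> 2 * ?D * exp \<bar>t N\<bar>" by simp
  qed (use pos in simp)
  finally have "ln (free_partition K (\<lambda>i. exp (t i)) N) \<le> ln (pinned_partition K (\<lambda>i. exp (t i)) N * (2 * ?D * exp \<bar>t N\<bar>))"
    using fpos by (smt (verit) ln_le_cancel_iff)
  also have "\<dots> = ln (pinned_partition K (\<lambda>i. exp (t i)) N) + ln (2 * ?D) + \<bar>t N\<bar>"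
    using pos D N B by (simp add: ln_mult)
  finally show "ln (free_partition K (\<lambda>i. exp (t i)) N) \<le> ln (pinned_partition K (\<lambda>i. exp (t i)) N) + ln (2 * ?D) + \<bar>t N\<bar>" .
qed

lemma ln_pinned_exp_bounds:
  assumes N: "N \<ge> 1"
  shows "ln (pinned_partition K (\<lambda>i. exp (t i)) N) \<le> (\<Sum>i=1..N. \<bar>t i\<bar>)"
    and "ln (K N) + t N \<le> ln (pinned_partition K (\<lambda>i. exp (t i)) N)"
proof -
  have pos: "pinned_partition K (\<lambda>i. exp (t i)) N > 0" by (rule pinned_pos) simp
  have "pinned_partition K (\<lambda>i. exp (t i)) N \<le> exp (\<Sum>i=1..N. \<bar>t i\<bar>)"
    by (rule pinned_le_exp) (auto intro: K_nonneg tail_nonneg)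
  then show "ln (pinned_partition K (\<lambda>i. exp (t i)) N) \<le> (\<Sum>i=1..N. \<bar>t i\<bar>)"
    using pos by (metis ln_exp ln_le_cancel_iff exp_gt_zero)
  have "K N * exp (t N) \<le> pinned_partition K (\<lambda>i. exp (t i)) N"
    by (rule pinned_ge_one_jump) (use N K_nonneg in auto)
  then have "ln (K N * exp (t N)) \<le> ln (pinned_partition K (\<lambda>i. exp (t i)) N)"
    using K_pos[OF N] pos by (subst ln_le_cancel_iff) auto
  then show "ln (K N) + t N \<le> ln (pinned_partition K (\<lambda>i. exp (t i)) N)"
    using K_pos[OF N] by (simp add: ln_mult)
qed

end

locale disordered_pinning = environment Q \<omega> + polynomial_kernel K B p
  for Q :: "'b measure" and \<omega> :: "nat \<Rightarrow> 'b \<Rightarrow> real" and K :: "nat \<Rightarrow> real" and B p :: real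
begin

definition Z_pinned :: "real \<Rightarrow> real \<Rightarrow> nat \<Rightarrow> 'b \<Rightarrow> real" where
  "Z_pinned \<beta> h N y = pinned_partition K (\<lambda>i. exp (h + \<beta> * \<omega> i y)) N"

definition Z_free :: "real \<Rightarrow> real \<Rightarrow> nat \<Rightarrow> 'b \<Rightarrow> real" where
  "Z_free \<beta> h N y = free_partition K (\<lambda>i. exp (h + \<beta> * \<omega> i y)) N"

definition mean_log_Z :: "real \<Rightarrow> real \<Rightarrow> nat \<Rightarrow> real" where
  "mean_log_Z \<beta> h N = (\<integral>y. ln (Z_pinned \<beta> h N y) \<partial>Q)"

definition free_energy :: "real \<Rightarrow> real \<Rightarrow> real" where
  "free_energy \<beta> h = lim (\<lambda>N. (\<integral>y. ln (Z_free \<beta> h N y) \<partial>Q) / real N)"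

lemma Z_pinned_measurable [measurable]: "Z_pinned \<beta> h N \<in> borel_measurable Q"
  unfolding Z_pinned_def by (rule pinned_measurable) simp

lemma Z_free_measurable [measurable]: "Z_free \<beta> h N \<in> borel_measurable Q"
  unfolding Z_free_def by (rule free_measurable) simp

lemma Z_pinned_pos: "Z_pinned \<beta> h N y > 0"
  unfolding Z_pinned_def by (rule pinned_pos) simp

lemma integrable_abs_site: "n \<ge> 1 \<Longrightarrow> integrable Q (\<lambda>y. \<bar>h + \<beta> * \<omega> n y\<bar>)"
  "n \<ge> 1 \<Longrightarrow> (\<integral>y. \<bar>h + \<beta> * \<omega> n y\<bar> \<partial>Q) = (\<integral>y. \<bar>h + \<beta> * \<omega> 1 y\<bar> \<partial>Q)"
  using integral_single_site[of "\<lambda>x. \<bar>h + \<beta> * x\<bar>" n] integrable_\<omega> by auto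

lemma integrable_ln_Z_pinned:
  assumes "N \<ge> 1"
  shows "integrable Q (\<lambda>y. ln (Z_pinned \<beta> h N y))"
proof (rule Bochner_Integration.integrable_bound)
  show "integrable Q (\<lambda>y. \<bar>ln (K N)\<bar> + (\<Sum>i=1..N. \<bar>h + \<beta> * \<omega> i y\<bar>))"
    by (intro Bochner_Integration.integrable_add Bochner_Integration.integrable_sum integrable_abs_site) auto
  show "AE y in Q. norm (ln (Z_pinned \<beta> h N y)) \<le> norm (\<bar>ln (K N)\<bar> + (\<Sum>i=1..N. \<bar>h + \<beta> * \<omega> i y\<bar>))"
  proof (rule AE_I2)
    fix y
    have "\<bar>h + \<beta> * \<omega> N y\<bar> \<le> (\<Sum>i=1..N. \<bar>h + \<beta> * \<omega> i y\<bar>)"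
      by (rule member_le_sum[where f="\<lambda>i. \<bar>h + \<beta> * \<omega> i y\<bar>"]) (use assms in auto)
    then show "norm (ln (Z_pinned \<beta> h N y)) \<le> norm (\<bar>ln (K N)\<bar> + (\<Sum>i=1..N. \<bar>h + \<beta> * \<omega> i y\<bar>))"
      using ln_pinned_exp_bounds[OF assms, of "\<lambda>i. h + \<beta> * \<omega> i y"] unfolding Z_pinned_def by (simp add: abs_le_iff) linarith
  qed
qed measurable

lemma ln_Z_free_bounds:
  assumes "N \<ge> 1"
  shows "ln (Z_pinned \<beta> h N y) \<le> ln (Z_free \<beta> h N y)"
    and "ln (Z_free \<beta> h N y) \<le> ln (Z_pinned \<beta> h N y) + ln (2 * (B * real N powr p)) + \<bar>h + \<beta> * \<omega> N y\<bar>"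
    and "Z_free \<beta> h N y > 0"
proof -
  note * = free_exp_bounds[OF assms, of "\<lambda>i. h + \<beta> * \<omega> i y"]
  show "Z_free \<beta> h N y > 0" "ln (Z_free \<beta> h N y) \<le> ln (Z_pinned \<beta> h N y) + ln (2 * (B * real N powr p)) + \<bar>h + \<beta> * \<omega> N y\<bar>"
    using * unfolding Z_pinned_def Z_free_def by auto
  then show "ln (Z_pinned \<beta> h N y) \<le> ln (Z_free \<beta> h N y)"
    using *(1) Z_pinned_pos[of \<beta> h N y] unfolding Z_pinned_def Z_free_def by simp
qed

lemma integral_ln_Z_free:
  assumes N: "N \<ge> 1"
  shows "integrable Q (\<lambda>y. ln (Z_free \<beta> h N y))"
    and "mean_log_Z \<beta> h N \<le> (\<integral>y. ln (Z_free \<beta> h N y) \<partial>Q)"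
    and "(\<integral>y. ln (Z_free \<beta> h N y) \<partial>Q) \<le> mean_log_Z \<beta> h N + ln (2 * (B * real N powr p)) + (\<integral>y. \<bar>h + \<beta> * \<omega> 1 y\<bar> \<partial>Q)"
proof -
  let ?U = "\<lambda>y. ln (Z_pinned \<beta> h N y) + ln (2 * (B * real N powr p)) + \<bar>h + \<beta> * \<omega> N y\<bar>"
  note b = ln_Z_free_bounds[OF N, of \<beta> h]
  have iU: "integrable Q ?U"
    by (intro Bochner_Integration.integrable_add integrable_ln_Z_pinned integrable_abs_site N) auto
  show i: "integrable Q (\<lambda>y. ln (Z_free \<beta> h N y))"
  proof (rule Bochner_Integration.integrable_bound)
    show "integrable Q (\<lambda>y. \<bar>ln (Z_pinned \<beta> h N y)\<bar> + \<bar>?U y\<bar>)"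
      by (rule Bochner_Integration.integrable_add[OF integrable_abs[OF integrable_ln_Z_pinned[OF N]] integrable_abs[OF iU]])
    show "AE y in Q. norm (ln (Z_free \<beta> h N y)) \<le> norm (\<bar>ln (Z_pinned \<beta> h N y)\<bar> + \<bar>?U y\<bar>)"
    proof (rule AE_I2)
      fix y
      show "norm (ln (Z_free \<beta> h N y)) \<le> norm (\<bar>ln (Z_pinned \<beta> h N y)\<bar> + \<bar>?U y\<bar>)"
        using b(1)[of y] b(2)[of y] by (simp only: real_norm_def)
    qed
  qed measurable
  show "mean_log_Z \<beta> h N \<le> (\<integral>y. ln (Z_free \<beta> h N y) \<partial>Q)"
    unfolding mean_log_Z_def by (rule integral_mono[OF integrable_ln_Z_pinned[OF N] i b(1)])
  have "(\<integral>y. ln (Z_free \<beta> h N y) \<partial>Q) \<le> (\<integral>y. ?U y \<partial>Q)"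
    by (rule integral_mono[OF i iU b(2)])
  also have "\<dots> = (\<integral>y. ln (Z_pinned \<beta> h N y) + ln (2 * (B * real N powr p)) \<partial>Q) + (\<integral>y. \<bar>h + \<beta> * \<omega> N y\<bar> \<partial>Q)"
    by (intro Bochner_Integration.integral_add Bochner_Integration.integrable_add integrable_ln_Z_pinned integrable_abs_site N integrable_const)
  also have "\<dots> = mean_log_Z \<beta> h N + ln (2 * (B * real N powr p)) + (\<integral>y. \<bar>h + \<beta> * \<omega> 1 y\<bar> \<partial>Q)"
    unfolding mean_log_Z_def integrable_abs_site(2)[OF N]
    using integrable_ln_Z_pinned[OF N] by (subst Bochner_Integration.integral_add) (auto simp: prob_space)
  finally show "(\<integral>y. ln (Z_free \<beta> h N y) \<partial>Q) \<le> mean_log_Z \<beta> h N + ln (2 * (B * real N powr p)) + (\<integral>y. \<bar>h + \<beta> * \<omega> 1 y\<bar> \<partial>Q)" .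
qed

text \<open>
  Superadditivity of the pinned partition function, combined with the shift invariance of the environment.
\<close>
lemma mean_log_Z_superadditive:
  assumes "M \<ge> 1" "N \<ge> 1"
  shows "mean_log_Z \<beta> h N + mean_log_Z \<beta> h M \<le> mean_log_Z \<beta> h (N + M)"
proof -
  define H where "H w = ln (pinned_partition K (\<lambda>i. exp (h + \<beta> * w i)) M)" for w :: "nat \<Rightarrow> real"
  have H: "H \<in> borel_measurable (Pi\<^sub>M {1..M} (\<lambda>_. borel))"
    unfolding H_def using pinned_measurable_PiM[of "\<lambda>x. exp (h + \<beta> * x)" M M K] by measurable
  define S where "S y = ln (pinned_partition K (\<lambda>i. exp (h + \<beta> * \<omega> (N + i) y)) M)" for y
  have HS: "H (\<lambda>i\<in>{1..M}. \<omega> (N + i) y) = S y" for y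
    unfolding H_def S_def by (intro arg_cong[of _ _ ln] pinned_cong) auto
  have H0: "H (\<lambda>i\<in>{1..M}. \<omega> i y) = ln (Z_pinned \<beta> h M y)" for y
    unfolding H_def Z_pinned_def by (intro arg_cong[of _ _ ln] pinned_cong) auto
  have ES: "(\<integral>y. S y \<partial>Q) = mean_log_Z \<beta> h M"
    using integral_shift[OF H assms(1), of N] unfolding HS H0 mean_log_Z_def .
  have Smeas: "S \<in> borel_measurable Q"
  proof -
    have "(\<lambda>y. \<lambda>i\<in>{1..M}. \<omega> (N + i) y) \<in> measurable Q (Pi\<^sub>M {1..M} (\<lambda>_. borel))"
      by (intro measurable_restrict) simp
    from measurable_compose[OF this H] show ?thesis unfolding HS .
  qed
  have iS: "integrable Q S"
  proof (rule Bochner_Integration.integrable_bound[OF _ Smeas])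
    show "integrable Q (\<lambda>y. \<bar>ln (K M)\<bar> + (\<Sum>i=1..M. \<bar>h + \<beta> * \<omega> (N + i) y\<bar>))"
      by (intro Bochner_Integration.integrable_add Bochner_Integration.integrable_sum integrable_abs_site) auto
    show "AE y in Q. norm (S y) \<le> norm (\<bar>ln (K M)\<bar> + (\<Sum>i=1..M. \<bar>h + \<beta> * \<omega> (N + i) y\<bar>))"
    proof (rule AE_I2)
      fix y
      have "\<bar>h + \<beta> * \<omega> (N + M) y\<bar> \<le> (\<Sum>i=1..M. \<bar>h + \<beta> * \<omega> (N + i) y\<bar>)"
        by (rule member_le_sum[where f="\<lambda>i. \<bar>h + \<beta> * \<omega> (N + i) y\<bar>"]) (use assms in auto)
      then show "norm (S y) \<le> norm (\<bar>ln (K M)\<bar> + (\<Sum>i=1..M. \<bar>h + \<beta> * \<omega> (N + i) y\<bar>))"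
        using ln_pinned_exp_bounds[OF assms(1), of "\<lambda>i. h + \<beta> * \<omega> (N + i) y"] unfolding S_def by (simp add: abs_le_iff) linarith
    qed
  qed
  have le: "ln (Z_pinned \<beta> h N y) + S y \<le> ln (Z_pinned \<beta> h (N + M) y)" for y
  proof -
    have pos: "pinned_partition K (\<lambda>i. exp (h + \<beta> * \<omega> (N + i) y)) M > 0" by (rule pinned_pos) simp
    have "Z_pinned \<beta> h N y * pinned_partition K (\<lambda>i. exp (h + \<beta> * \<omega> (N + i) y)) M \<le> Z_pinned \<beta> h (N + M) y"
      unfolding Z_pinned_def by (rule pinned_superadditive) (auto intro: K_nonneg)
    then have "ln (Z_pinned \<beta> h N y * pinned_partition K (\<lambda>i. exp (h + \<beta> * \<omega> (N + i) y)) M) \<le> ln (Z_pinned \<beta> h (N + M) y)"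
      using pos Z_pinned_pos by (subst ln_le_cancel_iff) auto
    then show ?thesis unfolding S_def using pos Z_pinned_pos[of \<beta> h N y] by (simp add: ln_mult)
  qed
  have "mean_log_Z \<beta> h N + mean_log_Z \<beta> h M = (\<integral>y. ln (Z_pinned \<beta> h N y) + S y \<partial>Q)"
    using integrable_ln_Z_pinned[OF assms(2)] iS ES by (simp add: mean_log_Z_def)
  also have "\<dots> \<le> mean_log_Z \<beta> h (N + M)"
    unfolding mean_log_Z_def using assms by (intro integral_mono Bochner_Integration.integrable_add iS integrable_ln_Z_pinned le) auto
  finally show ?thesis .
qed

lemma mean_log_Z_le:
  assumes N: "N \<ge> 1"
  shows "mean_log_Z \<beta> h N \<le> (\<integral>y. \<bar>h + \<beta> * \<omega> 1 y\<bar> \<partial>Q) * real N"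
proof -
  have "mean_log_Z \<beta> h N \<le> (\<integral>y. (\<Sum>i=1..N. \<bar>h + \<beta> * \<omega> i y\<bar>) \<partial>Q)"
    unfolding mean_log_Z_def
  proof (intro integral_mono integrable_ln_Z_pinned[OF N])
    show "ln (Z_pinned \<beta> h N y) \<le> (\<Sum>i=1..N. \<bar>h + \<beta> * \<omega> i y\<bar>)" for y
      using ln_pinned_exp_bounds[OF N, of "\<lambda>i. h + \<beta> * \<omega> i y"] unfolding Z_pinned_def by simp
  qed (intro Bochner_Integration.integrable_sum integrable_abs_site, auto)
  also have "\<dots> = (\<Sum>i=1..N. (\<integral>y. \<bar>h + \<beta> * \<omega> i y\<bar> \<partial>Q))"
    by (intro Bochner_Integration.integral_sum integrable_abs_site) auto
  also have "\<dots> = (\<Sum>i=1..N. (\<integral>y. \<bar>h + \<beta> * \<omega> 1 y\<bar> \<partial>Q))"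
    by (intro sum.cong integrable_abs_site(2)) auto
  finally show ?thesis by (simp add: mult.commute)
qed

text \<open>
  Fekete's lemma for the pinned partition function, whose mean logarithm differs from that of the free one by
  a term of order \<open>ln N\<close>. The limit is a supremum, so every finite volume yields a lower bound.
\<close>
theorem free_energy_exists:
  shows "(\<lambda>N. (\<integral>y. ln (Z_free \<beta> h N y) \<partial>Q) / real N) \<longlonglongrightarrow> free_energy \<beta> h"
    and "(\<lambda>N. mean_log_Z \<beta> h N / real N) \<longlonglongrightarrow> free_energy \<beta> h"
    and "N \<ge> 1 \<Longrightarrow> mean_log_Z \<beta> h N / real N \<le> free_energy \<beta> h"
proof -
  let ?c = "\<integral>y. \<bar>h + \<beta> * \<omega> 1 y\<bar> \<partial>Q"
  obtain l where l: "(\<lambda>N. mean_log_Z \<beta> h N / real N) \<longlonglongrightarrow> l" "\<And>n. n \<ge> 1 \<Longrightarrow> mean_log_Z \<beta> h n / real n \<le> l"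
    using superadditive_limit[of "mean_log_Z \<beta> h", OF _ mean_log_Z_le] mean_log_Z_superadditive by blast
  have "(\<lambda>N. (\<integral>y. ln (Z_free \<beta> h N y) \<partial>Q) / real N) \<longlonglongrightarrow> l"
  proof (rule tendsto_sandwich)
    show "\<forall>\<^sub>F N in sequentially. mean_log_Z \<beta> h N / real N \<le> (\<integral>y. ln (Z_free \<beta> h N y) \<partial>Q) / real N"
      using eventually_ge_at_top[of 1]
      by eventually_elim (auto intro!: divide_right_mono integral_ln_Z_free)
    show "\<forall>\<^sub>F N in sequentially. (\<integral>y. ln (Z_free \<beta> h N y) \<partial>Q) / real N \<le>
        mean_log_Z \<beta> h N / real N + (ln (2 * B) / real N + p * (ln (real N) / real N) + ?c / real N)"
      using eventually_ge_at_top[of 1]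
    proof eventually_elim
      case (elim N)
      have "ln (2 * (B * real N powr p)) = ln (2 * B) + p * ln (real N)"
        using elim B by (simp add: ln_mult ln_powr)
      then have "(\<integral>y. ln (Z_free \<beta> h N y) \<partial>Q) \<le> mean_log_Z \<beta> h N + (ln (2 * B) + p * ln (real N)) + ?c"
        using integral_ln_Z_free(3)[of N \<beta> h] elim by simp
      then have "(\<integral>y. ln (Z_free \<beta> h N y) \<partial>Q) / real N \<le> (mean_log_Z \<beta> h N + (ln (2 * B) + p * ln (real N)) + ?c) / real N"
        by (rule divide_right_mono) simp
      then show ?case by (simp add: add_divide_distrib add.assoc)
    qed
    have "(\<lambda>N. mean_log_Z \<beta> h N / real N + (ln (2 * B) / real N + p * (ln (real N) / real N) + ?c / real N)) \<longlonglongrightarrow> l + (0 + p * 0 + 0)"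
      by (intro tendsto_add tendsto_mult tendsto_const l lim_const_over_n lim_ln_over_n)
    then show "(\<lambda>N. mean_log_Z \<beta> h N / real N + (ln (2 * B) / real N + p * (ln (real N) / real N) + ?c / real N)) \<longlonglongrightarrow> l" by simp
  qed (rule l)
  moreover from this have "free_energy \<beta> h = l" unfolding free_energy_def by (rule limI)
  ultimately show "(\<lambda>N. (\<integral>y. ln (Z_free \<beta> h N y) \<partial>Q) / real N) \<longlonglongrightarrow> free_energy \<beta> h"
    "(\<lambda>N. mean_log_Z \<beta> h N / real N) \<longlonglongrightarrow> free_energy \<beta> h" "N \<ge> 1 \<Longrightarrow> mean_log_Z \<beta> h N / real N \<le> free_energy \<beta> h"
    using l by auto
qed

lemma free_energy_mono:
  assumes "h \<le> h'"
  shows "free_energy \<beta> h \<le> free_energy \<beta> h'"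
proof (rule LIMSEQ_le[OF free_energy_exists(2)[of \<beta> h] free_energy_exists(2)[of \<beta> h']])
  show "\<exists>N0. \<forall>N\<ge>N0. mean_log_Z \<beta> h N / real N \<le> mean_log_Z \<beta> h' N / real N"
  proof (intro exI[of _ 1] allI impI divide_right_mono)
    fix N :: nat assume N: "1 \<le> N"
    have "Z_pinned \<beta> h N y \<le> Z_pinned \<beta> h' N y" for y
    proof -
      have "pinned_steps K f j n \<le> pinned_steps K f' j n"
        if ff: "\<And>n. n \<ge> 1 \<Longrightarrow> 0 \<le> f n \<and> f n \<le> f' n" for f f' j n
      proof (induction j arbitrary: n)
        case (Suc j)
        have f': "0 \<le> f' n" if "n \<ge> 1" for n using ff[OF that] by linarith
        show ?case
        proof (cases "n = 0")
          case False
          then have "f n * (\<Sum>k<n. pinned_steps K f j k * K (n - k)) \<le> f' n * (\<Sum>k<n. pinned_steps K f' j k * K (n - k))"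
            by (intro mult_mono sum_mono Suc mult_right_mono sum_nonneg mult_nonneg_nonneg pinned_steps_nonneg K_nonneg f')
               (use ff in auto)
          then show ?thesis by simp
        qed simp
      qed simp
      then show ?thesis unfolding Z_pinned_def pinned_partition_def using assms by (intro sum_mono) simp
    qed
    then show "mean_log_Z \<beta> h N \<le> mean_log_Z \<beta> h' N"
      unfolding mean_log_Z_def using Z_pinned_pos[of \<beta> h N] Z_pinned_pos[of \<beta> h' N] by (intro integral_mono integrable_ln_Z_pinned N) auto
  qed simp
qed

definition logmgf :: "real \<Rightarrow> real" where
  "logmgf \<beta> = ln (\<integral>y. exp (\<beta> * \<omega> 1 y) \<partial>Q)"

lemma mgf_ge_1:
  assumes "\<beta> \<ge> 0"
  shows "1 \<le> (\<integral>y. exp (\<beta> * \<omega> 1 y) \<partial>Q)"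
proof -
  have "(\<integral>y. 1 + \<beta> * \<omega> 1 y \<partial>Q) \<le> (\<integral>y. exp (\<beta> * \<omega> 1 y) \<partial>Q)"
    using assms integrable_\<omega> exp_moments_\<omega>[OF assms] by (intro integral_mono exp_ge_add_one_self) auto
  then show ?thesis using integrable_\<omega> mean_\<omega> by (simp add: prob_space)
qed

lemma exp_logmgf: "\<beta> \<ge> 0 \<Longrightarrow> exp (logmgf \<beta>) = (\<integral>y. exp (\<beta> * \<omega> 1 y) \<partial>Q)"
  using mgf_ge_1[of \<beta>] by (simp add: logmgf_def)

lemma site_mean:
  assumes "\<beta> \<ge> 0"
  shows "integrable Q (\<lambda>y. exp (h + \<beta> * \<omega> 1 y))" "(\<integral>y. exp (h + \<beta> * \<omega> 1 y) \<partial>Q) = exp (h + logmgf \<beta>)"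
  using exp_moments_\<omega>[OF assms] exp_logmgf[OF assms] by (simp_all add: exp_add)

lemma expectation_Z_free:
  assumes "\<beta> \<ge> 0"
  shows "(\<integral>y. Z_free \<beta> h N y \<partial>Q) = free_partition K (\<lambda>_. exp (h + logmgf \<beta>)) N"
  using expectation_free(2)[of "\<lambda>x. exp (h + \<beta> * x)" K N] site_mean[OF assms, of h]
  unfolding Z_free_def by simp

text \<open>
  Jensen's inequality for the logarithm.
\<close>
lemma mean_log_Z_le_annealed:
  assumes "\<beta> \<ge> 0" "N \<ge> 1"
  shows "mean_log_Z \<beta> h N \<le> ln (pinned_partition K (\<lambda>_. exp (h + logmgf \<beta>)) N)"
proof -
  let ?m = "pinned_partition K (\<lambda>_. exp (h + logmgf \<beta>)) N"
  have m: "?m > 0" by (rule pinned_pos) simp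
  have E: "integrable Q (Z_pinned \<beta> h N)" "(\<integral>y. Z_pinned \<beta> h N y \<partial>Q) = ?m"
    using expectation_pinned[of "\<lambda>x. exp (h + \<beta> * x)" K N] site_mean[OF assms(1), of h]
    unfolding Z_pinned_def by auto
  have "mean_log_Z \<beta> h N \<le> (\<integral>y. Z_pinned \<beta> h N y / ?m - 1 + ln ?m \<partial>Q)"
    unfolding mean_log_Z_def
  proof (intro integral_mono integrable_ln_Z_pinned assms)
    show "ln (Z_pinned \<beta> h N y) \<le> Z_pinned \<beta> h N y / ?m - 1 + ln ?m" for y
      using ln_le_minus_one[of "Z_pinned \<beta> h N y / ?m"] m Z_pinned_pos[of \<beta> h N y] by (simp add: ln_div)
  qed (use E in auto)
  also have "\<dots> = ln ?m" using E m by (simp add: prob_space)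
  finally show ?thesis .
qed

lemma free_energy_le:
  assumes "\<beta> \<ge> 0" and K: "\<And>n. (\<Sum>k=1..n. K k * exp (- s * real k)) \<le> exp (- (h + logmgf \<beta>))"
  shows "free_energy \<beta> h \<le> s"
proof (rule LIMSEQ_le_const2[OF free_energy_exists(2)])
  show "\<exists>N0. \<forall>N\<ge>N0. mean_log_Z \<beta> h N / real N \<le> s"
  proof (intro exI[of _ 1] allI impI)
    fix N :: nat assume N: "1 \<le> N"
    have "pinned_partition K (\<lambda>_. exp (h + logmgf \<beta>)) N \<le> exp (s * real N)"
      by (rule pinned_const_le_exp[OF K_nonneg K])
    moreover have "pinned_partition K (\<lambda>_. exp (h + logmgf \<beta>)) N > 0" by (rule pinned_pos) simp
    ultimately have "ln (pinned_partition K (\<lambda>_. exp (h + logmgf \<beta>)) N) \<le> s * real N"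
      by (metis ln_exp ln_le_cancel_iff exp_gt_zero)
    then have "mean_log_Z \<beta> h N \<le> s * real N" using mean_log_Z_le_annealed[OF assms(1) N, of h] by linarith
    then show "mean_log_Z \<beta> h N / real N \<le> s" using N by (simp add: field_simps)
  qed
qed

end

section \<open>Second moment at the annealed critical point\<close>

context disordered_pinning
begin

text \<open>
  In terms of \<open>h\<close>, a constant factor in the weights is a shift; the scale \<open>s = 1 / m\<close> makes the Chernoff
  factor equal to \<open>exp 1\<close>.
\<close>
lemma Z_free_tilt:
  assumes "v \<ge> 0" "m > 0"
  shows "exp (v * m) * (Z_free \<beta> h N y - exp 1 * Z_free \<beta> (h - 1 / m) N y) \<le> Z_free \<beta> (h + v) N y"
proof -
  have "exp (v * m) * (free_partition K (\<lambda>i. exp (h + \<beta> * \<omega> i y)) N - exp ((1 / m) * m) * free_partition K (\<lambda>i. exp (- (1 / m)) * exp (h + \<beta> * \<omega> i y)) N)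
      \<le> free_partition K (\<lambda>i. exp v * exp (h + \<beta> * \<omega> i y)) N"
    by (rule free_tilt) (use assms K_nonneg tail_nonneg in auto)
  moreover have "exp v * exp (h + \<beta> * x) = exp (h + v + \<beta> * x)" "exp (- (1 / m)) * exp (h + \<beta> * x) = exp (h - 1 / m + \<beta> * x)" for x
    by (simp_all add: exp_add[symmetric] algebra_simps)
  ultimately show ?thesis using assms(2) by (simp add: Z_free_def)
qed

text \<open>
  At \<open>h = - logmgf \<beta>\<close> every site has mean weight one. The variance of the weight is at most
  \<open>E exp (2 \<beta> \<omega>) - 1\<close>, because \<open>logmgf \<beta> \<ge> 0\<close>, and by convexity this is at most linear in \<open>\<beta>\<close>.
\<close>
lemma critical_second_moment:
  assumes \<sigma>: "\<sigma> > 0" "\<And>n. (\<Sum>k=1..n. (pinned_partition K (\<lambda>_. 1) k)\<^sup>2) \<le> \<sigma>"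
    and \<beta>: "0 \<le> \<beta>" "\<beta> \<le> 1 / 2" "4 * \<beta> * \<sigma> * ((\<integral>y. exp (\<omega> 1 y) \<partial>Q) - 1) \<le> 1"
  shows "integrable Q (\<lambda>y. (Z_free \<beta> (- logmgf \<beta>) N y)\<^sup>2)"
    and "(\<integral>y. (Z_free \<beta> (- logmgf \<beta>) N y)\<^sup>2 \<partial>Q) \<le> 2"
proof -
  define g where "g x = exp (- logmgf \<beta> + \<beta> * x) - 1" for x
  let ?M = "\<lambda>\<beta>. \<integral>y. exp (\<beta> * \<omega> 1 y) \<partial>Q"
  have g: "g \<in> borel_measurable borel" unfolding g_def by measurable
  have ie: "integrable Q (\<lambda>y. exp (- logmgf \<beta> + \<beta> * \<omega> 1 y))" "(\<integral>y. exp (- logmgf \<beta> + \<beta> * \<omega> 1 y) \<partial>Q) = 1"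
    using site_mean[OF \<beta>(1), of "- logmgf \<beta>"] by simp_all
  have g1: "integrable Q (\<lambda>y. g (\<omega> 1 y))" "(\<integral>y. g (\<omega> 1 y) \<partial>Q) = 0"
    using ie by (simp_all add: g_def prob_space)
  have sq: "(g x)\<^sup>2 = exp (- 2 * logmgf \<beta>) * exp (2 * \<beta> * x) - 2 * exp (- logmgf \<beta> + \<beta> * x) + 1" for x
  proof -
    have "exp (- 2 * logmgf \<beta>) * exp (2 * \<beta> * x) = (exp (- logmgf \<beta> + \<beta> * x))\<^sup>2"
      by (simp add: power2_eq_square exp_add[symmetric])
    then show ?thesis by (simp add: g_def power2_eq_square algebra_simps)
  qed
  have i2: "integrable Q (\<lambda>y. exp (2 * \<beta> * \<omega> 1 y))" using exp_moments_\<omega>[of "2 * \<beta>"] \<beta> by simp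
  have g2: "integrable Q (\<lambda>y. (g (\<omega> 1 y))\<^sup>2)" unfolding sq using ie i2 by simp
  have "(\<integral>y. (g (\<omega> 1 y))\<^sup>2 \<partial>Q) = exp (- 2 * logmgf \<beta>) * ?M (2 * \<beta>) - 1"
    unfolding sq using ie i2 by (simp add: prob_space)
  also have "\<dots> \<le> 1 * ?M (2 * \<beta>) - 1"
  proof -
    have "logmgf \<beta> \<ge> 0" unfolding logmgf_def using mgf_ge_1[OF \<beta>(1)] by simp
    then show ?thesis using mgf_ge_1[of "2 * \<beta>"] \<beta> by (intro diff_right_mono mult_right_mono) auto
  qed
  also have "\<dots> \<le> 2 * \<beta> * (?M 1 - 1)"
  proof -
    have c: "exp (2 * \<beta> * x) \<le> (1 - 2 * \<beta>) + 2 * \<beta> * exp x" for x :: real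
      using Youngs_inequality_0[of "2 * \<beta>" "1 - 2 * \<beta>" "exp x" 1] \<beta> by (simp add: powr_def)
    have "?M (2 * \<beta>) \<le> (\<integral>y. (1 - 2 * \<beta>) + 2 * \<beta> * exp (\<omega> 1 y) \<partial>Q)"
      using i2 exp_moments_\<omega>[of 1] by (intro integral_mono c) auto
    also have "\<dots> = (1 - 2 * \<beta>) + 2 * \<beta> * ?M 1"
      using exp_moments_\<omega>[of 1] by (simp add: prob_space)
    finally show ?thesis by (simp add: algebra_simps)
  qed
  finally have \<kappa>: "(\<integral>y. (g (\<omega> 1 y))\<^sup>2 \<partial>Q) \<le> 2 * \<beta> * (?M 1 - 1)" .
  have \<kappa>0: "(\<integral>y. (g (\<omega> 1 y))\<^sup>2 \<partial>Q) \<ge> 0" by simp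
  have \<kappa>\<sigma>: "(\<integral>y. (g (\<omega> 1 y))\<^sup>2 \<partial>Q) * \<sigma> \<le> 1 / 2"
  proof -
    have "(\<integral>y. (g (\<omega> 1 y))\<^sup>2 \<partial>Q) * \<sigma> \<le> 2 * \<beta> * (?M 1 - 1) * \<sigma>"
      using \<sigma>(1) by (intro mult_right_mono \<kappa>) auto
    also have "\<dots> = (4 * \<beta> * \<sigma> * ((\<integral>y. exp (\<omega> 1 y) \<partial>Q) - 1)) / 2" by simp
    also have "\<dots> \<le> 1 / 2" using \<beta>(3) by (rule divide_right_mono) simp
    finally show ?thesis .
  qed
  have Z: "Z_free \<beta> (- logmgf \<beta>) N y = free_partition K (\<lambda>i. 1 + g (\<omega> i y)) N" for y
    by (simp add: Z_free_def g_def)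
  note sm = free_second_moment[OF g g1(1) g2 g1(2), of K N]
  show "integrable Q (\<lambda>y. (Z_free \<beta> (- logmgf \<beta>) N y)\<^sup>2)" unfolding Z by (rule sm)
  have "(\<integral>y. (Z_free \<beta> (- logmgf \<beta>) N y)\<^sup>2 \<partial>Q) \<le> 1 / (1 - (\<integral>y. (g (\<omega> 1 y))\<^sup>2 \<partial>Q) * \<sigma>)"
    unfolding Z sm(2) by (rule sum_pinned_const_le) (use \<sigma> \<kappa>0 \<kappa>\<sigma> in auto)
  also have "\<dots> \<le> 1 / (1 / 2)" using \<kappa>\<sigma> by (intro divide_left_mono) auto
  finally show "(\<integral>y. (Z_free \<beta> (- logmgf \<beta>) N y)\<^sup>2 \<partial>Q) \<le> 2" by simp
qed

text \<open>
  A second-moment argument of Paley and Zygmund: a variable with mean one and second moment at most two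
  exceeds \<open>1 / 2\<close> with positive probability, and the weight of paths with few contacts is small in mean.
\<close>
lemma many_contacts_probability:
  assumes \<beta>: "\<beta> \<ge> 0" and m: "m > 0"
    and sq: "integrable Q (\<lambda>y. (Z_free \<beta> (- logmgf \<beta>) N y)\<^sup>2)" "(\<integral>y. (Z_free \<beta> (- logmgf \<beta>) N y)\<^sup>2 \<partial>Q) \<le> 2"
    and few: "free_partition K (\<lambda>_. exp (- 1 / m)) N \<le> 1 / (64 * exp 1)"
  shows "prob {y \<in> space Q. 1 / 4 \<le> Z_free \<beta> (- logmgf \<beta>) N y - exp 1 * Z_free \<beta> (- logmgf \<beta> - 1 / m) N y} \<ge> 1 / 16"
proof -
  let ?W = "Z_free \<beta> (- logmgf \<beta>) N" and ?Y = "Z_free \<beta> (- logmgf \<beta> - 1 / m) N"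
  define E where "E = {y \<in> space Q. 1 / 4 \<le> ?W y - exp 1 * ?Y y}"
  have [measurable]: "E \<in> sets Q" unfolding E_def by measurable
  have iZ: "integrable Q (Z_free \<beta> h N)" for h
    using expectation_free(1)[of "\<lambda>x. exp (h + \<beta> * x)" K N] site_mean[OF \<beta>, of h]
    unfolding Z_free_def by simp
  have EW: "(\<integral>y. ?W y \<partial>Q) = 1" using expectation_Z_free[OF \<beta>, of "- logmgf \<beta>" N] by (simp add: free_one)
  have EY: "(\<integral>y. ?Y y \<partial>Q) \<le> 1 / (64 * exp 1)" using expectation_Z_free[OF \<beta>, of "- logmgf \<beta> - 1 / m" N] few by simp
  have Zf0: "Z_free \<beta> h N y \<ge> 0" for h y
    unfolding Z_free_def free_partition_def by (intro sum_nonneg mult_nonneg_nonneg tail_nonneg pinned_nonneg K_nonneg) auto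
  (* The concave parabola in W is at most 1 everywhere and negative for W < 1/2, so it is a
     polynomial minorant of the indicator whose mean is controlled by two moments. The last
     term pays for the points where W is large but the weight of the paths with few contacts is too. *)
  have pt: "(?W y - 1 / 2) / 2 - (?W y)\<^sup>2 / 16 - 4 * exp 1 * ?Y y \<le> indicator E y" if "y \<in> space Q" for y
  proof (cases "y \<in> E")
    case True
    have "0 \<le> (?W y - 4)\<^sup>2" by simp
    then have "(?W y - 1 / 2) / 2 - (?W y)\<^sup>2 / 16 \<le> 1" by (simp add: power2_eq_square field_simps)
    moreover have "exp 1 * ?Y y \<ge> 0" using Zf0 by simp
    ultimately show ?thesis using True by simp
  next
    case False
    then have lt: "?W y - exp 1 * ?Y y < 1 / 4" using that by (simp add: E_def)
    have Y0: "exp 1 * ?Y y \<ge> 0" using Zf0 by simp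
    have "(?W y - 1 / 2) / 2 - (?W y)\<^sup>2 / 16 - 4 * (exp 1 * ?Y y) \<le> 0"
    proof (cases "?W y < 1 / 2")
      case True
      have "(w - 1 / 2) / 2 - w\<^sup>2 / 16 - 4 * q \<le> 0" if "w < 1 / 2" "q \<ge> 0" for w q :: real
      proof -
        have "(w - 1 / 2) / 2 \<le> 0" "w\<^sup>2 / 16 \<ge> 0" using that by simp_all
        then show ?thesis using that by linarith
      qed
      from this[OF True Y0] show ?thesis .
    next
      case False
      have "0 \<le> (?W y - 4)\<^sup>2" by simp
      then have "(?W y - 1 / 2) / 2 - (?W y)\<^sup>2 / 16 \<le> 1" by (simp add: power2_eq_square field_simps)
      moreover have "4 * (exp 1 * ?Y y) \<ge> 1" using lt False by linarith
      ultimately show ?thesis by linarith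
    qed
    then show ?thesis using False by (simp add: mult.assoc)
  qed
  have "1 / 8 - 4 * exp 1 * (1 / (64 * exp 1)) \<le> (1 - 1 / 2) / 2 - (\<integral>y. (?W y)\<^sup>2 \<partial>Q) / 16 - 4 * exp 1 * (\<integral>y. ?Y y \<partial>Q)"
  proof -
    have "4 * exp 1 * (\<integral>y. ?Y y \<partial>Q) \<le> 4 * exp 1 * (1 / (64 * exp 1))"
      using EY by (intro mult_left_mono) auto
    then show ?thesis using sq(2) by simp
  qed
  also have "\<dots> = (\<integral>y. (?W y - 1 / 2) / 2 - (?W y)\<^sup>2 / 16 - 4 * exp 1 * ?Y y \<partial>Q)"
    using iZ sq(1) EW by (simp add: prob_space)
  also have "\<dots> \<le> (\<integral>y. indicator E y \<partial>Q)"
    using iZ sq(1) pt by (intro integral_mono) (auto simp: integrable_indicator_iff emeasure_eq_measure)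
  also have "\<dots> = prob E" by simp
  finally show ?thesis unfolding E_def by simp
qed

text \<open>
  On the good event the many contacts yield the factor \<open>exp (v m)\<close>. On its complement the path without contacts
  still bounds the partition function from below by a power of \<open>N\<close>.
\<close>
lemma mean_log_Z_lower:
  assumes \<beta>: "\<beta> \<ge> 0" and m: "m > 0" and N: "N \<ge> 1" and v: "0 \<le> v" "v \<le> 1"
    and sq: "integrable Q (\<lambda>y. (Z_free \<beta> (- logmgf \<beta>) N y)\<^sup>2)" "(\<integral>y. (Z_free \<beta> (- logmgf \<beta>) N y)\<^sup>2 \<partial>Q) \<le> 2"
    and few: "free_partition K (\<lambda>_. exp (- 1 / m)) N \<le> 1 / (64 * exp 1)"
  shows "v * m / 16 - 2 * p * ln (real (N + 1)) - (2 * ln B + ln 8 + 1 + \<bar>logmgf \<beta>\<bar> + (\<integral>y. \<bar>\<beta> * \<omega> 1 y\<bar> \<partial>Q))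
    \<le> mean_log_Z \<beta> (- logmgf \<beta> + v) N"
proof -
  let ?W = "Z_free \<beta> (- logmgf \<beta>) N" and ?Y = "Z_free \<beta> (- logmgf \<beta> - 1 / m) N" and ?Z = "Z_free \<beta> (- logmgf \<beta> + v) N"
  define E where "E = {y \<in> space Q. 1 / 4 \<le> ?W y - exp 1 * ?Y y}"
  have [measurable]: "E \<in> sets Q" unfolding E_def by measurable
  have pE: "prob E \<ge> 1 / 16" unfolding E_def by (rule many_contacts_probability[OF \<beta> m sq few])
  define b where "b = ln B + p * ln (real (N + 1))"
  have b0: "b \<ge> 0" using B p by (simp add: b_def)
  have tail: "exp (- b) \<le> tail K N"
  proof -
    have "1 \<le> B * real (N + 1) powr p * K (N + 1)" using K_lower[of "N + 1"] by simp
    also have "B * real (N + 1) powr p = exp b" using B by (simp add: b_def exp_add powr_def)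
    finally have "exp (- b) \<le> K (N + 1)" by (simp add: exp_minus field_simps)
    then show ?thesis using tail_Suc[of K N] tail_nonneg[of "Suc N"] by simp
  qed
  have Z_pos: "?Z y > 0" for y by (rule ln_Z_free_bounds(3)[OF N])
  have low: "- b - ln 4 + v * m * indicator E y \<le> ln (?Z y)" for y
  proof (cases "y \<in> E")
    case True
    then have "exp (v * m) * (1 / 4) \<le> exp (v * m) * (?W y - exp 1 * ?Y y)"
      by (intro mult_left_mono) (auto simp: E_def)
    also have "\<dots> \<le> ?Z y" using Z_free_tilt[OF v(1) m, of \<beta> "- logmgf \<beta>" N y] by simp
    finally have "ln (exp (v * m) * (1 / 4)) \<le> ln (?Z y)" by (intro ln_mono) auto
    then show ?thesis using True b0 by (simp add: ln_mult ln_div)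
  next
    case False
    have "tail K N \<le> ?Z y" unfolding Z_free_def by (rule free_ge_tail) (auto intro: K_nonneg tail_nonneg)
    then have "ln (exp (- b)) \<le> ln (?Z y)" using tail by (intro ln_mono) auto
    then have "- b \<le> ln (?Z y)" by simp
    moreover have "ln 4 \<ge> (0::real)" by simp
    ultimately have "- b - ln 4 \<le> ln (?Z y)" by linarith
    then show ?thesis using False by simp
  qed
  have "- b - ln 4 + v * m * (1 / 16) \<le> - b - ln 4 + v * m * prob E"
    using pE v m by (intro add_left_mono mult_left_mono) auto
  also have "\<dots> = (\<integral>y. - b - ln 4 + v * m * indicator E y \<partial>Q)"
    by (subst Bochner_Integration.integral_add) (auto simp: prob_space integrable_indicator_iff emeasure_eq_measure)
  also have "\<dots> \<le> (\<integral>y. ln (?Z y) \<partial>Q)"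
    by (intro integral_mono integral_ln_Z_free N low) (auto simp: integrable_indicator_iff emeasure_eq_measure)
  also have "\<dots> \<le> mean_log_Z \<beta> (- logmgf \<beta> + v) N + ln (2 * (B * real N powr p)) + (\<integral>y. \<bar>- logmgf \<beta> + v + \<beta> * \<omega> 1 y\<bar> \<partial>Q)"
    by (rule integral_ln_Z_free(3)[OF N])
  finally have 1: "- b - ln 4 + v * m * (1 / 16) \<le> mean_log_Z \<beta> (- logmgf \<beta> + v) N + ln (2 * (B * real N powr p)) + (\<integral>y. \<bar>- logmgf \<beta> + v + \<beta> * \<omega> 1 y\<bar> \<partial>Q)" .
  have i0: "integrable Q (\<lambda>y. \<bar>\<beta> * \<omega> 1 y\<bar>)" using integrable_\<omega> by simp
  have "(\<integral>y. \<bar>- logmgf \<beta> + v + \<beta> * \<omega> 1 y\<bar> \<partial>Q) \<le> (\<integral>y. (\<bar>logmgf \<beta>\<bar> + 1) + \<bar>\<beta> * \<omega> 1 y\<bar> \<partial>Q)"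
  proof (intro integral_mono integrable_abs_site(1) Bochner_Integration.integrable_add i0)
    fix y show "\<bar>- logmgf \<beta> + v + \<beta> * \<omega> 1 y\<bar> \<le> (\<bar>logmgf \<beta>\<bar> + 1) + \<bar>\<beta> * \<omega> 1 y\<bar>" using v by linarith
  qed auto
  also have "\<dots> = \<bar>logmgf \<beta>\<bar> + 1 + (\<integral>y. \<bar>\<beta> * \<omega> 1 y\<bar> \<partial>Q)"
    by (subst Bochner_Integration.integral_add[OF _ i0]) (auto simp: prob_space)
  finally have 2: "(\<integral>y. \<bar>- logmgf \<beta> + v + \<beta> * \<omega> 1 y\<bar> \<partial>Q) \<le> \<bar>logmgf \<beta>\<bar> + 1 + (\<integral>y. \<bar>\<beta> * \<omega> 1 y\<bar> \<partial>Q)" .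
  have "ln (2 * (B * real N powr p)) = ln 2 + ln B + p * ln (real N)" using N B by (simp add: ln_mult ln_powr)
  also have "\<dots> \<le> ln 2 + ln B + p * ln (real (N + 1))" using N p by (intro add_left_mono mult_left_mono) auto
  finally have 3: "ln (2 * (B * real N powr p)) \<le> ln 2 + ln B + p * ln (real (N + 1))" .
  have "ln (8::real) = ln (2 * 4)" by simp
  also have "\<dots> = ln 2 + ln 4" by (subst ln_mult) auto
  finally show ?thesis using 1 2 3 unfolding b_def by simp
qed

text \<open>
  In volume \<open>N \<approx> v powr (- 1 / a)\<close> the gain \<open>v m\<close> with \<open>m \<approx> N powr b\<close> is a positive power of \<open>N\<close> and beats the
  logarithmic losses. So the mean of the logarithm is at least one there, and the free energy at least \<open>1 / N\<close>.
\<close>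
theorem free_energy_lower_exponent:
  assumes \<sigma>: "\<sigma> > 0" "\<And>n. (\<Sum>k=1..n. (pinned_partition K (\<lambda>_. 1) k)\<^sup>2) \<le> \<sigma>"
    and \<beta>: "0 \<le> \<beta>" "\<beta> \<le> 1 / 2" "4 * \<beta> * \<sigma> * ((\<integral>y. exp (\<omega> 1 y) \<partial>Q) - 1) \<le> 1"
    and tails: "C > 0" "\<And>N. (\<Sum>m\<le>N. tail K m) / real (N + 1) \<le> C * real (N + 1) powr (- b)"
    and ab: "0 < a" "a < b"
  shows "\<forall>\<^sub>F v in at_right 0. v powr (1 / a) / 2 \<le> free_energy \<beta> (- logmgf \<beta> + v)"
proof -
  (* Half of the admissible bound 1 / (64 exp 1) on the mean of the damped partition function, divided by C;
     the other half absorbs the summand 1 of m + 1 below. *)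
  define \<delta> where "\<delta> = 1 / (128 * exp 1 * C)"
  define c where "c = 2 * ln B + ln 8 + 1 + \<bar>logmgf \<beta>\<bar> + (\<integral>y. \<bar>\<beta> * \<omega> 1 y\<bar> \<partial>Q)"
  have \<delta>: "\<delta> > 0" using tails by (simp add: \<delta>_def)
  have "\<forall>\<^sub>F x in at_top. x powr (- b) \<le> \<delta> \<and> 1 \<le> \<delta> * x powr (b - a) / 16 - 2 * p * ln x - c"
  proof (rule eventually_conj)
    have "((\<lambda>x. x powr (- b)) \<longlongrightarrow> 0) at_top" using ab by (intro tendsto_neg_powr filterlim_ident) auto
    then show "\<forall>\<^sub>F x in at_top. x powr (- b) \<le> \<delta>" by (rule eventually_mono[OF order_tendstoD(2)[OF _ \<delta>]]) auto
    have e: "b - a > 0" "\<delta> / 16 > 0" using ab \<delta> by auto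
    define e' where "e' = b - a"
    define d' where "d' = \<delta> / 16"
    have "e' > 0" "d' > 0" using e by (auto simp: e'_def d'_def)
    then have "filterlim (\<lambda>x. d' * x powr e' - 2 * p * ln x - c) at_top at_top"
      by real_asymp
    then show "\<forall>\<^sub>F x in at_top. 1 \<le> \<delta> * x powr (b - a) / 16 - 2 * p * ln x - c"
      unfolding filterlim_at_top e'_def d'_def by simp
  qed
  then obtain X where X: "\<And>x. x \<ge> X \<Longrightarrow> x powr (- b) \<le> \<delta> \<and> 1 \<le> \<delta> * x powr (b - a) / 16 - 2 * p * ln x - c"
    by (auto simp: eventually_at_top_linorder)
  define X0 where "X0 = max 1 X"
  have main: "v powr (1 / a) / 2 \<le> free_energy \<beta> (- logmgf \<beta> + v)" if v: "0 < v" "v < X0 powr (- a)" for v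
  proof -
    have "X0 powr (- a) \<le> 1 powr (- a)" using ab by (intro powr_mono2') (auto simp: X0_def)
    then have v1: "v < 1" using v by simp
    define z where "z = v powr (- 1 / a)"
    have z: "z > X0"
    proof -
      have "(X0 powr (- a)) powr (- 1 / a) < z" unfolding z_def
        by (rule powr_less_mono2_neg) (use v ab in auto)
      moreover have "(X0 powr (- a)) powr (- 1 / a) = X0" using ab by (simp add: powr_powr X0_def)
      ultimately show ?thesis by simp
    qed
    (* A volume in which the gain v m dominates the logarithmic terms. *)
    define N where "N = nat \<lceil>z\<rceil>"
    have N: "real N \<ge> z" "real N \<le> z + 1" "N \<ge> 1" using z unfolding N_def X0_def by linarith+
    let ?x = "real (N + 1)"
    have x: "?x \<ge> X" "?x \<ge> 1" using N z by (auto simp: X0_def)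
    define m where "m = \<delta> * ?x powr b"
    have m: "m > 0" using \<delta> by (simp add: m_def)
    have few: "free_partition K (\<lambda>_. exp (- 1 / m)) N \<le> 1 / (64 * exp 1)"
    proof -
      have "1 + 1 / m \<le> exp (1 / m)" by (rule exp_ge_add_one_self)
      then have "exp (- 1 / m) \<le> 1 / (1 + 1 / m)" using m by (simp add: exp_minus field_simps)
      also have "\<dots> = 1 - 1 / (m + 1)" using m by (simp add: field_simps)
      finally have e: "1 / (m + 1) \<le> 1 - exp (- 1 / m)" by simp
      have "free_partition K (\<lambda>_. exp (- 1 / m)) N \<le> (\<Sum>m\<le>N. tail K m) / real (N + 1) / (1 - exp (- 1 / m))"
        by (rule free_const_le) (use m K_nonneg tail_nonneg in auto)
      also have "\<dots> \<le> (C * ?x powr (- b)) / (1 / (m + 1))"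
        using e m tails by (intro frac_le) (auto intro!: mult_nonneg_nonneg)
      also have "\<dots> = C * (\<delta> * (?x powr b * ?x powr (- b)) + ?x powr (- b))"
        by (simp add: m_def algebra_simps)
      also have "?x powr b * ?x powr (- b) = 1" using x by (simp add: powr_minus field_simps)
      also have "C * (\<delta> * 1 + ?x powr (- b)) \<le> C * (\<delta> + \<delta>)"
        using X[OF x(1)] tails by (intro mult_left_mono) auto
      also have "\<dots> = 1 / (64 * exp 1)" using tails by (simp add: \<delta>_def field_simps)
      finally show ?thesis .
    qed
    have "v * m / 16 - 2 * p * ln ?x - c \<le> mean_log_Z \<beta> (- logmgf \<beta> + v) N"
      unfolding c_def using critical_second_moment[OF \<sigma> \<beta>] few v v1 N m \<beta>
      by (intro mean_log_Z_lower) auto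
    moreover have "\<delta> * ?x powr (b - a) / 16 \<le> v * m / 16"
    proof -
      have "?x powr (- a) \<le> z powr (- a)" using N z ab by (intro powr_mono2') (auto simp: X0_def)
      also have "z powr (- a) = v" using ab v by (simp add: z_def powr_powr)
      finally have "?x powr (- a) * m \<le> v * m" using m by (intro mult_right_mono) auto
      moreover have "?x powr (- a) * m = \<delta> * ?x powr (b - a)" by (simp add: m_def powr_diff powr_minus field_simps)
      ultimately show ?thesis by simp
    qed
    ultimately have "1 \<le> mean_log_Z \<beta> (- logmgf \<beta> + v) N" using X[OF x(1)] by linarith
    then have "1 / real N \<le> mean_log_Z \<beta> (- logmgf \<beta> + v) N / real N" by (intro divide_right_mono) auto
    also have "\<dots> \<le> free_energy \<beta> (- logmgf \<beta> + v)" by (rule free_energy_exists(3)[OF N(3)])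
    finally have 1: "1 / real N \<le> free_energy \<beta> (- logmgf \<beta> + v)" .
    have "v powr (1 / a) / 2 = 1 / (2 * z)" by (simp add: z_def powr_minus_divide)
    also have "\<dots> \<le> 1 / real N" using N z by (intro divide_left_mono) (auto simp: X0_def)
    finally show ?thesis using 1 by linarith
  qed
  show ?thesis
    by (rule eventually_at_rightI[of 0 "X0 powr (- a)"]) (use main in \<open>auto simp: X0_def\<close>)
qed

end

section \<open>Critical point and critical exponent\<close>

text \<open>
  Dividing by \<open>ln v < 0\<close> reverses inequalities, so upper bounds for \<open>F\<close> give lower bounds for the ratio; the
  constants disappear since \<open>ln v\<close> diverges.
\<close>
lemma exponent_limit:
  fixes F :: "real \<Rightarrow> real"
  assumes \<alpha>: "\<alpha> > 0"
    and lower: "\<And>a. 0 < a \<Longrightarrow> a < \<alpha> \<Longrightarrow> \<exists>c>0. \<forall>\<^sub>F v in at_right 0. c * v powr (1 / a) \<le> F v"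
    and upper: "\<And>a. \<alpha> < a \<Longrightarrow> \<exists>C>0. \<forall>\<^sub>F v in at_right 0. F v \<le> C * v powr (1 / a)"
  shows "((\<lambda>v. ln (F v) / ln v) \<longlongrightarrow> 1 / \<alpha>) (at_right 0)"
proof (rule order_tendstoI)
  have L: "((\<lambda>v. x + ln c / ln v) \<longlongrightarrow> x) (at_right 0)" for x c :: real
  proof -
    have "((\<lambda>v. x + ln c / ln v) \<longlongrightarrow> x + 0) (at_right 0)"
      by (intro tendsto_add tendsto_const tendsto_divide_0[OF tendsto_const] filterlim_at_bot_imp_at_infinity ln_at_0)
    then show ?thesis by simp
  qed
  have small: "\<forall>\<^sub>F v in at_right 0. 0 < v \<and> v < (1::real)"
    by (rule eventually_at_rightI[of 0 1]) auto
  obtain c0 where c0: "c0 > 0" "\<forall>\<^sub>F v in at_right 0. c0 * v powr (1 / (\<alpha> / 2)) \<le> F v"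
    using lower[of "\<alpha> / 2"] \<alpha> by auto
  have pos: "\<forall>\<^sub>F v in at_right 0. F v > 0"
    using c0(2) small
  proof eventually_elim
    case (elim v)
    have "0 < c0 * v powr (1 / (\<alpha> / 2))" using c0(1) elim by simp
    then show ?case using elim by linarith
  qed
  {
    fix x assume x: "x < 1 / \<alpha>"
    define a where "a = 1 / ((max x (1 / (2 * \<alpha>)) + 1 / \<alpha>) / 2)"
    have i: "1 / a = (max x (1 / (2 * \<alpha>)) + 1 / \<alpha>) / 2" by (simp add: a_def)
    have m: "0 < 1 / (2 * \<alpha>)" "1 / (2 * \<alpha>) < 1 / \<alpha>" using \<alpha> by (auto simp: field_simps)
    have ia: "x < 1 / a" "1 / a < 1 / \<alpha>" "0 < 1 / a" unfolding i using x m by (auto simp: max_def)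
    then have "a > 0" by (simp add: zero_less_divide_iff)
    then have "\<alpha> < a" using ia(2) \<alpha> by (simp add: field_simps)
    then obtain C where C: "C > 0" "\<forall>\<^sub>F v in at_right 0. F v \<le> C * v powr (1 / a)" using upper by blast
    have "\<forall>\<^sub>F v in at_right 0. x < 1 / a + ln C / ln v" using order_tendstoD(1)[OF L ia(1)] .
    then show "\<forall>\<^sub>F v in at_right 0. x < ln (F v) / ln v"
      using C(2) small pos
    proof eventually_elim
      case (elim v)
      have lv: "ln v < 0" using elim by simp
      have "ln (F v) \<le> ln (C * v powr (1 / a))" using elim by (intro ln_mono) auto
      also have "\<dots> = ln C + 1 / a * ln v" using C(1) elim by (simp add: ln_mult ln_powr)
      finally have "(ln C + 1 / a * ln v) / ln v \<le> ln (F v) / ln v" using lv by (intro divide_right_mono_neg) auto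
      then show ?case using elim(1) lv by (simp add: add_divide_distrib)
    qed
  }
  {
    fix x assume x: "1 / \<alpha> < x"
    define a where "a = 1 / ((x + 1 / \<alpha>) / 2)"
    have i: "1 / a = (x + 1 / \<alpha>) / 2" by (simp add: a_def)
    have m: "0 < 1 / \<alpha>" using \<alpha> by simp
    have "0 < x + 1 / \<alpha>" using x m by linarith
    then have ia: "1 / a < x" "1 / \<alpha> < 1 / a" "0 < 1 / a" unfolding i using x by auto
    then have a0: "a > 0" by (simp add: zero_less_divide_iff)
    then have "a < \<alpha>" using ia(2) \<alpha> by (simp add: field_simps)
    then obtain c where c: "c > 0" "\<forall>\<^sub>F v in at_right 0. c * v powr (1 / a) \<le> F v" using lower a0 by blast
    have "\<forall>\<^sub>F v in at_right 0. 1 / a + ln c / ln v < x" using order_tendstoD(2)[OF L ia(1)] .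
    then show "\<forall>\<^sub>F v in at_right 0. ln (F v) / ln v < x"
      using c(2) small
    proof eventually_elim
      case (elim v)
      have lv: "ln v < 0" using elim by simp
      have "ln (c * v powr (1 / a)) \<le> ln (F v)" using elim c(1) by (intro ln_mono) auto
      moreover have "ln (c * v powr (1 / a)) = ln c + 1 / a * ln v" using c(1) elim by (simp add: ln_mult ln_powr)
      ultimately have "ln (F v) / ln v \<le> (ln c + 1 / a * ln v) / ln v" using lv by (intro divide_right_mono_neg) auto
      then show ?case using elim(1) lv by (simp add: add_divide_distrib)
    qed
  }
qed

lemma slowly_varying_scale:
  assumes "slowly_varying L" "c > 0"
  shows "slowly_varying (\<lambda>x. c * L x)"
  using assms unfolding slowly_varying_def by auto

lemma (in pinning_kernel) polynomial_kernel_exists: "\<exists>B. polynomial_kernel K B (2 + \<alpha>)"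
proof -
  obtain C where C: "C > 0" "\<And>n. n \<ge> 1 \<Longrightarrow> 1 \<le> C * real n powr (2 + \<alpha>) * K n"
    using K_poly_lower by blast
  have "polynomial_kernel K (max 1 C) (2 + \<alpha>)"
  proof
    show "1 \<le> max 1 C * real n powr (2 + \<alpha>) * K n" if "n \<ge> 1" for n
      using C(2)[OF that] mult_right_mono[of C "max 1 C" "real n powr (2 + \<alpha>) * K n"] K_nonneg[OF that]
      by (simp add: mult.assoc)
  qed (use K_pos tail_nonneg \<alpha>_pos in auto)
  then show ?thesis by blast
qed

text \<open>
  All statements are transported to the normalised kernel \<open>K = K\<^sub>0 / \<rho>\<close>, for which criticality of the annealed model
  is at \<open>- logmgf \<beta>\<close>. There, the bounds on both sides give positivity of the free energy exactly above
  that point, for the quenched model and, with \<open>\<beta> = 0\<close>, for the annealed one.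
\<close>
theorem theorem1p1:
  fixes P :: "'a measure" and \<tau> :: "nat \<Rightarrow> 'a \<Rightarrow> enat"
    and Q :: "'b measure" and \<omega> :: "nat \<Rightarrow> 'b \<Rightarrow> real"
    and \<alpha> :: real and L :: "real \<Rightarrow> real"
  assumes "renewal_process P \<tau>"
    and "environment Q \<omega>"
    and "slowly_varying L"
    and "\<And>n :: nat. n \<ge> 1 \<Longrightarrow>
      measure P {x \<in> space P. \<tau> 1 x = enat n} = L (real n) / real n powr (1 + \<alpha>)"
    and "(0 < \<alpha> \<and> \<alpha> < 1 / 2) \<or>
      (\<alpha> = 1 / 2 \<and> summable (\<lambda>n. 1 / (real (Suc n) * (L (real (Suc n)))\<^sup>2)))"
  shows "\<exists>\<beta>\<^sub>2>0. \<forall>\<beta>\<in>{0..\<beta>\<^sub>2}.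
    quenched_critical_point P \<tau> Q \<omega> \<beta> = annealed_critical_point P \<tau> Q \<omega> \<beta> \<and>
    ((\<lambda>h. ln (quenched_free_energy P \<tau> Q \<omega> \<beta> h) / ln (h - annealed_critical_point P \<tau> Q \<omega> \<beta>))
      \<longlongrightarrow> 1 / \<alpha>) (at_right (annealed_critical_point P \<tau> Q \<omega> \<beta>))"
proof -
  interpret P: renewal_process P \<tau> by fact
  interpret env: environment Q \<omega> by fact
  have Lpos: "L x > 0" if "x > 0" for x using assms(3) that by (auto simp: slowly_varying_def)
  define K\<^sub>0 where "K\<^sub>0 n = L (real n) / real n powr (1 + \<alpha>)" for n :: nat
  have prob_K0: "P.prob {x \<in> space P. \<tau> 1 x = enat n} = K\<^sub>0 n" if "n \<ge> 1" for n
    unfolding K\<^sub>0_def by (rule assms(4)[OF that])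
  have K0_pos: "K\<^sub>0 n > 0" if "n \<ge> 1" for n using that Lpos by (simp add: K\<^sub>0_def)
  have disj: "disjoint_family (\<lambda>n. {x \<in> space P. \<tau> 1 x = enat (Suc n)})"
    by (auto simp: disjoint_family_on_def)
  have K0_sums: "(\<lambda>n. K\<^sub>0 (Suc n)) sums P.prob (\<Union>n. {x \<in> space P. \<tau> 1 x = enat (Suc n)})"
  proof -
    have "range (\<lambda>n. {x \<in> space P. \<tau> 1 x = enat (Suc n)}) \<subseteq> sets P" by (auto intro: P.sets_\<tau>)
    from P.finite_measure_UNION[OF this disj] show ?thesis using prob_K0[of "Suc _"] by simp
  qed
  define \<rho> where "\<rho> = P.prob (\<Union>n. {x \<in> space P. \<tau> 1 x = enat (Suc n)})"
  have \<rho>1: "\<rho> \<le> 1" unfolding \<rho>_def by (rule P.prob_le_1)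
  have K0_sum_le: "(\<Sum>k=1..n. K\<^sub>0 k) \<le> \<rho>" for n
  proof -
    have "(\<Sum>k=1..n. K\<^sub>0 k) = (\<Sum>k<n. K\<^sub>0 (Suc k))"
      by (rule sum.reindex_bij_witness[of _ Suc "\<lambda>n. n - 1"]) auto
    also have "\<dots> \<le> (\<Sum>k. K\<^sub>0 (Suc k))"
      by (rule sum_le_suminf[OF sums_summable[OF K0_sums]]) (auto intro: less_imp_le[OF K0_pos])
    also have "\<dots> = \<rho>" using sums_unique[OF K0_sums] by (simp add: \<rho>_def)
    finally show ?thesis .
  qed
  have \<rho>0: "\<rho> > 0" using K0_sum_le[of 1] K0_pos[of 1] by simp
  (* Normalisation: multiplying the kernel by a constant is the same as shifting h. *)
  define K where "K n = (1 / \<rho>) * K\<^sub>0 n" for n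
  have K0_K: "K\<^sub>0 = (\<lambda>n. \<rho> * K n)" using \<rho>0 by (auto simp: K_def)
  have \<alpha>0: "\<alpha> > 0" using assms(5) by auto
  interpret pinning_kernel K \<alpha> "\<lambda>x. (1 / \<rho>) * L x"
  proof
    show "slowly_varying (\<lambda>x. (1 / \<rho>) * L x)" using assms(3) \<rho>0 by (intro slowly_varying_scale) auto
    show "(\<lambda>n. K (Suc n)) sums 1"
      using sums_mult[OF K0_sums, of "1 / \<rho>"] \<rho>0 by (simp add: K_def \<rho>_def)
  qed (use \<alpha>0 in \<open>auto simp: K_def K\<^sub>0_def\<close>)
  obtain B where "polynomial_kernel K B (2 + \<alpha>)" using polynomial_kernel_exists by blast
  then interpret K: polynomial_kernel K B "2 + \<alpha>" .
  interpret K: disordered_pinning Q \<omega> K B "2 + \<alpha>" ..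
  have "polynomial_kernel K\<^sub>0 (B / \<rho>) (2 + \<alpha>)"
  proof
    show "tail K\<^sub>0 m \<ge> 0" for m using K0_sum_le[of m] \<rho>1 by (simp add: tail_def)
    show "1 \<le> B / \<rho>" using K.B \<rho>0 \<rho>1 by (simp add: field_simps)
    show "1 \<le> B / \<rho> * real n powr (2 + \<alpha>) * K\<^sub>0 n" if "n \<ge> 1" for n
      using K.K_lower[OF that] \<rho>0 by (simp add: K_def)
  qed (use K0_pos \<alpha>0 in auto)
  then interpret K0: polynomial_kernel K\<^sub>0 "B / \<rho>" "2 + \<alpha>" .
  interpret K0: disordered_pinning Q \<omega> K\<^sub>0 "B / \<rho>" "2 + \<alpha>" ..
  have Z: "partition_function P \<tau> \<beta> h (\<lambda>n. \<omega> n y) N = K0.Z_free \<beta> h N y" for \<beta> h y N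
    unfolding K0.Z_free_def by (rule P.partition_function_eq_free[OF prob_K0])
  have scale: "K0.free_energy \<beta> h = K.free_energy \<beta> (h + ln \<rho>)" for \<beta> h
  proof -
    have "K0.Z_pinned \<beta> h N y = K.Z_pinned \<beta> (h + ln \<rho>) N y" for N y
    proof -
      have "K0.Z_pinned \<beta> h N y = pinned_partition K\<^sub>0 (\<lambda>i. exp (h + \<beta> * \<omega> i y)) N" by (rule K0.Z_pinned_def)
      also have "\<dots> = pinned_partition K (\<lambda>i. \<rho> * exp (h + \<beta> * \<omega> i y)) N" by (simp only: K0_K pinned_kernel_scale)
      also have "\<dots> = K.Z_pinned \<beta> (h + ln \<rho>) N y" using \<rho>0 by (simp add: K.Z_pinned_def exp_add mult_ac)
      finally show ?thesis .
    qed
    then have "K0.mean_log_Z \<beta> h = K.mean_log_Z \<beta> (h + ln \<rho>)" by (simp add: K0.mean_log_Z_def K.mean_log_Z_def fun_eq_iff)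
    then show ?thesis
      using K0.free_energy_exists(2)[of \<beta> h] K.free_energy_exists(2)[of \<beta> "h + ln \<rho>"]
      by (metis LIMSEQ_unique)
  qed
  have quenched: "quenched_free_energy P \<tau> Q \<omega> \<beta> h = K.free_energy \<beta> (h + ln \<rho>)" for \<beta> h
    unfolding quenched_free_energy_def Z K0.free_energy_def[symmetric] by (rule scale)
  have annealed: "annealed_free_energy P \<tau> Q \<omega> \<beta> h = K.free_energy 0 (h + K.logmgf \<beta> + ln \<rho>)" if "\<beta> \<ge> 0" for \<beta> h
  proof -
    have "(\<integral>y. ln (K0.Z_free 0 (h + K.logmgf \<beta>) N y) \<partial>Q) = ln (free_partition K\<^sub>0 (\<lambda>_. exp (h + K.logmgf \<beta>)) N)" for N
      by (simp add: K0.Z_free_def env.prob_space)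
    then show ?thesis
      unfolding annealed_free_energy_def Z K0.expectation_Z_free[OF that] using scale[of 0 "h + K.logmgf \<beta>"]
      by (simp add: K0.free_energy_def)
  qed
  have logmgf0: "K.logmgf 0 = 0" by (simp add: K.logmgf_def env.prob_space)
  define \<sigma> where "\<sigma> = (\<Sum>n. (renewal_mass n)\<^sup>2) + 1"
  have cond: "(0 < \<alpha> \<and> \<alpha> < 1 / 2) \<or>
      (\<alpha> = 1 / 2 \<and> summable (\<lambda>n. 1 / (real (Suc n) * ((1 / \<rho>) * L (real (Suc n)))\<^sup>2)))"
    using assms(5)
  proof (rule disj_forward)
    assume a: "\<alpha> = 1 / 2 \<and> summable (\<lambda>n. 1 / (real (Suc n) * (L (real (Suc n)))\<^sup>2))"
    then have "summable (\<lambda>n. \<rho>\<^sup>2 * (1 / (real (Suc n) * (L (real (Suc n)))\<^sup>2)))" by (intro summable_mult) auto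
    moreover have "1 / (real (Suc n) * ((1 / \<rho>) * L (real (Suc n)))\<^sup>2) = \<rho>\<^sup>2 * (1 / (real (Suc n) * (L (real (Suc n)))\<^sup>2))" for n
      using \<rho>0 by (simp add: power_mult_distrib power_divide)
    ultimately show "\<alpha> = 1 / 2 \<and> summable (\<lambda>n. 1 / (real (Suc n) * ((1 / \<rho>) * L (real (Suc n)))\<^sup>2))"
      using a by simp
  qed
  have u2: "summable (\<lambda>n. (renewal_mass n)\<^sup>2)" by (rule renewal_mass_square_summable[OF cond])
  have \<sigma>: "\<sigma> > 0" "(\<Sum>k=1..n. (pinned_partition K (\<lambda>_. 1) k)\<^sup>2) \<le> \<sigma>" for n
  proof -
    show "\<sigma> > 0" unfolding \<sigma>_def using suminf_nonneg[OF u2] by (simp add: add_nonneg_pos)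
    have "(\<Sum>k=1..n. (renewal_mass k)\<^sup>2) \<le> (\<Sum>n. (renewal_mass n)\<^sup>2)" by (rule sum_le_suminf[OF u2]) auto
    then show "(\<Sum>k=1..n. (pinned_partition K (\<lambda>_. 1) k)\<^sup>2) \<le> \<sigma>" unfolding \<sigma>_def renewal_mass_def by simp
  qed
  define D where "D = (\<integral>y. exp (\<omega> 1 y) \<partial>Q) - 1"
  have D: "D \<ge> 0" using K.mgf_ge_1[of 1] by (simp add: D_def)
  (* Such beta satisfy the smallness condition of the second moment bound; adding 1 to D avoids a division
     by zero. *)
  define \<beta>\<^sub>2 where "\<beta>\<^sub>2 = min (1 / 2) (1 / (4 * \<sigma> * (D + 1)))"
  have \<beta>2: "\<beta>\<^sub>2 > 0" using \<sigma>(1) D by (simp add: \<beta>\<^sub>2_def)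
  have lower: "\<forall>\<^sub>F v in at_right 0. 1 / 2 * v powr (1 / a) \<le> K.free_energy \<beta> (- K.logmgf \<beta> + v)"
    if \<beta>: "\<beta> \<in> {0..\<beta>\<^sub>2}" and a: "0 < a" "a < \<alpha>" for \<beta> a
  proof -
    have "(a + \<alpha>) / 2 < \<alpha>" "a < (a + \<alpha>) / 2" using a by simp_all
    moreover have "\<alpha> < 1" using assms(5) by auto
    ultimately obtain C where C: "C > 0" "\<And>N. (\<Sum>m\<le>N. tail K m) / real (N + 1) \<le> C * real (N + 1) powr (- ((a + \<alpha>) / 2))"
      using mean_tail_upper[of "(a + \<alpha>) / 2"] a by auto
    have "\<beta> * (4 * \<sigma> * (D + 1)) \<le> 1"
      using \<beta> \<sigma>(1) D by (auto simp: \<beta>\<^sub>2_def pos_le_divide_eq)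
    moreover have "\<beta> * (4 * \<sigma> * D) \<le> \<beta> * (4 * \<sigma> * (D + 1))"
      using \<beta> \<sigma>(1) by (intro mult_left_mono) auto
    ultimately have "4 * \<beta> * \<sigma> * D \<le> 1" by (simp add: mult_ac)
    then have "\<forall>\<^sub>F v in at_right 0. v powr (1 / a) / 2 \<le> K.free_energy \<beta> (- K.logmgf \<beta> + v)"
      using \<beta> \<open>a < (a + \<alpha>) / 2\<close> a
      by (intro K.free_energy_lower_exponent[OF \<sigma> _ _ _ C]) (auto simp: D_def \<beta>\<^sub>2_def)
    then show ?thesis by simp
  qed
  have upper: "\<exists>C>0. \<forall>\<^sub>F v in at_right 0. K.free_energy \<beta> (- K.logmgf \<beta> + v) \<le> C * v powr (1 / a)"
    if \<beta>: "\<beta> \<ge> 0" and a: "\<alpha> < a" for \<beta> a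
  proof -
    obtain c where c: "c > 0" "\<And>s n. 0 < s \<Longrightarrow> s \<le> 1 \<Longrightarrow> (\<Sum>k=1..n. K k * exp (- s * real k)) \<le> 1 - c * s powr a"
      using laplace_upper[OF a] by blast
    have a0: "a > 0" using a \<alpha>0 by simp
    have "K.free_energy \<beta> (- K.logmgf \<beta> + v) \<le> (1 / c) powr (1 / a) * v powr (1 / a)" if v: "0 < v" "v < c" for v
    proof -
      define s where "s = (v / c) powr (1 / a)"
      have s: "0 < s" "s \<le> 1" using v c a0 by (auto simp: s_def powr_le_one_le intro!: powr_le1)
      have "c * s powr a = v" using v c a0 by (simp add: s_def powr_powr)
      then have "(\<Sum>k=1..n. K k * exp (- s * real k)) \<le> exp (- (- K.logmgf \<beta> + v + K.logmgf \<beta>))" for n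
        using c(2)[OF s, of n] exp_ge_add_one_self[of "- v"] by simp
      then have "K.free_energy \<beta> (- K.logmgf \<beta> + v) \<le> s" by (rule K.free_energy_le[OF \<beta>])
      also have "s = (1 / c) powr (1 / a) * v powr (1 / a)" using v c by (simp add: s_def powr_mult[symmetric])
      finally show ?thesis .
    qed
    then have "\<forall>\<^sub>F v in at_right 0. K.free_energy \<beta> (- K.logmgf \<beta> + v) \<le> (1 / c) powr (1 / a) * v powr (1 / a)"
      using c(1) by (intro eventually_at_rightI[of 0 c]) auto
    moreover have "(1 / c) powr (1 / a) > 0" using c(1) by simp
    ultimately show ?thesis by blast
  qed
  have pos: "K.free_energy \<beta> (- K.logmgf \<beta> + v) > 0 \<longleftrightarrow> v > 0" if \<beta>: "\<beta> \<in> {0..\<beta>\<^sub>2}" for \<beta> v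
  proof
    assume v: "v > 0"
    have l: "\<forall>\<^sub>F v' in at_right 0. 1 / 2 * v' powr (1 / (\<alpha> / 2)) \<le> K.free_energy \<beta> (- K.logmgf \<beta> + v')"
      by (rule lower[OF \<beta>]) (use \<alpha>0 in auto)
    have "\<forall>\<^sub>F v' in at_right 0. 0 < v' \<and> v' < v" by (rule eventually_at_rightI[of 0 v]) (use v in auto)
    then have "\<forall>\<^sub>F v' in at_right 0. 0 < v' \<and> v' < v \<and> 1 / 2 * v' powr (1 / (\<alpha> / 2)) \<le> K.free_energy \<beta> (- K.logmgf \<beta> + v')"
      using l by eventually_elim auto
    then obtain v' where v': "0 < v'" "v' < v" "1 / 2 * v' powr (1 / (\<alpha> / 2)) \<le> K.free_energy \<beta> (- K.logmgf \<beta> + v')"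
      using eventually_happens[of _ "at_right (0::real)"] by auto
    have "0 < 1 / 2 * v' powr (1 / (\<alpha> / 2))" using v' by simp
    also have "\<dots> \<le> K.free_energy \<beta> (- K.logmgf \<beta> + v')" by (rule v')
    also have "\<dots> \<le> K.free_energy \<beta> (- K.logmgf \<beta> + v)" using v' by (intro K.free_energy_mono) auto
    finally show "K.free_energy \<beta> (- K.logmgf \<beta> + v) > 0" .
  next
    assume p: "K.free_energy \<beta> (- K.logmgf \<beta> + v) > 0"
    show "v > 0"
    proof (rule ccontr)
      assume "\<not> v > 0"
      then have "(\<Sum>k=1..n. K k * exp (- 0 * real k)) \<le> exp (- (- K.logmgf \<beta> + v + K.logmgf \<beta>))" for n
      proof -
        have "(\<Sum>k=1..n. K k * exp (- 0 * real k)) \<le> 1" using tail_nonneg[of n] by (simp add: tail_def)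
        also have "1 \<le> exp (- (- K.logmgf \<beta> + v + K.logmgf \<beta>))" using \<open>\<not> v > 0\<close> by simp
        finally show ?thesis .
      qed
      then have "K.free_energy \<beta> (- K.logmgf \<beta> + v) \<le> 0" by (rule K.free_energy_le[rotated]) (use \<beta> in auto)
      then show False using p by simp
    qed
  qed
  have "quenched_critical_point P \<tau> Q \<omega> \<beta> = annealed_critical_point P \<tau> Q \<omega> \<beta> \<and>
    ((\<lambda>h. ln (quenched_free_energy P \<tau> Q \<omega> \<beta> h) / ln (h - annealed_critical_point P \<tau> Q \<omega> \<beta>))
      \<longlongrightarrow> 1 / \<alpha>) (at_right (annealed_critical_point P \<tau> Q \<omega> \<beta>))" if \<beta>: "\<beta> \<in> {0..\<beta>\<^sub>2}" for \<beta>
  proof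
    (* The candidate for both critical points. *)
    define hc where "hc = - ln \<rho> - K.logmgf \<beta>"
    have "quenched_free_energy P \<tau> Q \<omega> \<beta> h > 0 \<longleftrightarrow> h > hc" for h
    proof -
      have e: "- K.logmgf \<beta> + (h - hc) = h + ln \<rho>" by (simp add: hc_def)
      show ?thesis using pos[OF \<beta>, of "h - hc", unfolded e] by (simp add: quenched)
    qed
    then have q: "quenched_critical_point P \<tau> Q \<omega> \<beta> = hc"
      by (simp add: quenched_critical_point_def flip: greaterThan_def)
    have "annealed_free_energy P \<tau> Q \<omega> \<beta> h > 0 \<longleftrightarrow> h > hc" for h
    proof -
      have \<beta>0: "\<beta> \<ge> 0" "0 \<in> {0..\<beta>\<^sub>2}" using \<beta> \<beta>2 by auto
      have e: "- K.logmgf 0 + (h - hc) = h + K.logmgf \<beta> + ln \<rho>" by (simp add: hc_def logmgf0)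
      show ?thesis using pos[OF \<beta>0(2), of "h - hc", unfolded e] by (simp add: annealed[OF \<beta>0(1)])
    qed
    then have an: "annealed_critical_point P \<tau> Q \<omega> \<beta> = hc"
      by (simp add: annealed_critical_point_def flip: greaterThan_def)
    show "quenched_critical_point P \<tau> Q \<omega> \<beta> = annealed_critical_point P \<tau> Q \<omega> \<beta>"
      using q an by simp
    have "((\<lambda>v. ln (K.free_energy \<beta> (- K.logmgf \<beta> + v)) / ln v) \<longlongrightarrow> 1 / \<alpha>) (at_right 0)"
    proof (rule exponent_limit[OF \<alpha>0])
      show "\<exists>c>0. \<forall>\<^sub>F v in at_right 0. c * v powr (1 / a) \<le> K.free_energy \<beta> (- K.logmgf \<beta> + v)" if "0 < a" "a < \<alpha>" for a
        using lower[OF \<beta> that] by (intro exI[of _ "1 / 2"]) auto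
      show "\<exists>C>0. \<forall>\<^sub>F v in at_right 0. K.free_energy \<beta> (- K.logmgf \<beta> + v) \<le> C * v powr (1 / a)" if "\<alpha> < a" for a
        using upper[OF _ that] \<beta> by auto
    qed
    then show "((\<lambda>h. ln (quenched_free_energy P \<tau> Q \<omega> \<beta> h) / ln (h - annealed_critical_point P \<tau> Q \<omega> \<beta>))
      \<longlongrightarrow> 1 / \<alpha>) (at_right (annealed_critical_point P \<tau> Q \<omega> \<beta>))"
      unfolding an quenched at_right_to_0[of hc] filterlim_filtermap
      by (simp add: hc_def algebra_simps)
  qed
  then show ?thesis using \<beta>2 by blast
qed

end
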